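(* Let $\lambda>0$, $1<p<\infty$, $\Lambda\in(0,1)$, $\mathcal S$ a $\Lambda$-sparse family of dyadic cubes in $(\mathbb R_+,|\cdot|,\mu)$, and $b\in{\rm BMO}_{\triangle_\lambda}(\mathbb R_+)$. Then for every $w\in\widetilde A_{p,\lambda-\frac12}$, $$\|\mathcal A_{\mathcal S,b}\|_{L^p(w\,dx)\to L^p(w\,dx)},\ \|\mathcal A^*_{\mathcal S,b}\|_{L^p(w\,dx)\to L^p(w\,dx)}\le C\,\|b\|_{{\rm BMO}_{\triangle_\lambda}(\mathbb R_+)}\,[w]_{\widetilde A_{p,\lambda-\frac12}}^{2\max\{1,\frac1{p-1}\}},$$ with $C$ depending only on $p,\lambda,\Lambda$ (and the dyadic system).
   Context: Fix $\lambda>0$. On $\mathbb R_+=(0,\infty)$ let $d\mu(x)=x^{2\lambda}dx$; intervals are $B=(a,b)\subset\mathbb R_+$; $p'=p/(p-1)$; $L^p(w\,dx)=L^p(\mathbb R_+,w\,dx)$. For $1<p<\infty$, $w\ge0$ measurable belongs to $\widetilde A_{p,\lambda-\frac12}$ if $[w]_{\widetilde A_{p,\lambda-\frac12}}:=\sup_{B}\big(\frac1{\mu(B)}\int_B w(t)dt\big)\big(\frac1{\mu(B)}\int_B t^{2\lambda p'}w(t)^{-\frac1{p-1}}dt\big)^{p-1}<\infty$. ${\rm BMO}_{\triangle_\lambda}(\mathbb R_+)$ is the set of $f\in L^1_{loc}(\mathbb R_+,\mu)$ with $\|f\|_{{\rm BMO}_{\triangle_\lambda}}:=\sup_B\frac1{\mu(B)}\int_B|f-f_B|\,d\mu<\infty$,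 $f_B=\frac1{\mu(B)}\int_Bf\,d\mu$. $\mathcal D$ is a fixed system of dyadic cubes on the space of homogeneous type $(\mathbb R_+,|\cdot|,\mu)$. $\mathcal S\subset\mathcal D$ is $\Lambda$-sparse if for each $Q\in\mathcal S$ there is measurable $E_Q\subset Q$ with $\mu(E_Q)\ge\Lambda\mu(Q)$ and the $E_Q$ have finite overlap. $\mathcal A_{\mathcal S,b}f(x)=\sum_{Q\in\mathcal S}\frac{1}{\mu(Q)}|b(x)-b_Q|\int_Q f\,d\mu\cdot\chi_Q(x)$ and $\mathcal A^*_{\mathcal S,b}f(x)=\sum_{Q\in\mathcal S}\frac1{\mu(Q)}\int_Q|b(t)-b_Q|f(t)\,d\mu(t)\cdot\chi_Q(x)$.
   Formalization: "Finite overlap" is read as: each point lies in at most N of the sets E_Q, and C may also depend on N (with unrestricted overlap no such C exists); integrals in the adjoint operator that fail to converge are read as 0, which a truncation argument shows does not occur. *)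

theory Defs
  imports "HOL-Analysis.Analysis"
begin

definition mu_lam :: "real \<Rightarrow> real measure" where
  "mu_lam lam = density lborel (\<lambda>t. ennreal (indicator {0<..} t * t powr (2 * lam)))"

definition avg_mu :: "real \<Rightarrow> real set \<Rightarrow> (real \<Rightarrow> real) \<Rightarrow> real" where
  "avg_mu lam B f = (\<integral>t\<in>B. f t \<partial>mu_lam lam) / measure (mu_lam lam) B"

definition intervals_Rplus :: "real set set" where
  "intervals_Rplus = {{a<..<b} | a b. 0 \<le> a \<and> a < b}"

definition bmo_norm :: "real \<Rightarrow> (real \<Rightarrow> real) \<Rightarrow> real" where
  "bmo_norm lam f = (SUP B\<in>intervals_Rplus. avg_mu lam B (\<lambda>t. \<bar>f t - avg_mu lam B f\<bar>))"

definition in_BMO :: "real \<Rightarrow> (real \<Rightarrow> real) \<Rightarrow> bool" where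
  "in_BMO lam f \<longleftrightarrow> f \<in> borel_measurable borel
     \<and> (\<forall>B\<in>intervals_Rplus. set_integrable (mu_lam lam) B f)
     \<and> bdd_above ((\<lambda>B. avg_mu lam B (\<lambda>t. \<bar>f t - avg_mu lam B f\<bar>)) ` intervals_Rplus)"

definition Ap_char :: "real \<Rightarrow> real \<Rightarrow> (real \<Rightarrow> real) \<Rightarrow> real set \<Rightarrow> real" where
  "Ap_char lam p w B =
     ((\<integral>t\<in>B. w t \<partial>lborel) / measure (mu_lam lam) B) *
     ((\<integral>t\<in>B. t powr (2 * lam * (p / (p - 1))) * w t powr (- 1 / (p - 1)) \<partial>lborel)
        / measure (mu_lam lam) B) powr (p - 1)"

definition Ap_const :: "real \<Rightarrow> real \<Rightarrow> (real \<Rightarrow> real) \<Rightarrow> real" where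
  "Ap_const lam p w = (SUP B\<in>intervals_Rplus. Ap_char lam p w B)"

text \<open>Membership: w is a nonnegative measurable function, positive a.e. on R_+
  (otherwise w^(-1/(p-1)) would be infinite on a set of positive measure), both
  integrals in the characteristic are finite on every interval, and the supremum is finite.\<close>
definition in_Ap_tilde :: "real \<Rightarrow> real \<Rightarrow> (real \<Rightarrow> real) \<Rightarrow> bool" where
  "in_Ap_tilde lam p w \<longleftrightarrow> w \<in> borel_measurable borel
     \<and> (\<forall>t>0. w t \<ge> 0)
     \<and> (AE t in lborel. t > 0 \<longrightarrow> w t > 0)
     \<and> (\<forall>B\<in>intervals_Rplus. set_integrable lborel B w
          \<and> set_integrable lborel B (\<lambda>t. t powr (2 * lam * (p / (p - 1))) * w t powr (- 1 / (p - 1))))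
     \<and> bdd_above (Ap_char lam p w ` intervals_Rplus)"

definition dyadic_system ::
  "real \<Rightarrow> real \<Rightarrow> real \<Rightarrow> (int \<Rightarrow> real set set) \<Rightarrow> bool" where
  "dyadic_system \<delta> c0 C0 D \<longleftrightarrow>
     0 < \<delta> \<and> \<delta> < 1 \<and> 0 < c0 \<and> c0 \<le> C0
     \<and> (\<forall>k. \<forall>Q\<in>D k. Q \<subseteq> {0<..} \<and> Q \<in> sets borel)
     \<and> (\<forall>k. \<Union>(D k) = {0<..})
     \<and> (\<forall>k. \<forall>Q\<in>D k. \<forall>Q'\<in>D k. Q \<noteq> Q' \<longrightarrow> Q \<inter> Q' = {})
     \<and> (\<forall>k l. k \<le> l \<longrightarrow> (\<forall>Q\<in>D l. \<forall>P\<in>D k. Q \<subseteq> P \<or> Q \<inter> P = {}))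
     \<and> (\<forall>k. \<forall>Q\<in>D k. \<exists>z\<in>Q. ball z (c0 * \<delta> powi k) \<inter> {0<..} \<subseteq> Q
                              \<and> Q \<subseteq> ball z (C0 * \<delta> powi k))"

definition dyadic_cubes :: "(int \<Rightarrow> real set set) \<Rightarrow> real set set" where
  "dyadic_cubes D = (\<Union>k. D k)"

definition sparse :: "real \<Rightarrow> real \<Rightarrow> nat \<Rightarrow> (int \<Rightarrow> real set set) \<Rightarrow> real set set \<Rightarrow> bool" where
  "sparse lam \<Lambda> N D S \<longleftrightarrow> S \<subseteq> dyadic_cubes D \<and>
     (\<exists>E. (\<forall>Q\<in>S. E Q \<subseteq> Q \<and> E Q \<in> sets borel
                  \<and> measure (mu_lam lam) (E Q) \<ge> \<Lambda> * measure (mu_lam lam) Q)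
        \<and> (\<forall>x. finite {Q\<in>S. x \<in> E Q} \<and> card {Q\<in>S. x \<in> E Q} \<le> N))"

definition comm_term :: "real \<Rightarrow> (real \<Rightarrow> real) \<Rightarrow> (real \<Rightarrow> real) \<Rightarrow> real \<Rightarrow> real set \<Rightarrow> real" where
  "comm_term lam b f x Q =
      (1 / measure (mu_lam lam) Q) * \<bar>b x - avg_mu lam Q b\<bar> * (\<integral>t\<in>Q. f t \<partial>mu_lam lam)
      * indicator Q x"

definition comm_adj_term :: "real \<Rightarrow> (real \<Rightarrow> real) \<Rightarrow> (real \<Rightarrow> real) \<Rightarrow> real \<Rightarrow> real set \<Rightarrow> real" where
  "comm_adj_term lam b f x Q =
      (1 / measure (mu_lam lam) Q) * (\<integral>t\<in>Q. \<bar>b t - avg_mu lam Q b\<bar> * f t \<partial>mu_lam lam)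
      * indicator Q x"

definition sparse_comm :: "real \<Rightarrow> real set set \<Rightarrow> (real \<Rightarrow> real) \<Rightarrow> (real \<Rightarrow> real) \<Rightarrow> real \<Rightarrow> real" where
  "sparse_comm lam S b f x = (\<Sum>\<^sub>\<infinity>Q\<in>S. comm_term lam b f x Q)"

definition sparse_comm_adj :: "real \<Rightarrow> real set set \<Rightarrow> (real \<Rightarrow> real) \<Rightarrow> (real \<Rightarrow> real) \<Rightarrow> real \<Rightarrow> real" where
  "sparse_comm_adj lam S b f x = (\<Sum>\<^sub>\<infinity>Q\<in>S. comm_adj_term lam b f x Q)"

definition in_Lp_w :: "real \<Rightarrow> (real \<Rightarrow> real) \<Rightarrow> (real \<Rightarrow> real) \<Rightarrow> bool" where
  "in_Lp_w p w f \<longleftrightarrow> f \<in> borel_measurable borel \<and>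
     (\<integral>\<^sup>+x\<in>{0<..}. ennreal (\<bar>f x\<bar> powr p * w x) \<partial>lborel) < \<infinity>"

definition Lp_w_pow :: "real \<Rightarrow> (real \<Rightarrow> real) \<Rightarrow> (real \<Rightarrow> real) \<Rightarrow> ennreal" where
  "Lp_w_pow p w f = (\<integral>\<^sup>+x\<in>{0<..}. ennreal (\<bar>f x\<bar> powr p * w x) \<partial>lborel)"

end

theory Submission
  imports Defs
begin

text \<open>
  With \<open>v(x) = w(x) x\<^sup>-\<^sup>2\<^sup>\<lambda>\<close> one has \<open>w dx = v d\<mu>\<close>, and the modified condition on \<open>w\<close> is the ordinary \<open>A\<^sub>p\<close> condition
  for \<open>v\<close> with respect to \<open>\<mu>\<close>, with dual weight \<open>s\<close> satisfying \<open>v\<^sup>1\<^sup>/\<^sup>p s\<^sup>1\<^sup>/\<^sup>q = 1\<close>. Everything is phrased through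
  bilinear forms of nonnegative functions normalised in \<open>L\<^sup>p(v)\<close> and \<open>L\<^sup>q(s)\<close>.

  The form of a sparse averaging operator is bounded by the characteristic to the power
  \<open>max 1 (1/(p-1))\<close>: for \<open>p \<ge> 2\<close> the masses of a cube are traded for those of its sparse part, and Young's
  inequality with the Carleson embedding for both weights concludes; \<open>p < 2\<close> follows by symmetry.

  For a finite family \<open>F\<close> of cubes let \<open>T\<close> be the stopping cubes of \<open>b\<close> generated by the maximal cubes of \<open>F\<close>
  (stop when the mean of \<open>b\<close> has moved by twice the oscillation bound). Then \<open>T\<close> is sparse and
  \<open>|b - b\<^sub>Q|\<close> is dominated on \<open>Q \<in> F\<close> by the norm of \<open>b\<close> times one plus the number of cubes of \<open>T\<close> inside
  \<open>Q\<close> around the point. Hence the adjoint commutator form is at most a multiple of the norm of \<open>b\<close> times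
  \<open>\<langle>A\<^sub>F f, g\<rangle> + \<langle>A\<^sub>F A\<^sub>T f, g\<rangle>\<close>, which produces the square of the sparse bound; the other operator has the
  transposed form.
\<close>

section \<open>Powers of extended nonnegative reals and the Carleson embedding\<close>

text \<open>The cubes of the sparse family need not follow the variation of b, so the deviation |b -
  b_Q| calls for a second family, adapted to b. That family is built downwards from maximal cubes,
  which an infinite family may fail to have; the forms are therefore bounded on finite subfamilies,
  with constants that do not see the subfamily. The Carleson embedding stands in for bounds of
  weighted maximal functions, and testing against an explicit extremal function for the duality of
  L^p spaces. Values in \<open>ennreal\<close> postpone every question of convergence to the end,
  where a finite norm restores summability.

  The hypotheses speak of intervals, the argument of cubes. Every cube lies in an interval of at
  most \<kappa> times its measure, which costs 2 \<kappa> in the oscillation and \<kappa>^p in the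
  characteristic. The stopping rule needs a strictly positive oscillation bound; a function of norm
  0 is reached by adding e > 0 to the bound and letting e tend to 0.\<close>

definition epow :: "ennreal \<Rightarrow> real \<Rightarrow> ennreal" where
  "epow x p = (if x = top then top else ennreal (enn2real x powr p))"

lemma epow_ennreal [simp]: "0 \<le> x \<Longrightarrow> epow (ennreal x) p = ennreal (x powr p)"
  by (simp add: epow_def)

lemma epow_top [simp]: "epow top p = top"
  by (simp add: epow_def)

lemma epow_0 [simp]: "epow 0 p = 0"
  by (simp add: epow_def)

lemma epow_mono: "0 \<le> p \<Longrightarrow> x \<le> y \<Longrightarrow> epow x p \<le> epow y p"
  by (cases x; cases y) (auto simp: top_unique intro!: ennreal_leI powr_mono2)

text \<open>The conventions \<open>epow 0 p = 0\<close> and \<open>epow top p = top\<close> for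
  every real p let this law, \<open>epow_epow\<close> and \<open>epow_add_one\<close> hold without
  side conditions on finiteness or on the sign of the exponent.\<close>

lemma epow_mult: "epow (x * y) p = epow x p * epow y p"
proof (cases x; cases y)
  fix a b :: real assume "0 \<le> a" "x = ennreal a" "0 \<le> b" "y = ennreal b"
  then show ?thesis
    by (simp add: ennreal_mult[symmetric] powr_mult)
qed (auto simp: epow_def ennreal_mult_top ennreal_top_mult)

lemma epow_epow: "epow (epow x a) b = epow x (a * b)"
  by (cases x) (auto simp: powr_powr)

lemma epow_add_one: "x * epow x a = epow x (a + 1)"
proof (cases x)
  case (real r)
  then show ?thesis
    by (cases "r = 0") (auto simp: ennreal_mult[symmetric] powr_add mult.commute)
qed simp

lemma borel_measurable_epow [measurable (raw)]:
  assumes [measurable]: "f \<in> borel_measurable M"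
  shows "(\<lambda>x. epow (f x) p) \<in> borel_measurable M"
  unfolding epow_def by measurable

lemma epow_Young:
  assumes "1 < p" "1 < q" "1 / p + 1 / q = 1"
  shows "a * b \<le> ennreal (1 / p) * epow a p + ennreal (1 / q) * epow b q"
proof (cases a; cases b)
  fix x y assume "0 \<le> x" "a = ennreal x" "0 \<le> y" "b = ennreal y"
  then show ?thesis
    using Youngs_inequality[OF assms, of x y] assms
    by (simp add: ennreal_mult[symmetric] flip: ennreal_plus)
qed (use assms in \<open>auto simp: ennreal_mult_top\<close>)

lemma ennreal_eq_top_of_ge:
  assumes "\<And>r. 0 \<le> r \<Longrightarrow> ennreal r \<le> y"
  shows "y = top"
proof (rule ccontr)
  assume "y \<noteq> top"
  then obtain c where "0 \<le> c" "y = ennreal c" by (cases y) auto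
  with assms[of "c + 1"] show False by simp
qed

text \<open>The inner integral of the layer-cake formula, with an upper limit y that may be
  infinite; it is used for a = p and for a = p - 1. For infinite y, truncation at height (r a)^(1/a)
  already yields any given r.\<close>

lemma nn_integral_powr_below:
  fixes a :: real and y :: ennreal
  assumes "0 < a"
  shows "(\<integral>\<^sup>+t. ennreal (t powr (a - 1)) * indicator {t. 0 < t \<and> ennreal t < y} t \<partial>lborel)
           = ennreal (1 / a) * epow y a"
proof -
  have fin: "(\<integral>\<^sup>+t. ennreal (t powr (a - 1)) * indicator {t. 0 < t \<and> ennreal t < ennreal r} t \<partial>lborel)
           = ennreal (r powr a / a)" if r: "0 \<le> r" for r
  proof -
    have "((\<lambda>x. x powr (a - 1)) has_integral (r powr (a - 1 + 1) / (a - 1 + 1))) {0..r}"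
      by (rule has_integral_powr_from_0) (use assms r in auto)
    then have "((\<lambda>x. if x \<in> {0..r} then x powr (a - 1) else 0) has_integral (r powr a / a)) UNIV"
      by (subst has_integral_restrict_UNIV) simp
    then have "((\<lambda>x. indicator {0..r} x * x powr (a - 1)) has_integral (r powr a / a)) UNIV"
      by (rule has_integral_eq[rotated]) (auto simp: indicator_def)
    then have "(\<integral>\<^sup>+t. ennreal (indicator {0..r} t * t powr (a - 1)) \<partial>lborel) = ennreal (r powr a / a)"
      by (intro nn_integral_has_integral_lborel) (auto intro!: measurable_If simp: indicator_def)
    moreover have "AE t in lborel. t \<noteq> 0 \<and> t \<noteq> r"
      using AE_lborel_singleton by (auto simp: AE_conj_iff)
    then have "(\<integral>\<^sup>+t. ennreal (t powr (a - 1)) * indicator {t. 0 < t \<and> ennreal t < ennreal r} t \<partial>lborel)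
      = (\<integral>\<^sup>+t. ennreal (indicator {0..r} t * t powr (a - 1)) \<partial>lborel)"
      by (intro nn_integral_cong_AE) (auto simp: indicator_def ennreal_less_iff)
    ultimately show ?thesis by simp
  qed
  show ?thesis
  proof (cases y)
    case (real r)
    then show ?thesis using fin[of r] assms by (simp add: ennreal_mult[symmetric])
  next
    case top
    let ?I = "\<integral>\<^sup>+t. ennreal (t powr (a - 1)) * indicator {t. 0 < t \<and> ennreal t < top} t \<partial>lborel"
    have "ennreal r \<le> ?I" if "0 \<le> r" for r
    proof -
      have "ennreal r = ennreal (((r * a) powr (1 / a)) powr a / a)"
        using that assms by (simp add: powr_powr)
      also have "\<dots> = (\<integral>\<^sup>+t. ennreal (t powr (a - 1)) * indicator {t. 0 < t \<and> ennreal t < ennreal ((r * a) powr (1 / a))} t \<partial>lborel)"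
        by (rule fin[symmetric]) simp
      also have "\<dots> \<le> ?I"
        by (intro nn_integral_mono) (auto simp: indicator_def)
      finally show ?thesis .
    qed
    then have "?I = top"
      by (rule ennreal_eq_top_of_ge)
    then show ?thesis using top assms by (simp add: ennreal_mult_top)
  qed
qed

text \<open>Level-set proof: at height \<open>t\<close> only the maximal members with average above \<open>t\<close> matter, and
  on each of those the part of \<open>f\<close> above \<open>t / 2\<close> carries at least half of the average.\<close>

lemma carleson_embedding:
  fixes f :: "'a \<Rightarrow> ennreal" and E :: "'a set \<Rightarrow> 'a set"
  assumes "sigma_finite_measure M" and p: "1 < p"
    and fin: "finite F"
    and meas: "\<And>Q. Q \<in> F \<Longrightarrow> Q \<in> sets M"
    and pos: "\<And>Q. Q \<in> F \<Longrightarrow> 0 < emeasure M Q" and fnt: "\<And>Q. Q \<in> F \<Longrightarrow> emeasure M Q < top"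
    and lam: "\<And>P Q. P \<in> F \<Longrightarrow> Q \<in> F \<Longrightarrow> P \<subseteq> Q \<or> Q \<subseteq> P \<or> P \<inter> Q = {}"
    and E: "\<And>Q. Q \<in> F \<Longrightarrow> E Q \<in> sets M" "\<And>Q. Q \<in> F \<Longrightarrow> E Q \<subseteq> Q"
    and overlap: "\<And>x. card {Q\<in>F. x \<in> E Q} \<le> N"
    and f [measurable]: "f \<in> borel_measurable M"
  shows "(\<Sum>Q\<in>F. emeasure M (E Q) * epow ((set_nn_integral M Q f) / emeasure M Q) p)
     \<le> ennreal (real N * 2 powr p * p / (p - 1)) * (\<integral>\<^sup>+x. epow (f x) p \<partial>M)"
proof -
  interpret sigma_finite_measure M by fact
  define a where "a Q = (set_nn_integral M Q f) / emeasure M Q" for Q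
  let ?h = "\<lambda>t x. f x * indicator {x. ennreal (t/2) < f x} x"
  let ?H = "\<lambda>t. (\<integral>\<^sup>+x. f x * indicator {x. ennreal (t/2) < f x} x \<partial>M)"
  let ?A = "\<lambda>Q t. ennreal p * (emeasure M (E Q) * (ennreal (t powr (p - 1)) * indicator {t. 0 < t \<and> ennreal t < a Q} t))"
  let ?B = "\<lambda>x t. ennreal (2 * p * N) * (f x * (ennreal (t powr (p - 2)) * indicator {t. 0 < t \<and> ennreal t < 2 * f x} t))"
  have level: "(\<Sum>Q\<in>{Q\<in>F. ennreal t < a Q}. emeasure M (E Q))
      \<le> of_nat N * (ennreal (2 / t) * ?H t)"
    if t: "0 < t" for t
  proof -
    define G where "G = {Q\<in>F. ennreal t < a Q}"
    define X where "X = {Q\<in>G. \<forall>P\<in>G. Q \<subseteq> P \<longrightarrow> P = Q}"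
    have finG: "finite G" and GF: "G \<subseteq> F" unfolding G_def using fin by auto
    have XG: "X \<subseteq> G" by (auto simp: X_def)
    have finX: "finite X" using XG finG by (rule finite_subset)
    have "\<exists>P\<in>X. Q \<subseteq> P" if "Q \<in> G" for Q
    proof -
      from finite_has_maximal2[OF finG that] obtain P where "P \<in> G" "Q \<subseteq> P" "\<forall>b\<in>G. P \<le> b \<longrightarrow> P = b"
        by blast
      then show ?thesis by (auto simp: X_def)
    qed
    then have cov: "\<Union>G \<subseteq> \<Union>X" by blast
    have disj: "disjoint_family_on (\<lambda>Q. Q) X"
      unfolding disjoint_family_on_def
    proof (intro ballI impI)
      fix P Q assume "P \<in> X" "Q \<in> X" "P \<noteq> Q"
      then have "P \<in> F" "Q \<in> F" "\<not> P \<subseteq> Q" "\<not> Q \<subseteq> P" using GF by (auto simp: X_def)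
      then show "P \<inter> Q = {}" using lam[of P Q] by simp
    qed
    have "(\<Sum>Q\<in>G. emeasure M (E Q)) = (\<Sum>Q\<in>G. \<integral>\<^sup>+x. indicator (E Q) x \<partial>M)"
      using E GF by (intro sum.cong) (auto simp: subset_eq)
    also have "\<dots> = (\<integral>\<^sup>+x. (\<Sum>Q\<in>G. indicator (E Q) x) \<partial>M)"
      using E GF by (intro nn_integral_sum[symmetric]) auto
    \<comment> \<open>Each \<open>E Q\<close> with Q in \<open>G\<close> lies in the union of the
      maximal members, and a point meets at most N of these sets. This is where the overlap bound
      enters.\<close>
    also have "\<dots> \<le> (\<integral>\<^sup>+x. of_nat N * indicator (\<Union>X) x \<partial>M)"
    proof (rule nn_integral_mono)
      fix x
      have "(\<Sum>Q\<in>G. indicator (E Q) x :: ennreal) = of_nat (card {Q\<in>G. x \<in> E Q})"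
        using finG by (simp add: indicator_def sum.If_cases Int_def)
      also have "\<dots> \<le> of_nat N * indicator (\<Union>X) x"
      proof (cases "x \<in> \<Union>X")
        case True
        have "card {Q\<in>G. x \<in> E Q} \<le> card {Q\<in>F. x \<in> E Q}"
          using GF fin by (intro card_mono) auto
        also have "\<dots> \<le> N" by (rule overlap)
        finally show ?thesis using True by simp
      next
        case False
        then have "{Q\<in>G. x \<in> E Q} = {}" using cov E GF by blast
        then have "card {Q\<in>G. x \<in> E Q} = 0" by (simp only: card.empty)
        then show ?thesis by simp
      qed
      finally show "(\<Sum>Q\<in>G. indicator (E Q) x :: ennreal) \<le> of_nat N * indicator (\<Union>X) x" .
    qed
    also have "\<dots> = of_nat N * emeasure M (\<Union>X)"
      using finX XG GF meas by (intro nn_integral_cmult_indicator sets.finite_Union) auto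
    also have "emeasure M (\<Union>X) = (\<Sum>Q\<in>X. emeasure M Q)"
      using XG GF meas by (intro sum_emeasure[OF _ disj finX, simplified, symmetric]) auto
    also have "\<dots> \<le> (\<Sum>Q\<in>X. ennreal (2 / t) * (\<integral>\<^sup>+x\<in>Q. ?h t x \<partial>M))"
    proof (rule sum_mono)
      fix Q assume "Q \<in> X"
      then have Q: "Q \<in> F" "ennreal t < a Q" using XG by (auto simp: G_def)
      then have Qm [measurable]: "Q \<in> sets M" using meas by auto
      obtain m where m: "emeasure M Q = ennreal m" "0 < m"
        using pos[OF Q(1)] fnt[OF Q(1)] by (cases "emeasure M Q") auto
      let ?J = "\<integral>\<^sup>+x\<in>Q. ?h t x \<partial>M"
      have "ennreal (t * m) \<le> a Q * ennreal m"
        using Q(2) t m by (simp add: ennreal_mult mult_right_mono)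
      also have "\<dots> = (set_nn_integral M Q f)"
        using m by (simp add: a_def divide_ennreal_def mult.assoc inverse_ennreal ennreal_mult[symmetric])
      \<comment> \<open>Where f is at most t/2 it contributes at most half of t m. Subtracting that
        half from the left side leaves the factor 2/t.\<close>
      also have "\<dots> \<le> (\<integral>\<^sup>+x. ?h t x * indicator Q x + ennreal (t/2) * indicator Q x \<partial>M)"
        by (intro nn_integral_mono) (auto simp: indicator_def)
      also have "\<dots> = ?J + ennreal (t/2) * emeasure M Q"
        by (subst nn_integral_add) (auto simp: nn_integral_cmult_indicator)
      also have "ennreal (t/2) * emeasure M Q = ennreal (t / 2 * m)"
        using m t by (simp add: ennreal_mult[symmetric])
      finally have *: "ennreal (t * m) \<le> ?J + ennreal (t / 2 * m)" .
      show "emeasure M Q \<le> ennreal (2 / t) * ?J"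
      proof (cases ?J)
        case (real j)
        with * t m have "t * m \<le> j + t / 2 * m"
          by (simp flip: ennreal_plus)
        then have "m \<le> 2 / t * j" using t by (simp add: field_simps)
        then show ?thesis using real t m by (simp add: ennreal_mult[symmetric])
      next
        case top
        then show ?thesis using t by (simp add: ennreal_mult_top)
      qed
    qed
    also have "\<dots> = ennreal (2 / t) * (\<integral>\<^sup>+x. (\<Sum>Q\<in>X. ?h t x * indicator Q x) \<partial>M)"
      using XG GF meas
      by (subst nn_integral_sum) (auto simp: sum_distrib_left)
    also have "\<dots> \<le> ennreal (2 / t) * ?H t"
    proof (intro mult_left_mono nn_integral_mono)
      fix x
      have "(\<Sum>Q\<in>X. indicator Q x :: ennreal) = indicator (\<Union>X) x"
      proof (cases "x \<in> \<Union>X")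
        case True
        then obtain P where P: "P \<in> X" "x \<in> P" by blast
        then have "(\<Sum>Q\<in>X. indicator Q x :: ennreal) = (\<Sum>Q\<in>{P}. indicator Q x)"
          using disj finX by (intro sum.mono_neutral_right) (auto simp: disjoint_family_on_def indicator_def)
        then show ?thesis using P True by simp
      next
        case False
        then have "(\<Sum>Q\<in>X. indicator Q x :: ennreal) = (\<Sum>Q\<in>X. 0)"
          by (intro sum.cong) auto
        then show ?thesis using False by simp
      qed
      then have "(\<Sum>Q\<in>X. ?h t x * indicator Q x)
          = ?h t x * indicator (\<Union>X) x"
        by (simp add: sum_distrib_left[symmetric])
      also have "\<dots> \<le> ?h t x"
        by (auto simp: indicator_def)
      finally show "(\<Sum>Q\<in>X. ?h t x * indicator Q x)
          \<le> ?h t x" .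
    qed simp
    finally show ?thesis
      unfolding G_def by (simp add: mult_left_mono)
  qed
  have "(\<Sum>Q\<in>F. emeasure M (E Q) * epow (a Q) p)
     = (\<Sum>Q\<in>F. \<integral>\<^sup>+t. ?A Q t \<partial>lborel)"
  proof (rule sum.cong[OF refl])
    fix Q
    have "epow (a Q) p = ennreal p * (ennreal (1/p) * epow (a Q) p)"
      using p by (simp add: ennreal_mult[symmetric] flip: mult.assoc)
    also have "ennreal (1/p) * epow (a Q) p = (\<integral>\<^sup>+t. ennreal (t powr (p - 1)) * indicator {t. 0 < t \<and> ennreal t < a Q} t \<partial>lborel)"
      using nn_integral_powr_below[of p "a Q"] p by simp
    finally show "emeasure M (E Q) * epow (a Q) p = (\<integral>\<^sup>+t. ?A Q t \<partial>lborel)"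
      by (simp add: nn_integral_cmult mult.left_commute)
  qed
  also have "\<dots> = (\<integral>\<^sup>+t. (\<Sum>Q\<in>F. ?A Q t) \<partial>lborel)"
    by (rule nn_integral_sum[symmetric]) simp
  also have "\<dots> \<le> (\<integral>\<^sup>+t. \<integral>\<^sup>+x. ?B x t \<partial>M \<partial>lborel)"
  proof (rule nn_integral_mono)
    fix t :: real
    show "(\<Sum>Q\<in>F. ?A Q t)
      \<le> (\<integral>\<^sup>+x. ?B x t \<partial>M)"
    proof (cases "0 < t")
      case False
      then show ?thesis by simp
    next
      case True
      \<comment> \<open>After the exchange of integrals t is the inner variable, so the level
        condition on f is turned into the upper limit 2 f(x) for t.\<close>
      have half: "ennreal (t/2) < y \<longleftrightarrow> ennreal t < 2 * y" for y
      proof (cases y)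
        case (real r)
        have "2 * ennreal r = ennreal (2 * r)" using real by (simp add: ennreal_mult)
        then show ?thesis using real True by (simp add: ennreal_less_iff) linarith
      qed (simp add: ennreal_mult_top)
      have tt: "t powr (p - 1) * (2 / t) = 2 * t powr (p - 2)"
        using True powr_diff[of t "p - 1" 1] by simp
      have "(\<Sum>Q\<in>F. ?A Q t)
        = ennreal p * ennreal (t powr (p - 1)) * (\<Sum>Q\<in>{Q\<in>F. ennreal t < a Q}. emeasure M (E Q))"
        unfolding sum_distrib_left using True fin
        by (intro sum.mono_neutral_cong_right) (auto simp: mult_ac indicator_def)
      also have "\<dots> \<le> ennreal p * ennreal (t powr (p - 1)) * (of_nat N * (ennreal (2 / t) * ?H t))"
        by (intro mult_left_mono level True) simp
      also have "\<dots> = ennreal (p * N * (t powr (p - 1) * (2 / t))) * ?H t"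
        using p True by (simp add: ennreal_mult ennreal_of_nat_eq_real_of_nat mult_ac del: times_divide_eq_right times_divide_eq_left)
      also have "\<dots> = ennreal (2 * p * N) * ennreal (t powr (p - 2)) * ?H t"
        unfolding tt using p by (simp add: ennreal_mult[symmetric] mult_ac)
      also have "\<dots> = (\<integral>\<^sup>+x. ennreal (2 * p * N) * ennreal (t powr (p - 2)) * (?h t x) \<partial>M)"
        by (rule nn_integral_cmult[symmetric]) measurable
      also have "\<dots> = (\<integral>\<^sup>+x. ?B x t \<partial>M)"
        using True by (intro nn_integral_cong) (auto simp: half indicator_def mult_ac)
      finally show ?thesis .
    qed
  qed
  also have "\<dots> = (\<integral>\<^sup>+x. \<integral>\<^sup>+t. ?B x t \<partial>lborel \<partial>M)"
  proof -
    interpret pair_sigma_finite M lborel ..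
    show ?thesis
      by (rule Fubini') (unfold indicator_def mem_Collect_eq, measurable)
  qed
  also have "\<dots> = (\<integral>\<^sup>+x. ennreal (real N * 2 powr p * p / (p - 1)) * epow (f x) p \<partial>M)"
  proof (rule nn_integral_cong)
    fix x
    have "(\<integral>\<^sup>+t. ?B x t \<partial>lborel)
      = ennreal (2 * p * N) * (f x * (\<integral>\<^sup>+t. (ennreal (t powr (p - 1 - 1)) * indicator {t. 0 < t \<and> ennreal t < 2 * f x} t) \<partial>lborel))"
      by (simp add: nn_integral_cmult)
    also have "\<dots> = ennreal (2 * p * N) * (f x * (ennreal (1 / (p - 1)) * epow (2 * f x) (p - 1)))"
      using p by (subst nn_integral_powr_below) auto
    also have "epow (2 * f x) (p - 1) = ennreal (2 powr (p - 1)) * epow (f x) (p - 1)"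
      by (metis epow_mult epow_ennreal ennreal_numeral zero_le_numeral)
    also have "ennreal (2 * p * N) * (f x * (ennreal (1 / (p - 1)) * (ennreal (2 powr (p - 1)) * epow (f x) (p - 1))))
       = ennreal (2 * p * N * (1 / (p - 1)) * 2 powr (p - 1)) * (f x * epow (f x) (p - 1))"
      using p by (simp add: ennreal_mult mult_ac del: times_divide_eq_right times_divide_eq_left)
    also have "2 * p * N * (1 / (p - 1)) * 2 powr (p - 1) = real N * 2 powr p * p / (p - 1)"
      using p by (simp add: powr_diff field_simps)
    finally show "(\<integral>\<^sup>+t. ?B x t \<partial>lborel)
       = ennreal (real N * 2 powr p * p / (p - 1)) * epow (f x) p"
      by (simp add: epow_add_one)
  qed
  also have "\<dots> = ennreal (real N * 2 powr p * p / (p - 1)) * (\<integral>\<^sup>+x. epow (f x) p \<partial>M)"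
    by (rule nn_integral_cmult) measurable
  finally show ?thesis unfolding a_def .
qed

text \<open>A countable sum is the supremum of its finite partial sums. Through this, arguments that
  need maximal cubes only have to treat finite families.\<close>

lemma nn_integral_count_space_le_finite_sums:
  fixes h :: "'i \<Rightarrow> ennreal"
  assumes "countable S" and le: "\<And>F. finite F \<Longrightarrow> F \<subseteq> S \<Longrightarrow> (\<Sum>i\<in>F. h i) \<le> C"
  shows "(\<integral>\<^sup>+i. h i \<partial>count_space S) \<le> C"
proof (cases "finite S")
  case True
  then show ?thesis using le by (simp add: nn_integral_count_space_finite)
next
  case False
  then have bij: "bij_betw (from_nat_into S) UNIV S"
    using assms(1) by (intro bij_betw_from_nat_into) auto
  then have inj: "inj (from_nat_into S)" by (rule bij_betw_imp_inj_on)
  have "(\<integral>\<^sup>+i. h i \<partial>count_space S) = (\<integral>\<^sup>+n. h (from_nat_into S n) \<partial>count_space UNIV)"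
    by (rule nn_integral_bij_count_space[OF bij, symmetric])
  also have "\<dots> = (\<Sum>n. h (from_nat_into S n))"
    by (rule nn_integral_count_space_nat)
  also have "\<dots> \<le> C"
  proof (rule suminf_le_const)
    fix n
    have "(\<Sum>i<n. h (from_nat_into S i)) = (\<Sum>i\<in>from_nat_into S ` {..<n}. h i)"
      by (subst sum.reindex) (auto intro: inj_on_subset[OF inj])
    also have "\<dots> \<le> C"
      using bij by (intro le) (auto simp: bij_betw_def)
    finally show "(\<Sum>i<n. h (from_nat_into S i)) \<le> C" .
  qed simp
  finally show ?thesis .
qed

lemma nn_integral_count_space_mono_set:
  fixes h :: "'i \<Rightarrow> ennreal"
  assumes "A \<subseteq> B"
  shows "(\<integral>\<^sup>+i. h i \<partial>count_space A) \<le> (\<integral>\<^sup>+i. h i \<partial>count_space B)"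
proof -
  have "(\<integral>\<^sup>+i. h i \<partial>count_space A) = (\<integral>\<^sup>+i. h i * indicator A i \<partial>count_space B)"
    using assms by (simp add: nn_integral_restrict_space[symmetric] restrict_count_space Int_absorb2 Int_absorb1)
  also have "\<dots> \<le> (\<integral>\<^sup>+i. h i \<partial>count_space B)"
    by (intro nn_integral_mono) (auto simp: indicator_def)
  finally show ?thesis .
qed

lemma sum_le_nn_integral_count_space:
  fixes h :: "'i \<Rightarrow> ennreal"
  assumes "finite F" "F \<subseteq> S"
  shows "(\<Sum>i\<in>F. h i) \<le> (\<integral>\<^sup>+i. h i \<partial>count_space S)"
  using nn_integral_count_space_mono_set[OF assms(2), of h] assms(1)
  by (simp add: nn_integral_count_space_finite)

lemma borel_measurable_nn_integral_count_space:
  assumes "countable I" and h: "\<And>i. i \<in> I \<Longrightarrow> h i \<in> borel_measurable M"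
  shows "(\<lambda>x. \<integral>\<^sup>+i. h i x \<partial>count_space I) \<in> borel_measurable M"
proof -
  interpret sigma_finite_measure "count_space I"
    using assms(1) by (rule sigma_finite_measure_count_space_countable)
  have "(\<lambda>z. h (snd z) (fst z)) \<in> borel_measurable (M \<Otimes>\<^sub>M count_space I)"
    by (intro measurable_compose_countable'[where g = snd and I = I and f = "\<lambda>i z. h i (fst z)"]
        measurable_compose[OF measurable_fst] h measurable_snd assms(1))
  then show ?thesis
    by (intro borel_measurable_nn_integral) (simp add: case_prod_beta')
qed

section \<open>Dual weights: testing and Hoelder's inequality\<close>

abbreviation Lp_pow :: "'a measure \<Rightarrow> real \<Rightarrow> ('a \<Rightarrow> real) \<Rightarrow> ('a \<Rightarrow> ennreal) \<Rightarrow> ennreal" where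
  "Lp_pow M p v f \<equiv> \<integral>\<^sup>+x. epow (f x) p * ennreal (v x) \<partial>M"

text \<open>The last assumption says s = v^(-1/(p-1)), in a form symmetric under exchanging (p, v)
  with (q, s); by \<open>swap\<close> every estimate then holds for the dual pair as well.
  Positivity at every point, rather than almost everywhere, lets the weights be divided by without
  exceptional sets.\<close>

locale dual_weights = sigma_finite_measure M for M :: "'a measure" +
  fixes p q :: real and v s :: "'a \<Rightarrow> real"
  assumes p_gt_1: "1 < p" and q_gt_1: "1 < q" and conj_exp: "1 / p + 1 / q = 1"
    and v_meas [measurable]: "v \<in> borel_measurable M"
    and s_meas [measurable]: "s \<in> borel_measurable M"
    and v_pos: "\<And>x. 0 < v x" and s_pos: "\<And>x. 0 < s x"
    and dual: "\<And>x. v x powr (1 / p) * s x powr (1 / q) = 1"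
begin

lemma swap: "dual_weights M q p s v"
proof unfold_locales
  show "1 / q + 1 / p = 1" using conj_exp by (subst add.commute)
  show "s x powr (1 / q) * v x powr (1 / p) = 1" for x using dual by (subst mult.commute)
qed (fact p_gt_1 q_gt_1 s_meas v_meas s_pos v_pos)+

lemma exp_eqs: "q * (p - 1) = p" "(p - 1) * (q - 1) = 1" "p / q = p - 1" "q / p = q - 1"
  "q = p / (p - 1)" "1 / (p - 1) = q - 1"
proof -
  have *: "p + q = p * q"
    using conj_exp p_gt_1 q_gt_1 by (simp add: field_simps)
  then show 1: "q * (p - 1) = p" "(p - 1) * (q - 1) = 1" by (simp_all add: algebra_simps)
  show "p / q = p - 1" using 1(1) q_gt_1 by (simp add: divide_eq_eq mult.commute)
  have "q = (q - 1) * p" using * by (simp add: algebra_simps)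
  then show "q / p = q - 1" using p_gt_1 by (simp add: divide_eq_eq)
  show "q = p / (p - 1)" using 1(1) p_gt_1 by (simp add: eq_divide_eq)
  show "1 / (p - 1) = q - 1" using 1(2) p_gt_1 by (simp add: divide_eq_eq mult.commute)
qed

text \<open>The power q of the duality relation is v^(q-1) s = 1. In the testing argument it turns
  (h^(p-1) v)^q s into h^p v.\<close>

lemma v_powr_q: "v x powr q * s x = v x"
proof -
  have "1 = (v x powr (1 / p) * s x powr (1 / q)) powr q"
    using dual by simp
  also have "\<dots> = v x powr (q / p) * s x"
    using v_pos[of x] s_pos[of x] p_gt_1 q_gt_1 by (simp add: powr_mult powr_powr less_imp_le)
  also have "\<dots> = v x powr (q - 1) * s x"
    by (simp only: exp_eqs(4))
  finally have "v x powr (q - 1) * s x = 1" ..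
  moreover have "v x powr q = v x * v x powr (q - 1)"
    using v_pos[of x] by (simp add: powr_diff)
  ultimately show ?thesis by (simp add: mult.assoc)
qed

text \<open>Test against \<open>g = h\<^sup>p\<^sup>-\<^sup>1 v\<close>, truncated so that its norm is finite and can be divided out.\<close>

lemma duality:
  fixes h :: "'a \<Rightarrow> ennreal"
  assumes [measurable]: "h \<in> borel_measurable M" and K: "0 \<le> K"
    and bound: "\<And>g. g \<in> borel_measurable M \<Longrightarrow> Lp_pow M q s g \<le> 1
       \<Longrightarrow> (\<integral>\<^sup>+x. h x * g x \<partial>M) \<le> ennreal K"
  shows "Lp_pow M p v h \<le> ennreal (K powr p)"
proof -
  obtain A :: "nat \<Rightarrow> 'a set" where A: "range A \<subseteq> sets M" "(\<Union>i. A i) = space M"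
     "\<And>i. emeasure M (A i) \<noteq> \<infinity>" "incseq A"
    using sigma_finite_incseq by metis
  have A_meas [measurable]: "A n \<in> sets M" for n using A(1) by auto
  \<comment> \<open>On \<open>X n\<close> the measure is finite and v is at most n. With h cut off
    at n, the p-th power integral is at most n^p n times the measure of \<open>A n\<close>, hence
    finite.\<close>
  define X where "X n = A n \<inter> {x\<in>space M. v x \<le> real n}" for n
  have X_meas [measurable]: "X n \<in> sets M" for n unfolding X_def by measurable
  define hn where "hn n x = min (h x) (of_nat n) * indicator (X n) x" for n x
  have hn_meas [measurable]: "hn n \<in> borel_measurable M" for n
    unfolding hn_def by measurable
  have hn_real: "\<exists>r\<ge>0. hn n x = ennreal r \<and> r \<le> real n" for n x
  proof -
    have "hn n x \<le> ennreal (real n)"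
      by (auto simp: hn_def indicator_def ennreal_of_nat_eq_real_of_nat)
    then show ?thesis by (cases "hn n x") (auto simp: top_unique)
  qed
  have step: "Lp_pow M p v (hn n) \<le> ennreal (K powr p)" for n
  proof -
    let ?I = "\<integral>\<^sup>+x. epow (hn n x) p * ennreal (v x) \<partial>M"
    have "?I \<le> (\<integral>\<^sup>+x. ennreal (real n powr p * real n) * indicator (A n) x \<partial>M)"
    proof (rule nn_integral_mono)
      fix x
      obtain r where r: "0 \<le> r" "hn n x = ennreal r" "r \<le> real n" using hn_real by blast
      show "epow (hn n x) p * ennreal (v x) \<le> ennreal (real n powr p * real n) * indicator (A n) x"
      proof (cases "x \<in> X n")
        case True
        then have "r powr p * v x \<le> real n powr p * real n"
          using r v_pos[of x] p_gt_1 by (intro mult_mono powr_mono2) (auto simp: X_def)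
        then show ?thesis using True r v_pos[of x]
          by (simp add: X_def ennreal_mult[symmetric])
      next
        case False
        then have "hn n x = 0" by (simp add: hn_def)
        then show ?thesis by simp
      qed
    qed
    also have "\<dots> < top"
      using A(3)[of n] by (subst nn_integral_cmult_indicator) (auto simp: ennreal_mult_less_top less_top)
    finally have "?I < top" .
    then obtain a where a: "0 \<le> a" "?I = ennreal a" by (cases ?I) auto
    show ?thesis
    proof (cases "a = 0")
      case True
      then show ?thesis using a by simp
    next
      case False
      \<comment> \<open>Chosen so that c^q a = 1, which normalises g. Testing then bounds c a = a^(1
        - 1/q) = a^(1/p) by K.\<close>
      define c where "c = a powr (- 1 / q)"
      have c: "0 < c" and cq: "c powr q = 1 / a"
        using False a q_gt_1 by (auto simp: c_def powr_powr powr_minus_divide powr_divide)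
      define g where "g x = ennreal c * (epow (hn n x) (p - 1) * ennreal (v x))" for x
      have g_meas [measurable]: "g \<in> borel_measurable M" unfolding g_def by measurable
      have "Lp_pow M q s g
         = (\<integral>\<^sup>+x. ennreal (c powr q) * (epow (hn n x) p * ennreal (v x)) \<partial>M)"
      proof (rule nn_integral_cong)
        fix x
        have "ennreal (v x powr q) * ennreal (s x) = ennreal (v x)"
          using v_powr_q[of x] s_pos[of x] by (simp add: ennreal_mult[symmetric])
        then show "epow (g x) q * ennreal (s x) = ennreal (c powr q) * (epow (hn n x) p * ennreal (v x))"
          using c v_pos[of x] exp_eqs(1)
          by (simp add: g_def epow_mult epow_epow mult.assoc mult.commute[of "p - 1" q] less_imp_le)
      qed
      also have "\<dots> = ennreal (c powr q) * ?I"
        by (rule nn_integral_cmult) measurable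
      also have "\<dots> = 1"
        using a False cq by (simp add: ennreal_mult[symmetric])
      finally have "(\<integral>\<^sup>+x. h x * g x \<partial>M) \<le> ennreal K"
        by (intro bound) auto
      moreover have "ennreal c * ?I \<le> (\<integral>\<^sup>+x. h x * g x \<partial>M)"
      proof -
        have "ennreal c * ?I = (\<integral>\<^sup>+x. ennreal c * (epow (hn n x) p * ennreal (v x)) \<partial>M)"
          by (rule nn_integral_cmult[symmetric]) measurable
        also have "\<dots> \<le> (\<integral>\<^sup>+x. h x * g x \<partial>M)"
        proof (rule nn_integral_mono)
          fix x
          have "epow (hn n x) p = hn n x * epow (hn n x) (p - 1)"
            by (simp add: epow_add_one)
          moreover have "hn n x \<le> h x" by (auto simp: hn_def indicator_def)
          ultimately have "epow (hn n x) p \<le> h x * epow (hn n x) (p - 1)"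
            by (simp add: mult_right_mono)
          then have "ennreal c * (epow (hn n x) p * ennreal (v x)) \<le> ennreal c * (h x * epow (hn n x) (p - 1) * ennreal (v x))"
            by (intro mult_left_mono mult_right_mono) auto
          also have "\<dots> = h x * g x" by (simp add: g_def mult_ac)
          finally show "ennreal c * (epow (hn n x) p * ennreal (v x)) \<le> h x * g x" .
        qed
        finally show ?thesis .
      qed
      ultimately have "ennreal (c * a) \<le> ennreal K"
        using a c by (simp add: ennreal_mult)
      then have "c * a \<le> K" using K by simp
      moreover have "c * a = a powr (1 / p)"
      proof -
        have "c * a = a powr (- 1 / q + 1)" using a False powr_add[of a "- 1 / q" 1] by (simp add: c_def)
        also have "- 1 / q + 1 = 1 / p" using conj_exp by simp
        finally show ?thesis .
      qed
      ultimately have "(a powr (1 / p)) powr p \<le> K powr p"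
        using p_gt_1 by (intro powr_mono2) auto
      then have "a \<le> K powr p"
        using a p_gt_1 by (simp add: powr_powr)
      then show ?thesis using a by (simp add: ennreal_leI)
    qed
  qed
  have inc: "hn m x \<le> hn n x" if "m \<le> n" for m n x
  proof -
    have "X m \<subseteq> X n" using that incseqD[OF A(4) that] by (auto simp: X_def)
    moreover have "min (h x) (of_nat m) \<le> min (h x) (of_nat n)"
      using that by (intro min.mono) auto
    ultimately show ?thesis by (auto simp: hn_def indicator_def)
  qed
  have sup: "epow (h x) p * ennreal (v x) = (SUP n. epow (hn n x) p * ennreal (v x))" if x: "x \<in> space M" for x
  proof (rule antisym)
    obtain n0 where n0: "x \<in> X n" if "n \<ge> n0" for n
    proof -
      obtain i where "x \<in> A i" using A(2) x by auto
      moreover obtain j where "v x \<le> real j" using real_arch_simple by blast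
      ultimately have "x \<in> X n" if "n \<ge> max i j" for n
        using incseqD[OF A(4), of i n] that x by (auto simp: X_def intro: order.trans)
      then show ?thesis using that by blast
    qed
    show "epow (h x) p * ennreal (v x) \<le> (SUP n. epow (hn n x) p * ennreal (v x))"
    proof (cases "h x")
      case (real r)
      obtain j where "r \<le> real j" using real_arch_simple by blast
      then have "hn (max n0 j) x = h x"
        using n0[of "max n0 j"] real by (simp add: hn_def ennreal_of_nat_eq_real_of_nat ennreal_leI min_absorb1)
      then have "epow (h x) p * ennreal (v x) = epow (hn (max n0 j) x) p * ennreal (v x)" by simp
      also have "\<dots> \<le> (SUP n. epow (hn n x) p * ennreal (v x))" by (rule SUP_upper) simp
      finally show ?thesis .
    next
      case top
      \<comment> \<open>At such a point the truncated function equals n for all large n, and n above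
        (y / v)^(1/p) exceeds what is needed for y.\<close>
      have "ennreal y \<le> (SUP n. epow (hn n x) p * ennreal (v x))" if y: "0 \<le> y" for y
      proof -
        obtain j where j: "(y / v x) powr (1 / p) \<le> real j" using real_arch_simple by blast
        let ?n = "max n0 j"
        have e: "hn ?n x = ennreal (real ?n)"
          using n0[of ?n] top by (simp add: hn_def ennreal_of_nat_eq_real_of_nat)
        have "y / v x = ((y / v x) powr (1 / p)) powr p"
          using y v_pos[of x] p_gt_1 by (simp add: powr_powr)
        also have "\<dots> \<le> real ?n powr p"
          using j p_gt_1 by (intro powr_mono2) auto
        finally have "y \<le> real ?n powr p * v x"
          using v_pos[of x] by (simp add: field_simps)
        then have "ennreal y \<le> epow (hn ?n x) p * ennreal (v x)"
          unfolding e using v_pos[of x] by (simp add: ennreal_mult[symmetric])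
        also have "\<dots> \<le> (SUP n. epow (hn n x) p * ennreal (v x))" by (rule SUP_upper) simp
        finally show ?thesis .
      qed
      then have "(SUP n. epow (hn n x) p * ennreal (v x)) = top"
        by (rule ennreal_eq_top_of_ge)
      then show ?thesis by (metis top_greatest)
    qed
    show "(SUP n. epow (hn n x) p * ennreal (v x)) \<le> epow (h x) p * ennreal (v x)"
      using p_gt_1 by (intro SUP_least mult_right_mono epow_mono) (auto simp: hn_def indicator_def)
  qed
  have "Lp_pow M p v h = (\<integral>\<^sup>+x. (SUP n. epow (hn n x) p * ennreal (v x)) \<partial>M)"
    by (rule nn_integral_cong) (rule sup)
  also have "\<dots> = (SUP n. \<integral>\<^sup>+x. epow (hn n x) p * ennreal (v x) \<partial>M)"
    using p_gt_1 by (intro nn_integral_monotone_convergence_SUP)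
      (auto simp: incseq_def le_fun_def intro!: mult_right_mono epow_mono inc)
  also have "\<dots> \<le> ennreal (K powr p)"
    by (intro SUP_least step)
  finally show ?thesis .
qed

text \<open>A strictly positive density cannot integrate to 0 over a set of positive measure.
  Through \<open>swap\<close> the same holds for v; both keep the quotients by weighted masses
  meaningful.\<close>

lemma nn_integral_s_pos:
  assumes "Q \<in> sets M" "0 < emeasure M Q"
  shows "0 < (\<integral>\<^sup>+x\<in>Q. ennreal (s x) \<partial>M)"
proof (rule ccontr)
  assume "\<not> ?thesis"
  then have "(\<integral>\<^sup>+x\<in>Q. ennreal (s x) \<partial>M) = 0" by simp
  then have "AE x in M. ennreal (s x) * indicator Q x = 0"
    using assms by (subst nn_integral_0_iff_AE[symmetric]) auto
  then have "AE x in M. x \<notin> Q"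
  proof (rule AE_mp, intro AE_I2 impI)
    fix x assume "ennreal (s x) * indicator Q x = 0"
    then show "x \<notin> Q" using s_pos[of x] by (auto simp: ennreal_eq_0_iff)
  qed
  then have "emeasure M (Q \<inter> space M) = 0"
    using assms by (simp add: AE_iff_measurable[OF _ refl] Int_def conj_commute)
  then show False using assms by (simp add: sets.Int_space_eq2)
qed

text \<open>Hoelder's inequality for 1 = v^(1/p) s^(1/q), obtained by integrating the weighted
  inequality between geometric and arithmetic mean of v/u and s/t. It serves twice: to bound the
  characteristic below by 1, and to bound the two masses of a sparse part from below by its
  measure.\<close>

lemma Holder_measure:
  assumes [measurable]: "Q \<in> sets M"
    and u: "(\<integral>\<^sup>+x\<in>Q. ennreal (v x) \<partial>M) = ennreal u" "0 \<le> u"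
    and t: "(\<integral>\<^sup>+x\<in>Q. ennreal (s x) \<partial>M) = ennreal t" "0 \<le> t"
    and m: "emeasure M Q = ennreal m" "0 \<le> m"
  shows "m \<le> u powr (1 / p) * t powr (1 / q)"
proof (cases "m = 0")
  case False
  have nz: "emeasure M Q \<noteq> 0" using False m by simp
  have pos: "0 < u" "0 < t"
    using dual_weights.nn_integral_s_pos[OF swap assms(1)] nn_integral_s_pos[OF assms(1)] nz u t
    by (auto simp: zero_less_iff_neq_zero)
  define c where "c = u powr (1 / p) * t powr (1 / q)"
  have c: "0 < c" using pos by (simp add: c_def)
  have pt: "1 / c \<le> 1 / (p * u) * v x + 1 / (q * t) * s x" for x
  proof -
    have "(v x / u) powr (1 / p) * (s x / t) powr (1 / q) \<le> 1 / p * (v x / u) + 1 / q * (s x / t)"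
      using Youngs_inequality_0[of "1 / p" "1 / q" "v x / u" "s x / t"] conj_exp p_gt_1 q_gt_1 pos v_pos[of x] s_pos[of x]
      by simp
    moreover have "(v x / u) powr (1 / p) * (s x / t) powr (1 / q) = 1 / c"
      using pos v_pos[of x] s_pos[of x] dual[of x] by (simp add: powr_divide c_def less_imp_le)
    ultimately show ?thesis by simp
  qed
  have "ennreal (m / c) = (\<integral>\<^sup>+x\<in>Q. ennreal (1 / c) \<partial>M)"
    using m c by (simp add: nn_integral_cmult_indicator ennreal_mult[symmetric])
  also have "\<dots> \<le> (\<integral>\<^sup>+x. ennreal (1 / (p * u)) * (ennreal (v x) * indicator Q x)
       + ennreal (1 / (q * t)) * (ennreal (s x) * indicator Q x) \<partial>M)"
    using pt p_gt_1 q_gt_1 pos v_pos s_pos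
    by (intro nn_integral_mono) (auto simp: indicator_def less_imp_le ennreal_mult[symmetric] simp flip: ennreal_plus intro!: ennreal_leI)
  also have "\<dots> = ennreal (1 / (p * u)) * ennreal u + ennreal (1 / (q * t)) * ennreal t"
    by (subst nn_integral_add) (auto simp: nn_integral_cmult u t)
  also have "\<dots> = ennreal 1"
    using pos p_gt_1 q_gt_1 conj_exp by (simp add: ennreal_mult[symmetric] flip: ennreal_plus)
  finally have "m / c \<le> 1" by simp
  then show ?thesis using c by (simp add: c_def field_simps)
qed (use u t in simp)

end

section \<open>Weighted bounds for sparse operators\<close>

definition laminar :: "'a set set \<Rightarrow> bool" where
  "laminar S \<longleftrightarrow> (\<forall>P\<in>S. \<forall>Q\<in>S. P \<subseteq> Q \<or> Q \<subseteq> P \<or> P \<inter> Q = {})"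

lemma laminarD: "laminar S \<Longrightarrow> P \<in> S \<Longrightarrow> Q \<in> S \<Longrightarrow> P \<subseteq> Q \<or> Q \<subseteq> P \<or> P \<inter> Q = {}"
  by (simp add: laminar_def)

lemma laminar_subset: "laminar S \<Longrightarrow> F \<subseteq> S \<Longrightarrow> laminar F"
  unfolding laminar_def by (meson subsetD)

text \<open>Sparsity over an abstract measure, with the dyadic geometry reduced to
  \<open>laminar\<close>. An overlap bound N in place of disjointness covers both the given family
  and the stopping cubes, for which N = 1.\<close>

definition sparse_family :: "'a measure \<Rightarrow> real \<Rightarrow> nat \<Rightarrow> 'a set set \<Rightarrow> bool" where
  "sparse_family M \<Lambda> N S \<longleftrightarrow> countable S \<and> laminar S
     \<and> (\<forall>Q\<in>S. Q \<in> sets M \<and> 0 < emeasure M Q \<and> emeasure M Q < top)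
     \<and> (\<exists>E. (\<forall>Q\<in>S. E Q \<in> sets M \<and> E Q \<subseteq> Q \<and> \<Lambda> * measure M Q \<le> measure M (E Q))
          \<and> (\<forall>x. finite {Q\<in>S. x \<in> E Q} \<and> card {Q\<in>S. x \<in> E Q} \<le> N))"

lemma sparse_family_subset:
  assumes "sparse_family M \<Lambda> N S" "F \<subseteq> S"
  shows "sparse_family M \<Lambda> N F"
proof -
  obtain E where E: "\<forall>Q\<in>S. E Q \<in> sets M \<and> E Q \<subseteq> Q \<and> \<Lambda> * measure M Q \<le> measure M (E Q)"
    "\<And>x. finite {Q\<in>S. x \<in> E Q} \<and> card {Q\<in>S. x \<in> E Q} \<le> N"
    using assms(1) unfolding sparse_family_def by blast
  have "finite {Q\<in>F. x \<in> E Q} \<and> card {Q\<in>F. x \<in> E Q} \<le> N" for x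
  proof -
    have sub: "{Q\<in>F. x \<in> E Q} \<subseteq> {Q\<in>S. x \<in> E Q}" using assms(2) by auto
    show ?thesis
      using finite_subset[OF sub] card_mono[OF _ sub] E(2)[of x] by (meson order_trans)
  qed
  moreover have "\<forall>Q\<in>F. E Q \<in> sets M \<and> E Q \<subseteq> Q \<and> \<Lambda> * measure M Q \<le> measure M (E Q)"
    using E(1) assms(2) by (meson subsetD)
  ultimately have "\<exists>E. (\<forall>Q\<in>F. E Q \<in> sets M \<and> E Q \<subseteq> Q \<and> \<Lambda> * measure M Q \<le> measure M (E Q))
          \<and> (\<forall>x. finite {Q\<in>F. x \<in> E Q} \<and> card {Q\<in>F. x \<in> E Q} \<le> N)"
    by blast
  then show ?thesis
    using assms unfolding sparse_family_def
    by (meson countable_subset laminar_subset subsetD)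
qed

definition sparse_op :: "'a measure \<Rightarrow> 'a set set \<Rightarrow> ('a \<Rightarrow> ennreal) \<Rightarrow> 'a \<Rightarrow> ennreal" where
  "sparse_op M S f x = (\<integral>\<^sup>+Q. (set_nn_integral M Q f) / emeasure M Q * indicator Q x \<partial>count_space S)"

definition sparse_form :: "'a measure \<Rightarrow> 'a set set \<Rightarrow> ('a \<Rightarrow> ennreal) \<Rightarrow> ('a \<Rightarrow> ennreal) \<Rightarrow> ennreal" where
  "sparse_form M S f g = (\<integral>\<^sup>+Q. (set_nn_integral M Q f) * (set_nn_integral M Q g) / emeasure M Q \<partial>count_space S)"

text \<open>Tonelli's theorem for a countable sum of rank-one kernels. The sparse operator and both
  commutator operators are instances, and it identifies their pairings with the respective
  forms.\<close>

lemma rank_one_sum_dual: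
  fixes c :: "'i \<Rightarrow> ennreal"
  assumes S: "countable S" and h: "\<And>Q. Q \<in> S \<Longrightarrow> h Q \<in> borel_measurable M" and g: "g \<in> borel_measurable M"
  shows "(\<lambda>x. \<integral>\<^sup>+Q. c Q * h Q x \<partial>count_space S) \<in> borel_measurable M"
    and "(\<integral>\<^sup>+x. (\<integral>\<^sup>+Q. c Q * h Q x \<partial>count_space S) * g x \<partial>M)
       = (\<integral>\<^sup>+Q. c Q * (\<integral>\<^sup>+x. h Q x * g x \<partial>M) \<partial>count_space S)"
proof -
  show "(\<lambda>x. \<integral>\<^sup>+Q. c Q * h Q x \<partial>count_space S) \<in> borel_measurable M"
    using h by (intro borel_measurable_nn_integral_count_space S borel_measurable_times_ennreal) auto
  have "(\<integral>\<^sup>+x. (\<integral>\<^sup>+Q. c Q * h Q x \<partial>count_space S) * g x \<partial>M)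
    = (\<integral>\<^sup>+x. \<integral>\<^sup>+Q. c Q * (h Q x * g x) \<partial>count_space S \<partial>M)"
    by (subst nn_integral_multc[symmetric]) (auto simp: mult.assoc)
  also have "\<dots> = (\<integral>\<^sup>+Q. \<integral>\<^sup>+x. c Q * (h Q x * g x) \<partial>M \<partial>count_space S)"
    using h g by (intro nn_integral_count_space_nn_integral S borel_measurable_times_ennreal) auto
  also have "\<dots> = (\<integral>\<^sup>+Q. c Q * (\<integral>\<^sup>+x. h Q x * g x \<partial>M) \<partial>count_space S)"
    using h g by (intro nn_integral_cong nn_integral_cmult borel_measurable_times_ennreal) auto
  finally show "(\<integral>\<^sup>+x. (\<integral>\<^sup>+Q. c Q * h Q x \<partial>count_space S) * g x \<partial>M)
       = (\<integral>\<^sup>+Q. c Q * (\<integral>\<^sup>+x. h Q x * g x \<partial>M) \<partial>count_space S)" .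
qed

lemma sparse_op_dual:
  assumes S: "countable S" "\<And>Q. Q \<in> S \<Longrightarrow> Q \<in> sets M" and g: "g \<in> borel_measurable M"
  shows "sparse_op M S f \<in> borel_measurable M"
    and "(\<integral>\<^sup>+x. sparse_op M S f x * g x \<partial>M) = sparse_form M S f g"
proof -
  have h: "indicator Q \<in> borel_measurable M" if "Q \<in> S" for Q
    using S(2)[OF that] by measurable
  note r = rank_one_sum_dual[of S indicator M g "\<lambda>Q. set_nn_integral M Q f / emeasure M Q", OF S(1) h g]
  show "sparse_op M S f \<in> borel_measurable M"
    using r(1) by (simp add: sparse_op_def[abs_def])
  have "(\<integral>\<^sup>+x. sparse_op M S f x * g x \<partial>M)
      = (\<integral>\<^sup>+Q. set_nn_integral M Q f / emeasure M Q * (\<integral>\<^sup>+x. indicator Q x * g x \<partial>M) \<partial>count_space S)"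
    unfolding sparse_op_def by (rule r(2))
  also have "\<dots> = sparse_form M S f g"
    unfolding sparse_form_def by (intro nn_integral_cong) (simp add: divide_ennreal_def mult_ac)
  finally show "(\<integral>\<^sup>+x. sparse_op M S f x * g x \<partial>M) = sparse_form M S f g" .
qed

lemma sparse_form_commute: "sparse_form M S f g = sparse_form M S g f"
  by (simp add: sparse_form_def mult.commute)

lemma sparse_form_cmult:
  assumes "\<And>Q. Q \<in> S \<Longrightarrow> Q \<in> sets M" and f: "f \<in> borel_measurable M"
  shows "sparse_form M S (\<lambda>x. c * f x) g = c * sparse_form M S f g"
proof -
  have "sparse_form M S (\<lambda>x. c * f x) g
    = (\<integral>\<^sup>+Q. c * ((set_nn_integral M Q f) * (set_nn_integral M Q g) / emeasure M Q) \<partial>count_space S)"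
    unfolding sparse_form_def
  proof (rule nn_integral_cong)
    fix Q assume "Q \<in> space (count_space S)"
    then have [measurable]: "Q \<in> sets M" using assms by simp
    note f [measurable]
    have "(\<integral>\<^sup>+t\<in>Q. c * f t \<partial>M) = c * (set_nn_integral M Q f)"
      unfolding mult.assoc by (rule nn_integral_cmult) measurable
    then show "(\<integral>\<^sup>+t\<in>Q. c * f t \<partial>M) * (set_nn_integral M Q g) / emeasure M Q
       = c * ((set_nn_integral M Q f) * (set_nn_integral M Q g) / emeasure M Q)"
      by (simp add: divide_ennreal_def mult_ac)
  qed
  also have "\<dots> = c * sparse_form M S f g"
    unfolding sparse_form_def by (rule nn_integral_cmult) simp
  finally show ?thesis .
qed

text \<open>This is where the \<open>A\<^sub>p\<close> characteristic enters linearly: for \<open>2 \<le> p\<close> the total masses on \<open>Q\<close>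
  are traded for the masses on the sparse part of \<open>Q\<close>.\<close>

lemma sparse_weight_inequality:
  fixes u t m uE tE K \<Lambda> p q :: real
  assumes pq: "2 \<le> p" "1 / p + 1 / q = 1" "1 < q"
    and pos: "0 < u" "0 < t" "0 < m" "0 < uE" "0 < tE" "0 < \<Lambda>"
    and Ap: "u / m * (t / m) powr (p - 1) \<le> K"
    and E: "\<Lambda> * m \<le> uE powr (1 / p) * tE powr (1 / q)" and le: "tE \<le> t"
  shows "u * t / m \<le> K * \<Lambda> powr (1 - p) * (tE powr (1 / p) * uE powr (1 / q))"
proof -
  have pqe: "p + q = p * q" using pq by (simp add: field_simps)
  have q: "1 / q = (p - 1) / p" using pq by (simp add: field_simps)
  have K: "0 \<le> K" using Ap pos by (meson divide_nonneg_nonneg less_imp_le mult_nonneg_nonneg order_trans powr_ge_zero)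
  \<comment> \<open>Splits off the characteristic. The remaining factor m^(p-1) t^(2-p) has to be
    controlled by the sparse part alone.\<close>
  have eq: "u * t / m = (u / m * (t / m) powr (p - 1)) * (m powr (p - 1) * t powr (2 - p))"
  proof -
    have "(t / m) powr (p - 1) * m powr (p - 1) = t powr (p - 1)"
      using pos by (simp add: powr_divide)
    moreover have "t powr (p - 1) * t powr (2 - p) = t"
      using pos by (simp add: powr_add[symmetric])
    ultimately have "(t / m) powr (p - 1) * (m powr (p - 1) * t powr (2 - p)) = t"
      by (simp add: mult.assoc[symmetric])
    then show ?thesis by (simp add: mult.assoc)
  qed
  \<comment> \<open>Hypothesis \<open>E\<close> combines sparsity with Hoelder's inequality on the
    sparse part; this is its power p - 1.\<close>
  have m1: "m powr (p - 1) \<le> \<Lambda> powr (1 - p) * (uE powr (1 / q) * tE powr ((p - 1) * (p - 1) / p))"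
  proof -
    have "m \<le> (uE powr (1 / p) * tE powr (1 / q)) / \<Lambda>"
      using E pos by (simp add: field_simps)
    then have "m powr (p - 1) \<le> ((uE powr (1 / p) * tE powr (1 / q)) / \<Lambda>) powr (p - 1)"
      using pos pq by (intro powr_mono2) auto
    also have "\<dots> = uE powr ((p - 1) / p) * tE powr ((p - 1) / q) * \<Lambda> powr (1 - p)"
      using pos powr_minus_divide[of \<Lambda> "p - 1"] by (simp add: powr_divide powr_mult powr_powr)
    also have "(p - 1) / q = (p - 1) * (p - 1) / p"
      using arg_cong[OF q, of "\<lambda>z. (p - 1) * z"] by simp
    finally show ?thesis unfolding q by (simp add: mult_ac)
  qed
  \<comment> \<open>Here p \<ge> 2 is decisive: the exponent 2 - p is not positive, so the smaller
    mass has the larger power. The exponents of \<open>tE\<close> then add up to (p-1)^2/p + 2 - p =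
    1/p.\<close>
  have m2: "t powr (2 - p) \<le> tE powr (2 - p)"
    using le pos pq by (intro powr_mono2') auto
  have "m powr (p - 1) * t powr (2 - p)
     \<le> \<Lambda> powr (1 - p) * (uE powr (1 / q) * tE powr ((p - 1) * (p - 1) / p)) * tE powr (2 - p)"
    by (intro mult_mono m1 m2) auto
  also have "\<dots> = \<Lambda> powr (1 - p) * (tE powr (1 / p) * uE powr (1 / q))"
  proof -
    have "(p - 1) * (p - 1) / p + (2 - p) = 1 / p" using pq by (simp add: field_simps)
    then have "tE powr ((p - 1) * (p - 1) / p) * tE powr (2 - p) = tE powr (1 / p)"
      by (simp add: powr_add[symmetric])
    then show ?thesis by (simp add: mult_ac)
  qed
  finally have X: "m powr (p - 1) * t powr (2 - p) \<le> \<Lambda> powr (1 - p) * (tE powr (1 / p) * uE powr (1 / q))" .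
  have "(u / m * (t / m) powr (p - 1)) * (m powr (p - 1) * t powr (2 - p))
    \<le> K * (\<Lambda> powr (1 - p) * (tE powr (1 / p) * uE powr (1 / q)))"
    by (rule mult_mono[OF Ap X K]) auto
  then show ?thesis unfolding eq by (simp only: mult.assoc)
qed

section \<open>Sparse forms under the weight condition\<close>

context dual_weights begin

text \<open>The masses are asked for as real witnesses u and t, which makes their finiteness part of
  the condition.\<close>

definition Ap_on :: "'a set set \<Rightarrow> real \<Rightarrow> bool" where
  "Ap_on S K \<longleftrightarrow> (\<forall>Q\<in>S. \<exists>u t. 0 \<le> u \<and> 0 \<le> t
     \<and> (\<integral>\<^sup>+x\<in>Q. ennreal (v x) \<partial>M) = ennreal u \<and> (\<integral>\<^sup>+x\<in>Q. ennreal (s x) \<partial>M) = ennreal t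
     \<and> u / measure M Q * (t / measure M Q) powr (p - 1) \<le> K)"

text \<open>Together with \<open>nn_integral_epow_density_div\<close> this replaces f by f/s in the
  measure s dM: integrals over Q are unchanged, and because s^(1-p) = v the p-th power integral of
  f/s is the one of f with weight v.\<close>

lemma nn_integral_density_div:
  assumes [measurable]: "f \<in> borel_measurable M" "Q \<in> sets M"
  shows "(\<integral>\<^sup>+x\<in>Q. f x * ennreal (1 / s x) \<partial>density M (\<lambda>x. ennreal (s x))) = (set_nn_integral M Q f)"
proof -
  have "ennreal (s x) * (f x * ennreal (1 / s x) * indicator Q x) = f x * indicator Q x" for x
  proof -
    have "ennreal (s x) * ennreal (1 / s x) = 1"
      using s_pos[of x] by (simp add: ennreal_mult[symmetric])
    moreover have "ennreal (s x) * (f x * ennreal (1 / s x) * indicator Q x)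
      = (ennreal (s x) * ennreal (1 / s x)) * (f x * indicator Q x)" by (simp add: mult_ac)
    ultimately show ?thesis by simp
  qed
  then show ?thesis by (subst nn_integral_density) auto
qed

lemma nn_integral_epow_density_div:
  assumes [measurable]: "f \<in> borel_measurable M"
  shows "(\<integral>\<^sup>+x. epow (f x * ennreal (1 / s x)) p \<partial>density M (\<lambda>x. ennreal (s x)))
    = Lp_pow M p v f"
proof -
  have "ennreal (s x) * epow (f x * ennreal (1 / s x)) p = epow (f x) p * ennreal (v x)" for x
  proof -
    have "s x powr p * v x = s x"
      using dual_weights.v_powr_q[OF swap] .
    then have "s x * (1 / s x) powr p = v x"
      using s_pos[of x] by (simp add: powr_divide field_simps)
    then have "ennreal (s x) * ennreal ((1 / s x) powr p) = ennreal (v x)"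
      using s_pos[of x] by (simp add: ennreal_mult[symmetric])
    moreover have "ennreal (s x) * epow (f x * ennreal (1 / s x)) p
       = epow (f x) p * (ennreal (s x) * ennreal ((1 / s x) powr p))"
      using s_pos[of x] by (simp add: epow_mult mult.left_commute less_imp_le)
    ultimately show ?thesis by simp
  qed
  then show ?thesis by (subst nn_integral_density) auto
qed

lemma density_sigma_finite: "sigma_finite_measure (density M (\<lambda>x. ennreal (s x)))"
  by (subst sigma_finite_iff_density_finite) auto

text \<open>The unweighted embedding for the measure s dM and the function f/s. The q in the
  constant is p/(p-1).\<close>

lemma carleson_weighted:
  assumes F: "finite F" "laminar F" "\<And>Q. Q \<in> F \<Longrightarrow> Q \<in> sets M"
    and t: "\<And>Q. Q \<in> F \<Longrightarrow> 0 < (\<integral>\<^sup>+x\<in>Q. ennreal (s x) \<partial>M)" "\<And>Q. Q \<in> F \<Longrightarrow> (\<integral>\<^sup>+x\<in>Q. ennreal (s x) \<partial>M) < top"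
    and E: "\<And>Q. Q \<in> F \<Longrightarrow> E Q \<in> sets M" "\<And>Q. Q \<in> F \<Longrightarrow> E Q \<subseteq> Q" "\<And>x. card {Q\<in>F. x \<in> E Q} \<le> N"
    and f: "f \<in> borel_measurable M" "Lp_pow M p v f \<le> 1"
  shows "(\<Sum>Q\<in>F. (\<integral>\<^sup>+x\<in>E Q. ennreal (s x) \<partial>M)
      * epow ((set_nn_integral M Q f) / (\<integral>\<^sup>+x\<in>Q. ennreal (s x) \<partial>M)) p) \<le> ennreal (real N * 2 powr p * q)"
proof -
  let ?D = "density M (\<lambda>x. ennreal (s x))"
  note f(1) [measurable]
  have em: "emeasure ?D Q = (\<integral>\<^sup>+x\<in>Q. ennreal (s x) \<partial>M)" if "Q \<in> sets M" for Q
    using that by (intro emeasure_density) auto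
  have "(\<Sum>Q\<in>F. (\<integral>\<^sup>+x\<in>E Q. ennreal (s x) \<partial>M)
      * epow ((set_nn_integral M Q f) / (\<integral>\<^sup>+x\<in>Q. ennreal (s x) \<partial>M)) p)
    = (\<Sum>Q\<in>F. emeasure ?D (E Q) * epow ((\<integral>\<^sup>+x\<in>Q. f x * ennreal (1 / s x) \<partial>?D) / emeasure ?D Q) p)"
    using F E f(1) by (intro sum.cong) (auto simp: em nn_integral_density_div)
  also have "\<dots> \<le> ennreal (real N * 2 powr p * p / (p - 1)) * (\<integral>\<^sup>+x. epow (f x * ennreal (1 / s x)) p \<partial>?D)"
    using F E t p_gt_1 density_sigma_finite
    by (intro carleson_embedding) (auto simp: em dest: laminarD)
  also have "\<dots> \<le> ennreal (real N * 2 powr p * p / (p - 1)) * 1"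
    using f by (intro mult_left_mono) (auto simp: nn_integral_epow_density_div)
  also have "real N * 2 powr p * p / (p - 1) = real N * 2 powr p * q"
    using arg_cong[OF exp_eqs(5), of "\<lambda>z. real N * 2 powr p * z"] by simp
  finally show ?thesis by simp
qed

text \<open>With the integrals of f and g over Q written as weighted averages a and b times the
  masses t and u, a term becomes (u t / m) a b. \<open>sparse_weight_inequality\<close> replaces u t
  / m by masses of the sparse part with exponents 1/p and 1/q. These are the exponents for which
  Young's inequality splits the product into one Carleson sum for s and one for v.\<close>

lemma sparse_form_bound_ge_2:
  assumes p2: "2 \<le> p" and S: "sparse_family M \<Lambda> N S" and \<Lambda>: "0 < \<Lambda>" and Ap: "Ap_on S K" and K: "0 \<le> K"
    and f: "f \<in> borel_measurable M" "Lp_pow M p v f \<le> 1"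
    and g: "g \<in> borel_measurable M" "Lp_pow M q s g \<le> 1"
  shows "sparse_form M S f g
     \<le> ennreal (K * \<Lambda> powr (1 - p) * (real N * (2 powr p * q / p + 2 powr q * p / q)))"
  unfolding sparse_form_def
proof (rule nn_integral_count_space_le_finite_sums)
  show "countable S" using S by (simp add: sparse_family_def)
  fix F assume F: "finite F" "F \<subseteq> S"
  have SF: "sparse_family M \<Lambda> N F" using sparse_family_subset[OF S F(2)] .
  obtain E where E: "\<And>Q. Q \<in> F \<Longrightarrow> E Q \<in> sets M" "\<And>Q. Q \<in> F \<Longrightarrow> E Q \<subseteq> Q"
    "\<And>Q. Q \<in> F \<Longrightarrow> \<Lambda> * measure M Q \<le> measure M (E Q)" "\<And>x. card {Q\<in>F. x \<in> E Q} \<le> N"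
    using SF unfolding sparse_family_def by blast
  have Q: "\<And>Q. Q \<in> F \<Longrightarrow> Q \<in> sets M" "\<And>Q. Q \<in> F \<Longrightarrow> 0 < emeasure M Q" "\<And>Q. Q \<in> F \<Longrightarrow> emeasure M Q < top"
    and lamF: "laminar F"
    using SF unfolding sparse_family_def by blast+
  interpret sw: dual_weights M q p s v by (rule swap)
  define iv where "iv A = (\<integral>\<^sup>+x\<in>A. ennreal (v x) \<partial>M)" for A
  define si where "si A = (\<integral>\<^sup>+x\<in>A. ennreal (s x) \<partial>M)" for A
  define a where "a Q = (set_nn_integral M Q f) / si Q" for Q
  define b where "b Q = (set_nn_integral M Q g) / iv Q" for Q
  have fin: "iv Q < top" "si Q < top" "0 < iv Q" "0 < si Q" if QF: "Q \<in> F" for Q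
  proof -
    obtain u t where "0 \<le> u" "0 \<le> t" "iv Q = ennreal u" "si Q = ennreal t"
      using Ap QF F unfolding Ap_on_def iv_def si_def by (meson subsetD)
    then show "iv Q < top" "si Q < top" by auto
    show "0 < iv Q" unfolding iv_def using that Q by (intro sw.nn_integral_s_pos) auto
    show "0 < si Q" unfolding si_def using that Q by (intro nn_integral_s_pos) auto
  qed
  define c where "c = K * \<Lambda> powr (1 - p)"
  have c0: "0 \<le> c" using K by (simp add: c_def)
  have each: "(set_nn_integral M Q f) * (set_nn_integral M Q g) / emeasure M Q
    \<le> ennreal c * (ennreal (1 / p) * (si (E Q) * epow (a Q) p) + ennreal (1 / q) * (iv (E Q) * epow (b Q) q))"
    if QF: "Q \<in> F" for Q
  proof -
    obtain u t where ut: "0 \<le> u" "0 \<le> t" "iv Q = ennreal u" "si Q = ennreal t"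
      and Apq: "u / measure M Q * (t / measure M Q) powr (p - 1) \<le> K"
      using Ap QF F unfolding Ap_on_def iv_def si_def by (meson subsetD)
    have upos: "0 < u" "0 < t" using ut fin[OF QF] by auto
    define m where "m = measure M Q"
    have em: "emeasure M Q = ennreal m"
      unfolding m_def using Q(3)[OF QF] by (simp add: emeasure_eq_ennreal_measure less_top)
    have m: "0 < m" using Q(2)[OF QF] em by (simp add: )
    have EQ: "E Q \<in> sets M" "E Q \<subseteq> Q" using E QF by auto
    have "emeasure M (E Q) \<le> emeasure M Q" using EQ Q QF by (intro emeasure_mono) auto
    then have emE: "emeasure M (E Q) = ennreal (measure M (E Q))"
      using em by (intro emeasure_eq_ennreal_measure) (auto simp: top_unique)
    have mE: "\<Lambda> * m \<le> measure M (E Q)" using E QF by (simp add: m_def)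
    then have mEpos: "0 < measure M (E Q)" using \<Lambda> m by (meson less_le_trans mult_pos_pos)
    have ivE: "iv (E Q) \<le> iv Q" "si (E Q) \<le> si Q"
      unfolding iv_def si_def using EQ by (auto intro!: nn_integral_mono simp: indicator_def)
    have "iv (E Q) < top" "si (E Q) < top" using ivE fin[OF QF] by (auto intro: le_less_trans)
    then obtain uE tE where uE: "0 \<le> uE" "iv (E Q) = ennreal uE" and tE: "0 \<le> tE" "si (E Q) = ennreal tE"
      by (cases "iv (E Q)"; cases "si (E Q)") auto
    have "0 < iv (E Q)" unfolding iv_def using EQ emE mEpos by (intro sw.nn_integral_s_pos) auto
    then have uEpos: "0 < uE" using uE by auto
    have "0 < si (E Q)" unfolding si_def using EQ emE mEpos by (intro nn_integral_s_pos) auto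
    then have tEpos: "0 < tE" using tE by auto
    have "measure M (E Q) \<le> uE powr (1 / p) * tE powr (1 / q)"
      using EQ uE tE emE unfolding iv_def si_def by (intro Holder_measure) auto
    then have H: "\<Lambda> * m \<le> uE powr (1 / p) * tE powr (1 / q)" using mE by linarith
    have tle: "tE \<le> t" using ivE(2) ut tE by simp
    have W: "u * t / m \<le> c * (tE powr (1 / p) * uE powr (1 / q))"
      unfolding c_def using p2 conj_exp q_gt_1 upos m uEpos tEpos \<Lambda> Apq H tle
      by (intro sparse_weight_inequality) (auto simp: m_def)
    have fa: "(set_nn_integral M Q f) = a Q * ennreal t" and gb: "(set_nn_integral M Q g) = b Q * ennreal u"
      unfolding a_def b_def using upos ut by (simp_all add: ennreal_divide_times)
    have "(set_nn_integral M Q f) * (set_nn_integral M Q g) / emeasure M Q = ennreal (u * t / m) * (a Q * b Q)"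
      unfolding fa gb em using upos m
      by (simp add: divide_ennreal_def inverse_ennreal ennreal_mult divide_inverse mult_ac)
    also have "\<dots> \<le> ennreal (c * (tE powr (1 / p) * uE powr (1 / q))) * (a Q * b Q)"
      using W by (intro mult_right_mono ennreal_leI) auto
    also have "\<dots> = ennreal c * ((ennreal (tE powr (1 / p)) * a Q) * (ennreal (uE powr (1 / q)) * b Q))"
      using c0 by (simp add: ennreal_mult mult_ac)
    also have "\<dots> \<le> ennreal c * (ennreal (1 / p) * epow (ennreal (tE powr (1 / p)) * a Q) p
        + ennreal (1 / q) * epow (ennreal (uE powr (1 / q)) * b Q) q)"
      by (intro mult_left_mono epow_Young p_gt_1 q_gt_1 conj_exp) auto
    also have "epow (ennreal (tE powr (1 / p)) * a Q) p = si (E Q) * epow (a Q) p"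
      using tE tEpos p_gt_1 by (simp add: epow_mult powr_powr)
    also have "epow (ennreal (uE powr (1 / q)) * b Q) q = iv (E Q) * epow (b Q) q"
      using uE uEpos q_gt_1 by (simp add: epow_mult powr_powr)
    finally show ?thesis .
  qed
  have "(\<Sum>Q\<in>F. (set_nn_integral M Q f) * (set_nn_integral M Q g) / emeasure M Q)
     \<le> (\<Sum>Q\<in>F. ennreal c * (ennreal (1 / p) * (si (E Q) * epow (a Q) p) + ennreal (1 / q) * (iv (E Q) * epow (b Q) q)))"
    by (rule sum_mono) (rule each)
  also have "\<dots> = ennreal c * (ennreal (1 / p) * (\<Sum>Q\<in>F. si (E Q) * epow (a Q) p)
       + ennreal (1 / q) * (\<Sum>Q\<in>F. iv (E Q) * epow (b Q) q))"
    by (simp add: sum_distrib_left sum.distrib distrib_left)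
  also have "\<dots> \<le> ennreal c * (ennreal (1 / p) * ennreal (real N * 2 powr p * q)
       + ennreal (1 / q) * ennreal (real N * 2 powr q * p))"
  proof (intro mult_left_mono add_mono)
    show "(\<Sum>Q\<in>F. si (E Q) * epow (a Q) p) \<le> ennreal (real N * 2 powr p * q)"
      unfolding a_def si_def using F(1) lamF Q E f fin(2,4)
      by (intro carleson_weighted) (auto simp: si_def)
    show "(\<Sum>Q\<in>F. iv (E Q) * epow (b Q) q) \<le> ennreal (real N * 2 powr q * p)"
      unfolding b_def iv_def using F(1) lamF Q E g fin(1,3)
      by (intro sw.carleson_weighted) (auto simp: iv_def)
  qed auto
  also have "\<dots> = ennreal (c * (1 / p * (real N * 2 powr p * q) + 1 / q * (real N * 2 powr q * p)))"
    using c0 p_gt_1 q_gt_1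
    by (simp add: ennreal_mult[symmetric] del: times_divide_eq_left times_divide_eq_right flip: ennreal_plus)
  also have "c * (1 / p * (real N * 2 powr p * q) + 1 / q * (real N * 2 powr q * p))
     = K * \<Lambda> powr (1 - p) * (real N * (2 powr p * q / p + 2 powr q * p / q))"
    by (simp add: c_def field_simps)
  finally show "(\<Sum>Q\<in>F. (set_nn_integral M Q f) * (set_nn_integral M Q g) / emeasure M Q)
     \<le> ennreal (K * \<Lambda> powr (1 - p) * (real N * (2 powr p * q / p + 2 powr q * p / q)))" .
qed

text \<open>Since (p - 1)(q - 1) = 1, the power q - 1 of the characteristic of a cube is the
  characteristic of the dual pair.\<close>

lemma Ap_on_swap:
  assumes "Ap_on S K" and K: "0 \<le> K"
  shows "dual_weights.Ap_on M q s v S (K powr (q - 1))"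
proof -
  interpret sw: dual_weights M q p s v by (rule swap)
  show ?thesis unfolding sw.Ap_on_def
  proof
    fix Q assume "Q \<in> S"
    then obtain u t where ut: "0 \<le> u" "0 \<le> t"
      "(\<integral>\<^sup>+x\<in>Q. ennreal (v x) \<partial>M) = ennreal u" "(\<integral>\<^sup>+x\<in>Q. ennreal (s x) \<partial>M) = ennreal t"
      and le: "u / measure M Q * (t / measure M Q) powr (p - 1) \<le> K"
      using assms(1) unfolding Ap_on_def by meson
    have "(u / measure M Q * (t / measure M Q) powr (p - 1)) powr (q - 1) \<le> K powr (q - 1)"
      using le ut q_gt_1 by (intro powr_mono2) auto
    also have "(u / measure M Q * (t / measure M Q) powr (p - 1)) powr (q - 1)
       = t / measure M Q * (u / measure M Q) powr (q - 1)"
      using ut exp_eqs(2) by (simp add: powr_mult powr_powr del: times_divide_eq_left times_divide_eq_right)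
    finally show "\<exists>u t. 0 \<le> u \<and> 0 \<le> t
     \<and> (\<integral>\<^sup>+x\<in>Q. ennreal (s x) \<partial>M) = ennreal u \<and> (\<integral>\<^sup>+x\<in>Q. ennreal (v x) \<partial>M) = ennreal t
     \<and> u / measure M Q * (t / measure M Q) powr (q - 1) \<le> K powr (q - 1)"
      using ut by blast
  qed
qed

text \<open>The powers of \<Lambda> for p and for q are added, so that one constant serves both
  ranges of p and is invariant under exchanging p and q. \<open>Suc N\<close> instead of N keeps it
  positive when N = 0, so that functions can be normalised by dividing by it.\<close>

definition sparse_const :: "real \<Rightarrow> nat \<Rightarrow> real" where
  "sparse_const \<Lambda> N = (\<Lambda> powr (1 - p) + \<Lambda> powr (1 - q)) * (real (Suc N) * (2 powr p * q / p + 2 powr q * p / q))"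

lemma sparse_const_pos: "0 < \<Lambda> \<Longrightarrow> 0 < sparse_const \<Lambda> N"
  unfolding sparse_const_def using p_gt_1 q_gt_1
  by (intro mult_pos_pos add_pos_pos divide_pos_pos) auto

text \<open>For p < 2 the form is read with f and g exchanged: the dual exponent is at least 2, the
  dual characteristic is K^(q-1), and q - 1 = 1/(p-1) is then the larger entry of the
  maximum.\<close>

lemma sparse_form_bound:
  assumes S: "sparse_family M \<Lambda> N S" and \<Lambda>: "0 < \<Lambda>" and Ap: "Ap_on S K" and K: "0 \<le> K"
    and f: "f \<in> borel_measurable M" "Lp_pow M p v f \<le> 1"
    and g: "g \<in> borel_measurable M" "Lp_pow M q s g \<le> 1"
  shows "sparse_form M S f g \<le> ennreal (sparse_const \<Lambda> N * K powr max 1 (1 / (p - 1)))"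
proof -
  let ?c = "2 powr p * q / p + 2 powr q * p / q"
  have c: "0 \<le> ?c" using p_gt_1 q_gt_1 by simp
  have le: "y * x * (real N * ?c) \<le> sparse_const \<Lambda> N * y" if "x = \<Lambda> powr (1 - p) \<or> x = \<Lambda> powr (1 - q)" "0 \<le> y" for x y
  proof -
    have "x * (real N * ?c) \<le> sparse_const \<Lambda> N"
      unfolding sparse_const_def using c that by (intro mult_mono) auto
    then have "x * (real N * ?c) * y \<le> sparse_const \<Lambda> N * y" using that(2) by (rule mult_right_mono)
    then show ?thesis by (simp only: mult_ac)
  qed
  show ?thesis
  proof (cases "2 \<le> p")
    case True
    then have "1 / (p - 1) \<le> 1" by simp
    then have m: "max 1 (1 / (p - 1)) = 1" by simp
    have "sparse_form M S f g \<le> ennreal (K * \<Lambda> powr (1 - p) * (real N * ?c))"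
      by (rule sparse_form_bound_ge_2[OF True S \<Lambda> Ap K f g])
    also have "\<dots> \<le> ennreal (sparse_const \<Lambda> N * K)"
      using K by (intro ennreal_leI le) auto
    finally show ?thesis using K by (simp add: m)
  next
    case False
    have q2: "2 \<le> q"
    proof -
      have "1 \<le> 1 / (p - 1)" using False p_gt_1 by simp
      then show ?thesis using exp_eqs(6) by simp
    qed
    then have m: "max 1 (1 / (p - 1)) = q - 1"
      unfolding exp_eqs(6) by simp
    interpret sw: dual_weights M q p s v by (rule swap)
    have "sparse_form M S g f \<le> ennreal (K powr (q - 1) * \<Lambda> powr (1 - q) * (real N * (2 powr q * p / q + 2 powr p * q / p)))"
      by (rule sw.sparse_form_bound_ge_2[OF q2 S \<Lambda> Ap_on_swap[OF Ap K] _ g f]) simp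
    also have "\<dots> = ennreal (K powr (q - 1) * \<Lambda> powr (1 - q) * (real N * ?c))"
      by (simp add: add.commute)
    also have "\<dots> \<le> ennreal (sparse_const \<Lambda> N * K powr (q - 1))"
      by (intro ennreal_leI le) auto
    finally show ?thesis by (simp add: m sparse_form_commute)
  qed
qed

lemma sparse_op_bound:
  assumes S: "sparse_family M \<Lambda> N S" and \<Lambda>: "0 < \<Lambda>" and Ap: "Ap_on S K" and K: "0 \<le> K"
    and f: "f \<in> borel_measurable M" "Lp_pow M p v f \<le> 1"
  shows "Lp_pow M p v (sparse_op M S f)
     \<le> ennreal ((sparse_const \<Lambda> N * K powr max 1 (1 / (p - 1))) powr p)"
proof (rule duality)
  have S': "countable S" "\<And>Q. Q \<in> S \<Longrightarrow> Q \<in> sets M" using S by (auto simp: sparse_family_def)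
  then show "sparse_op M S f \<in> borel_measurable M" using f(1) by (rule sparse_op_dual(1))
  show "0 \<le> sparse_const \<Lambda> N * K powr max 1 (1 / (p - 1))"
    using sparse_const_pos[OF \<Lambda>, of N] by simp
  fix g assume g: "g \<in> borel_measurable M" "Lp_pow M q s g \<le> 1"
  show "(\<integral>\<^sup>+x. sparse_op M S f x * g x \<partial>M) \<le> ennreal (sparse_const \<Lambda> N * K powr max 1 (1 / (p - 1)))"
    using sparse_op_dual(2)[OF S' g(1)] sparse_form_bound[OF S \<Lambda> Ap K f g] by simp
qed

text \<open>\<open>sparse_op M T f\<close> divided by its norm bound c is again admissible in the
  first slot, so the two sparse bounds multiply and the exponent of K doubles.\<close>

lemma sparse_form_compose_bound:
  assumes S: "sparse_family M \<Lambda> N S" "0 < \<Lambda>" "Ap_on S K" and K: "0 < K"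
    and T: "sparse_family M \<Lambda>' N' T" "0 < \<Lambda>'" "Ap_on T K"
    and f: "f \<in> borel_measurable M" "Lp_pow M p v f \<le> 1"
    and g: "g \<in> borel_measurable M" "Lp_pow M q s g \<le> 1"
  shows "sparse_form M S (sparse_op M T f) g
    \<le> ennreal (sparse_const \<Lambda> N * sparse_const \<Lambda>' N' * K powr (2 * max 1 (1 / (p - 1))))"
proof -
  let ?e = "max 1 (1 / (p - 1))"
  define c where "c = sparse_const \<Lambda>' N' * K powr ?e"
  have c: "0 < c" using sparse_const_pos[OF T(2)] K by (simp add: c_def)
  have T': "countable T" "\<And>Q. Q \<in> T \<Longrightarrow> Q \<in> sets M" using T by (auto simp: sparse_family_def)
  have S': "\<And>Q. Q \<in> S \<Longrightarrow> Q \<in> sets M" using S by (auto simp: sparse_family_def)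
  have h [measurable]: "sparse_op M T f \<in> borel_measurable M"
    using T' f(1) by (rule sparse_op_dual(1))
  define h where "h x = ennreal (1 / c) * sparse_op M T f x" for x
  have hm [measurable]: "h \<in> borel_measurable M" unfolding h_def by measurable
  have "Lp_pow M p v h
     = ennreal ((1 / c) powr p) * Lp_pow M p v (sparse_op M T f)"
    unfolding h_def epow_mult mult.assoc using c by (subst nn_integral_cmult) auto
  also have "\<dots> \<le> ennreal ((1 / c) powr p) * ennreal (c powr p)"
    unfolding c_def using K by (intro mult_left_mono sparse_op_bound T f) auto
  also have "\<dots> = 1"
    using c by (simp add: ennreal_mult[symmetric] powr_mult[symmetric])
  finally have hn: "Lp_pow M p v h \<le> 1" .
  have "sparse_op M T f x = ennreal c * h x" for x
    using c by (simp add: h_def mult.assoc[symmetric] ennreal_mult[symmetric])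
  then have "sparse_form M S (sparse_op M T f) g = sparse_form M S (\<lambda>x. ennreal c * h x) g"
    by (simp add: sparse_form_def)
  also have "\<dots> = ennreal c * sparse_form M S h g"
    by (rule sparse_form_cmult[OF S' hm])
  also have "\<dots> \<le> ennreal c * ennreal (sparse_const \<Lambda> N * K powr ?e)"
    using K by (intro mult_left_mono sparse_form_bound S hm hn g) auto
  also have "\<dots> = ennreal (sparse_const \<Lambda> N * sparse_const \<Lambda>' N' * (K powr ?e * K powr ?e))"
    using c sparse_const_pos[OF S(2), of N] by (simp add: c_def ennreal_mult[symmetric] mult_ac)
  also have "K powr ?e * K powr ?e = K powr (2 * ?e)"
    using K by (simp add: powr_add[symmetric])
  finally show ?thesis .
qed

end

section \<open>Dyadic differentiation and stopping cubes\<close>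

lemma disjoint_family_on_nn_integral:
  assumes "countable I" "disjoint_family_on (\<lambda>Q. Q) I" "\<And>Q. Q \<in> I \<Longrightarrow> Q \<in> sets M" "h \<in> borel_measurable M"
  shows "(\<integral>\<^sup>+x\<in>\<Union>I. h x \<partial>M) = (\<integral>\<^sup>+Q. (set_nn_integral M Q h) \<partial>count_space I)"
proof -
  have "(\<integral>\<^sup>+x\<in>\<Union>I. h x \<partial>M) = emeasure (density M h) (\<Union>I)"
    using assms by (intro emeasure_density[symmetric] sets.countable_Union) auto
  also have "\<dots> = (\<integral>\<^sup>+Q. emeasure (density M h) Q \<partial>count_space I)"
    using emeasure_UN_countable[of I "\<lambda>Q. Q" "density M h"] assms by simp
  also have "\<dots> = (\<integral>\<^sup>+Q. (set_nn_integral M Q h) \<partial>count_space I)"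
    using assms by (intro nn_integral_cong emeasure_density) auto
  finally show ?thesis .
qed

text \<open>What the stopping argument uses of a dyadic system. \<open>doubling\<close> compares a
  cube with a subcube one level down, and \<open>shrink\<close> expresses that cubes around a point
  become small. One set may occur at several levels; where the level of a cube matters, the proofs
  select an extremal one.\<close>

locale dyadic_tree =
  fixes M :: "real measure" and D :: "int \<Rightarrow> real set set" and X :: "real set" and \<kappa> :: real
  assumes sets_M [measurable_cong, simp]: "sets M = sets borel"
    and cube_sets: "\<And>k Q. Q \<in> D k \<Longrightarrow> Q \<in> sets borel"
    and cube_pos: "\<And>k Q. Q \<in> D k \<Longrightarrow> 0 < emeasure M Q"
    and cube_fin: "\<And>k Q. Q \<in> D k \<Longrightarrow> emeasure M Q < top"
    and cover: "\<And>k. \<Union>(D k) = X"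
    and disjoint: "\<And>k P Q. P \<in> D k \<Longrightarrow> Q \<in> D k \<Longrightarrow> P \<noteq> Q \<Longrightarrow> P \<inter> Q = {}"
    and nested: "\<And>k l P Q. k \<le> l \<Longrightarrow> Q \<in> D l \<Longrightarrow> P \<in> D k \<Longrightarrow> Q \<subseteq> P \<or> Q \<inter> P = {}"
    and countable_level: "\<And>k. countable (D k)"
    and doubling: "\<And>k P Q. P \<in> D (k + 1) \<Longrightarrow> Q \<in> D k \<Longrightarrow> P \<subseteq> Q \<Longrightarrow> emeasure M Q \<le> ennreal \<kappa> * emeasure M P"
    and \<kappa>_ge_1: "1 \<le> \<kappa>"
    and shrink: "\<And>x U. open U \<Longrightarrow> x \<in> U \<Longrightarrow> x \<in> X \<Longrightarrow> \<exists>k. \<forall>j\<ge>k. \<forall>Q\<in>D j. x \<in> Q \<longrightarrow> Q \<subseteq> U"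
begin

lemma space_M [simp]: "space M = UNIV"
  using sets_eq_imp_space_eq[OF sets_M] by simp

definition cubes :: "real set set" where "cubes = (\<Union>k. D k)"

lemma cubesI: "Q \<in> D k \<Longrightarrow> Q \<in> cubes"
  by (auto simp: cubes_def)

lemma cubesE: assumes "Q \<in> cubes" obtains k where "Q \<in> D k"
  using assms by (auto simp: cubes_def)

lemma countable_cubes: "countable cubes"
  unfolding cubes_def using countable_level by auto

lemma cube_measurable [measurable]: "Q \<in> cubes \<Longrightarrow> Q \<in> sets borel"
  using cube_sets by (auto elim: cubesE)

lemma cube_emeasure: "Q \<in> cubes \<Longrightarrow> 0 < emeasure M Q" "Q \<in> cubes \<Longrightarrow> emeasure M Q < top"
  using cube_pos cube_fin by (auto elim: cubesE)

lemma cube_emeasure_eq: "Q \<in> cubes \<Longrightarrow> emeasure M Q = ennreal (measure M Q)"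
  using cube_emeasure(2)[of Q] by (intro emeasure_eq_ennreal_measure) auto

lemma cube_measure_pos: "Q \<in> cubes \<Longrightarrow> 0 < measure M Q"
  using cube_emeasure(1)[of Q] cube_emeasure_eq[of Q] by simp

lemma cube_nonempty: "Q \<in> cubes \<Longrightarrow> Q \<noteq> {}"
  using cube_emeasure(1)[of Q] by auto

lemma cube_subset: "Q \<in> cubes \<Longrightarrow> Q \<subseteq> X"
  using cover by (blast elim: cubesE)

lemma cube_at: assumes "x \<in> X" obtains Q where "Q \<in> D k" "x \<in> Q"
  using assms cover[of k] by blast

lemma laminar_cubes: "laminar cubes"
  unfolding laminar_def
proof (intro ballI)
  fix P Q assume "P \<in> cubes" "Q \<in> cubes"
  then obtain k l where "P \<in> D k" "Q \<in> D l" by (metis cubesE)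
  then show "P \<subseteq> Q \<or> Q \<subseteq> P \<or> P \<inter> Q = {}"
    using nested[of k l Q P] nested[of l k P Q] by (cases "k \<le> l") auto
qed

lemma finer_subset: "k \<le> l \<Longrightarrow> Q \<in> D l \<Longrightarrow> P \<in> D k \<Longrightarrow> Q \<inter> P \<noteq> {} \<Longrightarrow> Q \<subseteq> P"
  using nested by blast

text \<open>At each level at most one cube contains P, and at levels outside the range from R to P
  nestedness leaves only R and P themselves. The finiteness provides maximal stopped cubes and
  minimal stopping cubes.\<close>

lemma finite_cubes_between:
  assumes "P \<in> cubes" "R \<in> cubes"
  shows "finite {Q\<in>cubes. P \<subseteq> Q \<and> Q \<subseteq> R}"
proof -
  obtain k m where k: "P \<in> D k" and m: "R \<in> D m" using assms by (metis cubesE)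
  have "{Q\<in>cubes. P \<subseteq> Q \<and> Q \<subseteq> R} \<subseteq> {P, R} \<union> (\<Union>j\<in>{m..k}. {Q\<in>D j. P \<subseteq> Q})"
  proof
    fix Q assume "Q \<in> {Q\<in>cubes. P \<subseteq> Q \<and> Q \<subseteq> R}"
    then obtain j where j: "Q \<in> D j" "P \<subseteq> Q" "Q \<subseteq> R" by (auto elim: cubesE)
    have ne: "P \<noteq> {}" using assms cube_nonempty by auto
    consider "j < m" | "k < j" | "m \<le> j" "j \<le> k" by linarith
    then show "Q \<in> {P, R} \<union> (\<Union>j\<in>{m..k}. {Q\<in>D j. P \<subseteq> Q})"
    proof cases
      case 1
      then have "R \<subseteq> Q" using finer_subset[of j m R Q] j m ne by auto
      then show ?thesis using j by auto
    next
      case 2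
      then have "Q \<subseteq> P" using finer_subset[of k j Q P] j k ne by auto
      then show ?thesis using j by auto
    next
      case 3
      then show ?thesis using j by auto
    qed
  qed
  moreover have "finite {Q\<in>D j. P \<subseteq> Q}" for j
  proof (cases "\<exists>Q\<in>D j. P \<subseteq> Q")
    case True
    then obtain Q where Q: "Q \<in> D j" "P \<subseteq> Q" by blast
    have "Q' = Q" if "Q' \<in> D j" "P \<subseteq> Q'" for Q'
      using disjoint[of Q' j Q] Q that cube_nonempty[OF assms(1)] by blast
    then have "{Q\<in>D j. P \<subseteq> Q} \<subseteq> {Q}" by blast
    then show ?thesis by (rule finite_subset) simp
  next
    case False
    then have "{Q\<in>D j. P \<subseteq> Q} = {}" by blast
    then show ?thesis by (metis finite.emptyI)
  qed
  ultimately show ?thesis by (auto intro: finite_subset)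
qed

text \<open>Cover the exceptional set by an open set of almost the same measure and use the maximal cubes
  inside that open set.\<close>

lemma dyadic_differentiation:
  fixes h :: "real \<Rightarrow> ennreal"
  assumes R: "R \<in> D m" and A: "A \<subseteq> R" "A \<in> sets borel" and h [measurable]: "h \<in> borel_measurable borel"
    and K: "0 \<le> K"
    and avg: "\<And>x k Q. x \<in> A \<Longrightarrow> m \<le> k \<Longrightarrow> Q \<in> D k \<Longrightarrow> x \<in> Q \<Longrightarrow> (set_nn_integral M Q h) \<le> ennreal K * emeasure M Q"
  shows "AE x in M. x \<in> A \<longrightarrow> h x \<le> ennreal K"
proof -
  note A(2) [measurable]
  have Rm [measurable]: "R \<in> sets borel" using R cube_sets by blast
  have null: "emeasure M {x\<in>A. ennreal (K + e) < h x} = 0" if e: "0 < e" for e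
  proof -
    define A' where "A' = {x\<in>A. ennreal (K + e) < h x}"
    have A'm [measurable]: "A' \<in> sets borel" unfolding A'_def by measurable
    have A'R: "A' \<subseteq> R" using A by (auto simp: A'_def)
    have "emeasure M A' \<le> emeasure M R" using A'R by (intro emeasure_mono) auto
    then obtain a where a: "0 \<le> a" "emeasure M A' = ennreal a"
      using cube_fin[OF R] by (cases "emeasure M A'") (auto simp: top_unique)
    \<comment> \<open>Here (K + e) a is at most the integral of h over the chosen disjoint cubes,
      hence at most K times their total measure, hence at most K (a + \<eta>). As \<eta> is
      arbitrary, a = 0.\<close>
    have key: "e * a \<le> K * \<eta>" if \<eta>: "0 < \<eta>" for \<eta>
    proof -
      \<comment> \<open>Restriction to R gives a finite Borel measure, which is outer
        regular.\<close>
      define MR where "MR = density M (indicator R)"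
      have emR: "emeasure MR B = emeasure M (B \<inter> R)" if "B \<in> sets borel" for B
        unfolding MR_def using that by (simp add: emeasure_restricted Int_commute)
      have space_MR: "space MR = UNIV" by (simp add: MR_def)
      have "finite_measure MR"
        using cube_fin[OF R] emR[of UNIV] by (intro finite_measureI) (simp add: less_top space_MR)
      then have "emeasure MR A' = (INF U \<in> {U. A' \<subseteq> U \<and> open U}. emeasure MR U)"
        using finite_measure.emeasure_finite[of MR "space MR"] by (intro outer_regular) (simp_all add: MR_def)
      moreover have "emeasure MR A' = ennreal a" using A'R a by (simp add: emR Int_absorb2)
      ultimately have "(INF U \<in> {U. A' \<subseteq> U \<and> open U}. emeasure MR U) < ennreal (a + \<eta>)"
        using a \<eta> by (metis ennreal_less_iff less_add_same_cancel1)
      then obtain U where U: "A' \<subseteq> U" "open U" "emeasure MR U < ennreal (a + \<eta>)"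
        by (auto simp: INF_less_iff)
      have [measurable]: "U \<in> sets borel" using U by auto
      define W where "W = {Q. (\<exists>k\<ge>m. Q \<in> D k) \<and> Q \<subseteq> U \<and> Q \<inter> A' \<noteq> {}}"
      define G where "G = {Q\<in>W. \<forall>Q'\<in>W. Q \<subseteq> Q' \<longrightarrow> Q' = Q}"
      have Wc: "W \<subseteq> cubes" and GW: "G \<subseteq> W" by (auto simp: W_def G_def cubes_def)
      have Gm [measurable]: "Q \<in> sets borel" if "Q \<in> G" for Q using that GW Wc cube_measurable by blast
      have Gc: "countable G" using GW Wc countable_cubes by (meson countable_subset order_trans)
      have disj: "disjoint_family_on (\<lambda>Q. Q) G"
        unfolding disjoint_family_on_def
      proof (intro ballI impI)
        fix P Q assume PQ: "P \<in> G" "Q \<in> G" "P \<noteq> Q"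
        then have "\<not> P \<subseteq> Q" "\<not> Q \<subseteq> P" by (auto simp: G_def)
        then show "P \<inter> Q = {}" using laminarD[OF laminar_cubes, of P Q] PQ GW Wc by blast
      qed
      have cov: "A' \<subseteq> \<Union>G"
      proof
        fix x assume x: "x \<in> A'"
        then have xX: "x \<in> X" using A'R cover R by blast
        obtain k where k: "\<forall>j\<ge>k. \<forall>Q\<in>D j. x \<in> Q \<longrightarrow> Q \<subseteq> U"
          using shrink[OF U(2) _ xX] U(1) x by blast
        \<comment> \<open>The least n belongs to the coarsest level, from m on, at which the cube
          around x fits into U. The cube found there is maximal in \<open>W\<close> even if the same
          set recurs at finer levels.\<close>
        define PP where "PP n \<longleftrightarrow> (\<exists>Q\<in>D (m + int n). x \<in> Q \<and> Q \<subseteq> U)" for n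
        have "PP (nat (k - m))"
        proof -
          obtain Q where "Q \<in> D (m + int (nat (k - m)))" "x \<in> Q" using cube_at[OF xX] by blast
          then show ?thesis using k unfolding PP_def by (smt (verit) int_nat_eq)
        qed
        then have L: "PP (LEAST n. PP n)" and least: "\<And>n. PP n \<Longrightarrow> (LEAST n. PP n) \<le> n"
          by (auto intro: LeastI Least_le)
        then obtain Q where Q: "Q \<in> D (m + int (LEAST n. PP n))" "x \<in> Q" "Q \<subseteq> U"
          by (auto simp: PP_def)
        have QW: "Q \<in> W" unfolding W_def using Q x by (auto intro!: exI[of _ "m + int (LEAST n. PP n)"])
        have "Q' = Q" if Q': "Q' \<in> W" "Q \<subseteq> Q'" for Q'
        proof -
          obtain j where j: "m \<le> j" "Q' \<in> D j" "Q' \<subseteq> U" using Q' by (auto simp: W_def)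
          then have "PP (nat (j - m))" using Q' Q unfolding PP_def by (auto intro!: bexI[of _ Q'])
          then have "(LEAST n. PP n) \<le> nat (j - m)" by (rule least)
          then have "m + int (LEAST n. PP n) \<le> j" using j by linarith
          then have "Q' \<subseteq> Q" using finer_subset[of "m + int (LEAST n. PP n)" j Q' Q] Q j Q' by blast
          then show ?thesis using Q' by auto
        qed
        then have "Q \<in> G" using QW by (auto simp: G_def)
        then show "x \<in> \<Union>G" using Q by blast
      qed
      have UG [measurable]: "\<Union>G \<in> sets borel" using Gc Gm by (intro sets.countable_Union) auto
      have GR: "\<Union>G \<subseteq> U \<inter> R"
      proof -
        have "Q \<subseteq> R" if Q: "Q \<in> W" for Q
        proof -
          obtain k where "m \<le> k" "Q \<in> D k" using Q by (auto simp: W_def)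
          moreover have "Q \<inter> R \<noteq> {}" using Q A'R by (auto simp: W_def)
          ultimately show ?thesis using finer_subset[of m k Q R] R by blast
        qed
        moreover have "Q \<subseteq> U" if "Q \<in> W" for Q using that by (simp add: W_def)
        ultimately show ?thesis using GW by blast
      qed
      have "ennreal (K + e) * ennreal a = (\<integral>\<^sup>+x\<in>A'. ennreal (K + e) \<partial>M)"
        using a by (simp add: nn_integral_cmult_indicator)
      also have "\<dots> \<le> (\<integral>\<^sup>+x\<in>\<Union>G. h x \<partial>M)"
        using cov by (intro nn_integral_mono) (auto simp: indicator_def A'_def)
      also have "\<dots> = (\<integral>\<^sup>+Q. (set_nn_integral M Q h) \<partial>count_space G)"
        using disj Gc Gm by (intro disjoint_family_on_nn_integral) auto
      also have "\<dots> \<le> (\<integral>\<^sup>+Q. ennreal K * emeasure M Q \<partial>count_space G)"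
      proof (rule nn_integral_mono)
        fix Q assume "Q \<in> space (count_space G)"
        then have Q: "Q \<in> G" by simp
        then have "Q \<in> W" using GW by blast
        then obtain k x where "m \<le> k" "Q \<in> D k" "x \<in> Q" "x \<in> A" by (auto simp: W_def A'_def)
        then show "(set_nn_integral M Q h) \<le> ennreal K * emeasure M Q"
          using avg by blast
      qed
      also have "\<dots> = ennreal K * (\<integral>\<^sup>+Q. emeasure M Q \<partial>count_space G)"
        by (rule nn_integral_cmult) simp
      also have "(\<integral>\<^sup>+Q. emeasure M Q \<partial>count_space G) = emeasure M (\<Union>G)"
        using emeasure_UN_countable[of G "\<lambda>Q. Q" M] disj Gc Gm by simp
      also have "\<dots> \<le> emeasure M (U \<inter> R)"
        using GR by (intro emeasure_mono) auto
      also have "\<dots> \<le> ennreal (a + \<eta>)"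
        using U(3) emR[of U] by simp
      finally have "ennreal (K + e) * ennreal a \<le> ennreal K * ennreal (a + \<eta>)"
        by (simp add: mult_left_mono)
      then have "(K + e) * a \<le> K * (a + \<eta>)"
        using a K e \<eta> by (simp add: ennreal_mult[symmetric] del: ennreal_plus)
      then show ?thesis by (simp add: algebra_simps)
    qed
    have "e * a \<le> 0"
    proof (rule field_le_epsilon)
      fix d :: real assume d: "0 < d"
      have "e * a \<le> K * (d / (K + 1))" using d K by (intro key) auto
      also have "\<dots> \<le> d" using d K by (simp add: field_simps)
      finally show "e * a \<le> 0 + d" by simp
    qed
    then have "a = 0" using e a(1) by (simp add: mult_le_0_iff)
    then show ?thesis using a by (simp add: A'_def)
  qed
  have "AE x in M. \<forall>n::nat. x \<in> A \<longrightarrow> h x \<le> ennreal (K + 1 / real (Suc n))"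
    unfolding AE_all_countable
  proof
    fix n :: nat
    have "{x\<in>A. ennreal (K + 1 / real (Suc n)) < h x} \<in> null_sets M"
      using null[of "1 / real (Suc n)"] by (intro null_setsI) auto
    from AE_not_in[OF this] show "AE x in M. x \<in> A \<longrightarrow> h x \<le> ennreal (K + 1 / real (Suc n))"
      by (rule AE_mp) (auto simp: not_less)
  qed
  then show ?thesis
  proof (rule AE_mp, intro AE_I2 impI)
    fix x assume *: "\<forall>n::nat. x \<in> A \<longrightarrow> h x \<le> ennreal (K + 1 / real (Suc n))" and x: "x \<in> A"
    show "h x \<le> ennreal K"
    proof (rule ennreal_le_epsilon)
      fix e :: real assume e: "0 < e"
      then obtain n where "1 / real (Suc n) < e" using nat_approx_posE by blast
      then have "ennreal (K + 1 / real (Suc n)) \<le> ennreal (K + e)" by (intro ennreal_leI) auto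
      then show "h x \<le> ennreal K + ennreal e"
        using * x K e by (metis ennreal_plus less_imp_le order_trans)
    qed
  qed
qed

end

text \<open>The triangle inequality for the integral of b - c, kept multiplied by
  \<open>emeasure M Q\<close> so that no quotient of extended reals arises.\<close>

lemma average_diff_le:
  fixes b :: "'a \<Rightarrow> real"
  assumes Q [measurable]: "Q \<in> sets M" and fin: "0 < measure M Q" "emeasure M Q < top"
    and bi: "set_integrable M Q b"
  shows "ennreal \<bar>(\<integral>t\<in>Q. b t \<partial>M) / measure M Q - c\<bar> * emeasure M Q \<le> (\<integral>\<^sup>+t\<in>Q. ennreal \<bar>b t - c\<bar> \<partial>M)"
proof -
  have em: "emeasure M Q = ennreal (measure M Q)"
    using fin(2) by (intro emeasure_eq_ennreal_measure) auto
  have ci: "set_integrable M Q (\<lambda>t. c)"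
    using fin(2) by (auto simp: set_integrable_def integrable_indicator_iff)
  have "(\<integral>t\<in>Q. (b t - c) \<partial>M) = (\<integral>t\<in>Q. b t \<partial>M) - c * measure M Q"
    using set_integral_diff(2)[OF bi ci] fin(2)
    by (simp add: set_lebesgue_integral_def mult.commute)
  also have "\<dots> = ((\<integral>t\<in>Q. b t \<partial>M) / measure M Q - c) * measure M Q"
    using fin(1) by (simp add: field_simps)
  finally have e: "(\<integral>t\<in>Q. (b t - c) \<partial>M) = ((\<integral>t\<in>Q. b t \<partial>M) / measure M Q - c) * measure M Q" .
  have "ennreal \<bar>(\<integral>t\<in>Q. b t \<partial>M) / measure M Q - c\<bar> * emeasure M Q = ennreal \<bar>\<integral>t\<in>Q. (b t - c) \<partial>M\<bar>"
    unfolding e em using fin(1) by (simp add: abs_mult ennreal_mult[symmetric])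
  also have "\<dots> \<le> (\<integral>\<^sup>+t. ennreal (norm (indicator Q t *\<^sub>R (b t - c))) \<partial>M)"
    using integral_norm_bound_ennreal[OF set_integral_diff(1)[OF bi ci, unfolded set_integrable_def]]
    by (simp add: set_lebesgue_integral_def)
  also have "\<dots> = (\<integral>\<^sup>+t\<in>Q. ennreal \<bar>b t - c\<bar> \<partial>M)"
    by (intro nn_integral_cong) (auto simp: indicator_def)
  finally show ?thesis .
qed

text \<open>B may be any positive bound for the mean oscillations over cubes, not necessarily the
  best one. Positivity keeps a cube out of its own stopped set and permits division by B.\<close>

locale bmo_tree = dyadic_tree +
  fixes b :: "real \<Rightarrow> real" and B :: real
  assumes b_meas [measurable]: "b \<in> borel_measurable borel"
    and b_int: "\<And>k Q. Q \<in> D k \<Longrightarrow> set_integrable M Q b"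
    and B_pos: "0 < B"
    and osc: "\<And>k Q. Q \<in> D k \<Longrightarrow>
      (\<integral>\<^sup>+t\<in>Q. ennreal \<bar>b t - (\<integral>t\<in>Q. b t \<partial>M) / measure M Q\<bar> \<partial>M) \<le> ennreal B * emeasure M Q"
begin

definition avg :: "real set \<Rightarrow> real" where
  "avg Q = (\<integral>t\<in>Q. b t \<partial>M) / measure M Q"

lemma osc_cube: "Q \<in> cubes \<Longrightarrow> (\<integral>\<^sup>+t\<in>Q. ennreal \<bar>b t - avg Q\<bar> \<partial>M) \<le> ennreal B * emeasure M Q"
  using osc by (auto simp: avg_def elim: cubesE)

lemma avg_diff_le:
  assumes Q: "Q \<in> cubes"
  shows "ennreal \<bar>avg Q - c\<bar> * emeasure M Q \<le> (\<integral>\<^sup>+t\<in>Q. ennreal \<bar>b t - c\<bar> \<partial>M)"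
  unfolding avg_def using Q b_int cube_measure_pos cube_emeasure(2) cube_measurable
  by (intro average_diff_le) (auto elim: cubesE)

lemma avg_diff_bound:
  assumes Q: "Q \<in> cubes" and le: "(\<integral>\<^sup>+t\<in>Q. ennreal \<bar>b t - c\<bar> \<partial>M) \<le> ennreal C * emeasure M Q" and C: "0 \<le> C"
  shows "\<bar>avg Q - c\<bar> \<le> C"
proof -
  have m: "0 < measure M Q" using Q by (rule cube_measure_pos)
  have "ennreal \<bar>avg Q - c\<bar> * emeasure M Q \<le> ennreal C * emeasure M Q"
    using avg_diff_le[OF Q, of c] le by (rule order_trans)
  then have "\<bar>avg Q - c\<bar> * measure M Q \<le> C * measure M Q"
    unfolding cube_emeasure_eq[OF Q] using m C by (simp add: ennreal_mult[symmetric])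
  then show ?thesis using m by simp
qed

lemma avg_parent:
  assumes "P \<in> D (k + 1)" "Q \<in> D k" "P \<subseteq> Q"
  shows "\<bar>avg P - avg Q\<bar> \<le> \<kappa> * B"
proof (rule avg_diff_bound)
  show "P \<in> cubes" using assms cubesI by blast
  have "(\<integral>\<^sup>+t\<in>P. ennreal \<bar>b t - avg Q\<bar> \<partial>M) \<le> (\<integral>\<^sup>+t\<in>Q. ennreal \<bar>b t - avg Q\<bar> \<partial>M)"
    using assms by (intro nn_integral_mono) (auto simp: indicator_def)
  also have "\<dots> \<le> ennreal B * emeasure M Q"
    using assms cubesI by (intro osc_cube) blast
  also have "\<dots> \<le> ennreal B * (ennreal \<kappa> * emeasure M P)"
    using assms by (intro mult_left_mono doubling) auto
  also have "\<dots> = ennreal (\<kappa> * B) * emeasure M P"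
    using B_pos \<kappa>_ge_1 by (simp add: ennreal_mult mult_ac)
  finally show "(\<integral>\<^sup>+t\<in>P. ennreal \<bar>b t - avg Q\<bar> \<partial>M) \<le> ennreal (\<kappa> * B) * emeasure M P" .
  show "0 \<le> \<kappa> * B" using B_pos \<kappa>_ge_1 by simp
qed

text \<open>Any threshold larger than B would leave a part of R uncovered by stopped cubes; the
  factor 2 leaves half of it.\<close>

definition stopped :: "real set \<Rightarrow> real set set" where
  "stopped R = {P\<in>cubes. P \<subseteq> R \<and> 2 * B < \<bar>avg P - avg R\<bar>}"

definition children :: "real set \<Rightarrow> real set set" where
  "children R = {P\<in>stopped R. \<forall>P'\<in>stopped R. P \<subseteq> P' \<longrightarrow> P' = P}"

lemma children_cubes: "children R \<subseteq> cubes"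
  by (auto simp: children_def stopped_def)

lemma children_subset: "P \<in> children R \<Longrightarrow> P \<subset> R"
  using B_pos by (auto simp: children_def stopped_def)

lemma Union_children_subset: "\<Union>(children R) \<subseteq> R"
  using children_subset by blast

lemma stopped_covered:
  assumes R: "R \<in> cubes" and P: "P \<in> stopped R"
  obtains C where "C \<in> children R" "P \<subseteq> C"
proof -
  let ?Z = "{Q\<in>stopped R. P \<subseteq> Q}"
  have Pc: "P \<in> cubes" using P by (simp add: stopped_def)
  have "finite ?Z"
    by (rule finite_subset[OF _ finite_cubes_between[OF Pc R]]) (auto simp: stopped_def)
  moreover have "P \<in> ?Z" using P by simp
  ultimately obtain C where C: "C \<in> ?Z" "\<forall>Q\<in>?Z. C \<subseteq> Q \<longrightarrow> C = Q"
    using finite_has_maximal2[of ?Z P] by blast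
  then have "C \<in> children R" unfolding children_def by blast
  then show ?thesis using that C by blast
qed

lemma children_disjoint: "disjoint_family_on (\<lambda>Q. Q) (children R)"
  unfolding disjoint_family_on_def
proof (intro ballI impI)
  fix P Q assume PQ: "P \<in> children R" "Q \<in> children R" "P \<noteq> Q"
  then have "\<not> P \<subseteq> Q" "\<not> Q \<subseteq> P" by (auto simp: children_def)
  then show "P \<inter> Q = {}"
    using laminarD[OF laminar_cubes, of P Q] PQ children_cubes by blast
qed

lemma countable_children: "countable (children R)"
  using children_cubes countable_cubes by (rule countable_subset)

lemma Union_children_measurable [measurable]: "\<Union>(children R) \<in> sets borel"
  using countable_children children_cubes cube_measurable by (intro sets.countable_Union) blast+

text \<open>Chebyshev's inequality on disjoint cubes: over each child the integral of |b - avg R| is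
  at least 2 B times its measure, while over R it is at most B times the measure of R.\<close>

lemma emeasure_children:
  assumes R: "R \<in> cubes"
  shows "2 * emeasure M (\<Union>(children R)) \<le> emeasure M R"
proof -
  have child_sets: "Q \<in> sets borel" if "Q \<in> children R" for Q
    using that children_cubes cube_measurable by blast
  have "ennreal (2 * B) * emeasure M (\<Union>(children R)) = ennreal (2 * B) * (\<integral>\<^sup>+Q. emeasure M Q \<partial>count_space (children R))"
    using emeasure_UN_countable[of "children R" "\<lambda>Q. Q" M] children_disjoint countable_children
      child_sets by (simp add: image_subset_iff)
  also have "\<dots> = (\<integral>\<^sup>+Q. ennreal (2 * B) * emeasure M Q \<partial>count_space (children R))"
    by (rule nn_integral_cmult[symmetric]) simp
  also have "\<dots> \<le> (\<integral>\<^sup>+Q. (\<integral>\<^sup>+t\<in>Q. ennreal \<bar>b t - avg R\<bar> \<partial>M) \<partial>count_space (children R))"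
  proof (rule nn_integral_mono)
    fix Q assume "Q \<in> space (count_space (children R))"
    then have Q: "Q \<in> cubes" "2 * B < \<bar>avg Q - avg R\<bar>" by (auto simp: children_def stopped_def)
    have "ennreal (2 * B) * emeasure M Q \<le> ennreal \<bar>avg Q - avg R\<bar> * emeasure M Q"
      using Q by (intro mult_right_mono ennreal_leI) auto
    also have "\<dots> \<le> (\<integral>\<^sup>+t\<in>Q. ennreal \<bar>b t - avg R\<bar> \<partial>M)" using Q by (intro avg_diff_le)
    finally show "ennreal (2 * B) * emeasure M Q \<le> (\<integral>\<^sup>+t\<in>Q. ennreal \<bar>b t - avg R\<bar> \<partial>M)" .
  qed
  also have "\<dots> = (\<integral>\<^sup>+t\<in>\<Union>(children R). ennreal \<bar>b t - avg R\<bar> \<partial>M)"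
    using children_disjoint countable_children child_sets
    by (intro disjoint_family_on_nn_integral[symmetric]) auto
  also have "\<dots> \<le> (\<integral>\<^sup>+t\<in>R. ennreal \<bar>b t - avg R\<bar> \<partial>M)"
    using Union_children_subset[of R] by (intro nn_integral_mono) (auto simp: indicator_def)
  also have "\<dots> \<le> ennreal B * emeasure M R" using R by (rule osc_cube)
  finally have *: "ennreal B * (2 * emeasure M (\<Union>(children R))) \<le> ennreal B * emeasure M R"
    using B_pos by (simp add: ennreal_mult mult_ac)
  have "ennreal (1 / B) * (ennreal B * y) = y" for y
    using B_pos by (simp add: mult.assoc[symmetric] ennreal_mult[symmetric])
  then show ?thesis using mult_left_mono[OF *, of "ennreal (1 / B)"] by simp
qed

text \<open>By maximality the cube one level above a child is not stopped, so the mean has moved by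
  at most 2 B up to there. The last step down costs \<kappa> B by doubling, and 2 B + \<kappa> B
  \<le> 3 \<kappa> B because \<kappa> \<ge> 1.\<close>

lemma avg_child:
  assumes R: "R \<in> cubes" and P: "P \<in> children R"
  shows "\<bar>avg P - avg R\<bar> \<le> 3 * \<kappa> * B"
proof -
  obtain m where m: "R \<in> D m" using R by (rule cubesE)
  have Pc: "P \<in> cubes" "P \<subset> R" using P children_cubes children_subset by auto
  have level: "m < j" if "P \<in> D j" for j
  proof (rule ccontr)
    assume "\<not> m < j"
    then have "R \<subseteq> P" using finer_subset[of j m R P] that m Pc cube_nonempty[OF Pc(1)] by auto
    then show False using Pc by auto
  qed
  \<comment> \<open>P may occur at several levels. At its coarsest one the surrounding cube of the
    preceding level is a different set, as the appeal to maximality requires.\<close>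
  define PP where "PP n \<longleftrightarrow> P \<in> D (m + int n)" for n
  obtain j where j: "P \<in> D j" using Pc by (auto elim: cubesE)
  then have "PP (nat (j - m))" using level[OF j] by (simp add: PP_def)
  then have L: "PP (LEAST n. PP n)" and least: "\<And>n. PP n \<Longrightarrow> (LEAST n. PP n) \<le> n"
    by (auto intro: LeastI Least_le)
  define n where "n = (LEAST n. PP n)"
  have n: "P \<in> D (m + int n)" using L by (simp add: PP_def n_def)
  have n0: "0 < n" using level[OF n] by simp
  obtain x where x: "x \<in> P" using cube_nonempty[OF Pc(1)] by blast
  then have "x \<in> X" using cube_subset[OF Pc(1)] by blast
  then obtain Q where Q: "Q \<in> D (m + int (n - 1))" "x \<in> Q" by (rule cube_at)
  have e: "m + int (n - 1) + 1 = m + int n" using n0 by simp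
  have PQ: "P \<subseteq> Q" using finer_subset[of "m + int (n - 1)" "m + int n" P Q] n Q x by auto
  have QR: "Q \<subseteq> R" using finer_subset[of m "m + int (n - 1)" Q R] m Q x Pc by auto
  have "Q \<noteq> P"
  proof
    assume "Q = P"
    then have "PP (n - 1)" using Q by (simp add: PP_def)
    then have "n \<le> n - 1" unfolding n_def by (rule least)
    then show False using n0 by simp
  qed
  then have "Q \<notin> stopped R" using P PQ by (auto simp: children_def)
  then have "\<bar>avg Q - avg R\<bar> \<le> 2 * B" using Q QR cubesI by (auto simp: stopped_def)
  moreover have "\<bar>avg P - avg Q\<bar> \<le> \<kappa> * B" using avg_parent[of P "m + int (n - 1)" Q] n Q PQ e by simp
  moreover have "2 * B \<le> 2 * \<kappa> * B" using B_pos \<kappa>_ge_1 by simp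
  ultimately show ?thesis by linarith
qed

lemma avg_not_stopped:
  assumes R: "R \<in> cubes" and Q: "Q \<in> cubes" "Q \<subseteq> R" and no: "\<And>C. C \<in> children R \<Longrightarrow> \<not> Q \<subseteq> C"
  shows "\<bar>avg Q - avg R\<bar> \<le> 2 * B"
proof (rule ccontr)
  assume "\<not> ?thesis"
  then have "Q \<in> stopped R" using Q by (simp add: stopped_def)
  then show False using stopped_covered[OF R] no by blast
qed

text \<open>For a point of R in no child, the cubes around it inside R have means within 2 B of
  \<open>avg R\<close>. Over each of them |b - avg R| has mean at most B + 2 B, and
  \<open>dyadic_differentiation\<close> passes this bound to the point.\<close>

lemma AE_avg_bound:
  "AE x in M. \<forall>R\<in>cubes. x \<in> R \<longrightarrow> x \<notin> \<Union>(children R) \<longrightarrow> \<bar>b x - avg R\<bar> \<le> 3 * B"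
proof (rule AE_ball_countable[THEN iffD2, OF countable_cubes], rule ballI)
  fix R assume R: "R \<in> cubes"
  then obtain m where m: "R \<in> D m" by (rule cubesE)
  have [measurable]: "R \<in> sets borel" using R by (rule cube_measurable)
  have "AE x in M. x \<in> R - \<Union>(children R) \<longrightarrow> ennreal \<bar>b x - avg R\<bar> \<le> ennreal (3 * B)"
  proof (rule dyadic_differentiation[OF m])
    fix x k Q assume x: "x \<in> R - \<Union>(children R)" and Q: "m \<le> k" "Q \<in> D k" "x \<in> Q"
    have Qc: "Q \<in> cubes" and QR: "Q \<subseteq> R" using Q x cubesI finer_subset[of m k Q R] m by auto
    have "\<bar>avg Q - avg R\<bar> \<le> 2 * B" using x Q by (intro avg_not_stopped R Qc QR) blast
    then have "(\<integral>\<^sup>+t\<in>Q. ennreal \<bar>b t - avg R\<bar> \<partial>M)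
       \<le> (\<integral>\<^sup>+t. ennreal \<bar>b t - avg Q\<bar> * indicator Q t + ennreal (2 * B) * indicator Q t \<partial>M)"
      by (intro nn_integral_mono) (auto simp: indicator_def simp flip: ennreal_plus intro!: ennreal_leI)
    also have "\<dots> = (\<integral>\<^sup>+t\<in>Q. ennreal \<bar>b t - avg Q\<bar> \<partial>M) + ennreal (2 * B) * emeasure M Q"
      using cube_measurable[OF Qc] by (subst nn_integral_add) (auto simp: nn_integral_cmult_indicator)
    also have "\<dots> \<le> ennreal B * emeasure M Q + ennreal (2 * B) * emeasure M Q"
      by (intro add_right_mono osc_cube Qc)
    also have "\<dots> = ennreal (3 * B) * emeasure M Q"
      using B_pos by (simp add: distrib_right[symmetric] flip: ennreal_plus)
    finally show "(\<integral>\<^sup>+t\<in>Q. ennreal \<bar>b t - avg R\<bar> \<partial>M) \<le> ennreal (3 * B) * emeasure M Q" .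
  qed (use B_pos in auto)
  then show "AE x in M. x \<in> R \<longrightarrow> x \<notin> \<Union>(children R) \<longrightarrow> \<bar>b x - avg R\<bar> \<le> 3 * B"
    by (rule AE_mp) (use B_pos in \<open>auto simp: ennreal_le_iff\<close>)
qed

section \<open>Generations of stopping cubes\<close>

primrec generation :: "real set set \<Rightarrow> nat \<Rightarrow> real set set" where
  "generation T0 0 = T0"
| "generation T0 (Suc n) = (\<Union>R\<in>generation T0 n. children R)"

definition stopping_family :: "real set set \<Rightarrow> real set set" where
  "stopping_family T0 = (\<Union>n. generation T0 n)"

lemma stopping_family_top: "T0 \<subseteq> stopping_family T0"
  unfolding stopping_family_def using generation.simps(1)[of T0] by blast

lemma stopping_family_child: "R \<in> stopping_family T0 \<Longrightarrow> P \<in> children R \<Longrightarrow> P \<in> stopping_family T0"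
  unfolding stopping_family_def
proof -
  assume "R \<in> (\<Union>n. generation T0 n)" "P \<in> children R"
  then obtain n where "P \<in> generation T0 (Suc n)" by auto
  then show "P \<in> (\<Union>n. generation T0 n)" by blast
qed

lemma generation_cubes: "T0 \<subseteq> cubes \<Longrightarrow> generation T0 n \<subseteq> cubes"
  using children_cubes by (induction n) auto

lemma stopping_family_cubes: "T0 \<subseteq> cubes \<Longrightarrow> stopping_family T0 \<subseteq> cubes"
  unfolding stopping_family_def using generation_cubes by blast

lemma generation_disjoint:
  assumes "T0 \<subseteq> cubes" and d0: "\<And>P Q. P \<in> T0 \<Longrightarrow> Q \<in> T0 \<Longrightarrow> P \<noteq> Q \<Longrightarrow> P \<inter> Q = {}"
  shows "P \<in> generation T0 n \<Longrightarrow> Q \<in> generation T0 n \<Longrightarrow> P \<noteq> Q \<Longrightarrow> P \<inter> Q = {}"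
proof (induction n arbitrary: P Q)
  case 0
  then show ?case using d0 by simp
next
  case (Suc n)
  then obtain R R' where R: "R \<in> generation T0 n" "P \<in> children R" "R' \<in> generation T0 n" "Q \<in> children R'"
    by auto
  show ?case
  proof (cases "R = R'")
    case True
    then show ?thesis using children_disjoint[of R] R Suc.prems(3) by (auto simp: disjoint_family_on_def)
  next
    case False
    then have "R \<inter> R' = {}" using Suc.IH R by blast
    then show ?thesis using children_subset R by blast
  qed
qed

text \<open>Climbs one generation at a time. It separates a later cube from what the children leave
  uncovered in an earlier generation.\<close>

lemma generation_ancestor:
  "n < k \<Longrightarrow> Q \<in> generation T0 k \<Longrightarrow> \<exists>R\<in>generation T0 n. \<exists>C\<in>children R. Q \<subseteq> C"
proof (induction k arbitrary: Q)
  case (Suc k)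
  then obtain R where R: "R \<in> generation T0 k" "Q \<in> children R" by auto
  show ?case
  proof (cases "n = k")
    case True
    then show ?thesis using R by blast
  next
    case False
    then obtain R' C where "R' \<in> generation T0 n" "C \<in> children R'" "R \<subseteq> C"
      using Suc.IH[OF _ R(1)] Suc.prems by auto
    then show ?thesis using children_subset[OF R(2)] by blast
  qed
qed simp

text \<open>The part of a cube outside its children carries at least half of the measure. These
  parts are pairwise disjoint: within a generation because the cubes are, across generations because
  later cubes lie inside the children of earlier ones.\<close>

lemma stopping_family_sparse:
  assumes T0: "T0 \<subseteq> cubes" and d0: "\<And>P Q. P \<in> T0 \<Longrightarrow> Q \<in> T0 \<Longrightarrow> P \<noteq> Q \<Longrightarrow> P \<inter> Q = {}"
  shows "sparse_family M (1 / 2) 1 (stopping_family T0)"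
  unfolding sparse_family_def
proof (intro conjI exI)
  let ?T = "stopping_family T0"
  define E where "E R = R - \<Union>(children R)" for R
  have Tc: "?T \<subseteq> cubes" using T0 by (rule stopping_family_cubes)
  show "countable ?T" using Tc countable_cubes by (rule countable_subset)
  show "laminar ?T" using laminar_cubes Tc by (rule laminar_subset)
  show "\<forall>Q\<in>?T. Q \<in> sets M \<and> 0 < emeasure M Q \<and> emeasure M Q < top"
    using Tc cube_measurable cube_emeasure by auto
  show "\<forall>Q\<in>?T. E Q \<in> sets M \<and> E Q \<subseteq> Q \<and> 1 / 2 * measure M Q \<le> measure M (E Q)"
  proof (intro ballI conjI)
    fix Q assume "Q \<in> ?T"
    then have Q: "Q \<in> cubes" using Tc by blast
    note cube_measurable[OF Q, measurable]
    show "E Q \<in> sets M" unfolding E_def by measurable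
    show "E Q \<subseteq> Q" by (auto simp: E_def)
    have sub: "\<Union>(children Q) \<subseteq> Q" by (rule Union_children_subset)
    have cf: "emeasure M (\<Union>(children Q)) \<noteq> top"
      using emeasure_mono[OF sub, of M] cube_emeasure(2)[OF Q] by (auto simp: top_unique)
    have "measure M (E Q) = measure M Q - measure M (\<Union>(children Q))"
      unfolding E_def using cube_emeasure(2)[OF Q] sub by (intro measure_Diff) auto
    moreover have "2 * measure M (\<Union>(children Q)) \<le> measure M Q"
    proof -
      have "ennreal (2 * measure M (\<Union>(children Q))) = 2 * emeasure M (\<Union>(children Q))"
        unfolding emeasure_eq_ennreal_measure[OF cf] by (simp add: ennreal_mult)
      also have "\<dots> \<le> ennreal (measure M Q)"
        using emeasure_children[OF Q] unfolding cube_emeasure_eq[OF Q] .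
      finally show ?thesis by simp
    qed
    ultimately show "1 / 2 * measure M Q \<le> measure M (E Q)" by simp
  qed
  have E_disj: "P = Q" if P: "P \<in> generation T0 n" "x \<in> E P" and Q: "Q \<in> generation T0 k" "x \<in> E Q" and nk: "n \<le> k" for P Q n k x
  proof (cases "n = k")
    case True
    then show ?thesis using generation_disjoint[OF T0 d0, of P n Q] P Q by (auto simp: E_def)
  next
    case False
    then have "n < k" using nk by simp
    then obtain R C where R: "R \<in> generation T0 n" "C \<in> children R" "Q \<subseteq> C"
      using generation_ancestor[OF _ Q(1)] by blast
    have xC: "x \<in> C" using R Q by (auto simp: E_def)
    have "x \<in> R" "x \<in> P" using xC children_subset[OF R(2)] P(2) by (auto simp: E_def)
    then have "R = P" using generation_disjoint[OF T0 d0 R(1) P(1)] by blast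
    then show ?thesis using P(2) R(2) xC by (auto simp: E_def)
  qed
  have uniq: "P = Q" if PQ: "P \<in> ?T" "x \<in> E P" "Q \<in> ?T" "x \<in> E Q" for P Q x
  proof -
    obtain n where "P \<in> generation T0 n" using PQ(1) unfolding stopping_family_def by blast
    moreover obtain k where "Q \<in> generation T0 k" using PQ(3) unfolding stopping_family_def by blast
    ultimately show ?thesis using E_disj[of P n x Q k] E_disj[of Q k x P n] PQ by (cases "n \<le> k") auto
  qed
  show "\<forall>x. finite {Q\<in>?T. x \<in> E Q} \<and> card {Q\<in>?T. x \<in> E Q} \<le> 1"
  proof
    fix x
    show "finite {Q\<in>?T. x \<in> E Q} \<and> card {Q\<in>?T. x \<in> E Q} \<le> 1"
    proof (cases "\<exists>P. P \<in> ?T \<and> x \<in> E P")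
      case True
      then obtain P where "P \<in> ?T" "x \<in> E P" by blast
      then have "{Q\<in>?T. x \<in> E Q} = {P}" using uniq by blast
      then show ?thesis by simp
    next
      case False
      then have "{Q\<in>?T. x \<in> E Q} = {}" by blast
      then show ?thesis by (metis card.empty finite.emptyI zero_le_one)
    qed
  qed
qed

text \<open>Telescoping along the chain of children around x: each step moves the mean by at most 3
  \<kappa> B, and the last cube contributes 3 B. Finiteness is assumed because \<open>card\<close>
  of an infinite set is 0.\<close>

lemma deviation_le_count:
  assumes T: "T \<subseteq> cubes" "\<And>R P. R \<in> T \<Longrightarrow> P \<in> children R \<Longrightarrow> P \<in> T"
    and x: "\<forall>R\<in>cubes. x \<in> R \<longrightarrow> x \<notin> \<Union>(children R) \<longrightarrow> \<bar>b x - avg R\<bar> \<le> 3 * B"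
  shows "R \<in> T \<Longrightarrow> x \<in> R \<Longrightarrow> finite {P\<in>T. x \<in> P \<and> P \<subseteq> R}
    \<Longrightarrow> \<bar>b x - avg R\<bar> \<le> 3 * \<kappa> * B * real (card {P\<in>T. x \<in> P \<and> P \<subseteq> R})"
proof (induction "card {P\<in>T. x \<in> P \<and> P \<subseteq> R}" arbitrary: R rule: less_induct)
  case less
  let ?Z = "\<lambda>R. {P\<in>T. x \<in> P \<and> P \<subseteq> R}"
  have L: "3 * B \<le> 3 * \<kappa> * B" using B_pos \<kappa>_ge_1 by simp
  have Rc: "R \<in> cubes" using less.prems T by blast
  show ?case
  proof (cases "x \<in> \<Union>(children R)")
    case False
    have "R \<in> ?Z R" using less.prems by simp
    then have "1 \<le> card (?Z R)" using less.prems(3) by (metis One_nat_def Suc_leI card_gt_0_iff empty_iff)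
    then have "3 * \<kappa> * B * 1 \<le> 3 * \<kappa> * B * real (card (?Z R))"
      using B_pos \<kappa>_ge_1 by (intro mult_left_mono) auto
    moreover have "\<bar>b x - avg R\<bar> \<le> 3 * B" using x Rc less.prems(2) False by blast
    ultimately show ?thesis using L by linarith
  next
    case True
    then obtain P where P: "P \<in> children R" "x \<in> P" by blast
    have PT: "P \<in> T" using T(2) less.prems(1) P by blast
    have sub: "?Z P \<subseteq> ?Z R - {R}" using children_subset[OF P(1)] by auto
    have finP: "finite (?Z P)" by (rule finite_subset[OF sub]) (use less.prems(3) in simp)
    have "card (?Z P) \<le> card (?Z R - {R})" using sub less.prems(3) by (intro card_mono) auto
    also have "\<dots> = card (?Z R) - 1" using less.prems by (intro card_Diff_singleton) auto
    finally have c1: "card (?Z P) \<le> card (?Z R) - 1" .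
    have "R \<in> ?Z R" using less.prems by simp
    then have "0 < card (?Z R)" using less.prems(3) by (metis card_gt_0_iff empty_iff)
    then have c2: "card (?Z P) < card (?Z R)" "real (card (?Z P)) + 1 \<le> real (card (?Z R))" using c1 by auto
    have "\<bar>b x - avg P\<bar> \<le> 3 * \<kappa> * B * real (card (?Z P))"
      using less.hyps[OF c2(1) PT P(2) finP] .
    moreover have "\<bar>avg P - avg R\<bar> \<le> 3 * \<kappa> * B" using avg_child[OF Rc P(1)] .
    ultimately have "\<bar>b x - avg R\<bar> \<le> 3 * \<kappa> * B * (real (card (?Z P)) + 1)"
      by (simp add: algebra_simps)
    also have "\<dots> \<le> 3 * \<kappa> * B * real (card (?Z R))"
      using c2(2) B_pos \<kappa>_ge_1 by (intro mult_left_mono) auto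
    finally show ?thesis .
  qed
qed

text \<open>The stopping cubes are generated from the maximal cubes of \<open>F\<close> only; a cube \<open>Q\<close> of \<open>F\<close> is
  compared with the smallest stopping cube around it, below which all stopping cubes that meet \<open>Q\<close>
  lie inside \<open>Q\<close>.\<close>

lemma oscillation_domination:
  assumes F: "finite F" "F \<subseteq> cubes"
  obtains T where "T \<subseteq> cubes" "sparse_family M (1 / 2) 1 T"
    "AE x in M. \<forall>Q\<in>F. x \<in> Q \<longrightarrow> ennreal \<bar>b x - avg Q\<bar>
       \<le> ennreal (6 * \<kappa> * B) * (1 + (\<integral>\<^sup>+R. indicator R x \<partial>count_space {R\<in>T. R \<subseteq> Q}))"
proof -
  define T0 where "T0 = {Q\<in>F. \<forall>P\<in>F. Q \<subseteq> P \<longrightarrow> P = Q}"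
  define T where "T = stopping_family T0"
  have T0c: "T0 \<subseteq> cubes" using F by (auto simp: T0_def)
  have d0: "P \<inter> Q = {}" if "P \<in> T0" "Q \<in> T0" "P \<noteq> Q" for P Q
  proof -
    have "\<not> P \<subseteq> Q" "\<not> Q \<subseteq> P" using that by (auto simp: T0_def)
    then show ?thesis using laminarD[OF laminar_cubes, of P Q] that T0c by blast
  qed
  have Tc: "T \<subseteq> cubes" unfolding T_def by (rule stopping_family_cubes[OF T0c])
  have Tch: "\<And>R P. R \<in> T \<Longrightarrow> P \<in> children R \<Longrightarrow> P \<in> T"
    unfolding T_def by (rule stopping_family_child)
  have "AE x in M. \<forall>Q\<in>F. x \<in> Q \<longrightarrow> ennreal \<bar>b x - avg Q\<bar>
       \<le> ennreal (6 * \<kappa> * B) * (1 + (\<integral>\<^sup>+R. indicator R x \<partial>count_space {R\<in>T. R \<subseteq> Q}))"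
    using AE_avg_bound
  proof (rule AE_mp, intro AE_I2 impI ballI)
    fix x Q
    assume good: "\<forall>R\<in>cubes. x \<in> R \<longrightarrow> x \<notin> \<Union>(children R) \<longrightarrow> \<bar>b x - avg R\<bar> \<le> 3 * B"
      and Q: "Q \<in> F" and x: "x \<in> Q"
    have Qc: "Q \<in> cubes" using Q F by blast
    let ?Y = "{R\<in>T. R \<subseteq> Q}"
    have cnt: "(\<integral>\<^sup>+R. indicator R x \<partial>count_space ?Y) = emeasure (count_space ?Y) {R\<in>?Y. x \<in> R}"
    proof -
      have "(\<integral>\<^sup>+R. indicator R x \<partial>count_space ?Y) = (\<integral>\<^sup>+R. indicator {R\<in>?Y. x \<in> R} R \<partial>count_space ?Y)"
        by (intro nn_integral_cong) (auto simp: indicator_def)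
      also have "\<dots> = emeasure (count_space ?Y) {R\<in>?Y. x \<in> R}"
        by (rule nn_integral_indicator) auto
      finally show ?thesis .
    qed
    show "ennreal \<bar>b x - avg Q\<bar>
       \<le> ennreal (6 * \<kappa> * B) * (1 + (\<integral>\<^sup>+R. indicator R x \<partial>count_space ?Y))"
    proof (cases "finite {R\<in>?Y. x \<in> R}")
      case False
      \<comment> \<open>Infinitely many stopping cubes around x make the right side infinite, so
        \<open>deviation_le_count\<close> is only called for in the finite case.\<close>
      then have "(\<integral>\<^sup>+R. indicator R x \<partial>count_space ?Y) = top"
        unfolding cnt by (subst emeasure_count_space_infinite) auto
      then show ?thesis using B_pos \<kappa>_ge_1 by (simp add: ennreal_mult_top)
    next
      case True
      have "\<exists>P\<in>T0. Q \<subseteq> P"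
      proof -
        from finite_has_maximal2[OF F(1) Q] obtain P where "P \<in> F" "Q \<subseteq> P" "\<forall>b\<in>F. P \<le> b \<longrightarrow> P = b"
          by blast
        then show ?thesis by (auto simp: T0_def)
      qed
      then obtain P0 where P0: "P0 \<in> T" "Q \<subseteq> P0" using stopping_family_top[of T0] by (auto simp: T_def)
      let ?Z = "{R\<in>T. Q \<subseteq> R \<and> R \<subseteq> P0}"
      have finZ: "finite ?Z"
        using Tc P0 by (intro finite_subset[OF _ finite_cubes_between[OF Qc, of P0]]) auto
      have P0Z: "P0 \<in> ?Z" using P0 by simp
      \<comment> \<open>A minimum exists because only finitely many cubes lie between Q and
        \<open>P0\<close>. Minimality also prevents a child of R from containing Q, which bounds
        |avg Q - avg R| by 2 B.\<close>
      obtain R where R: "R \<in> ?Z" and Rmin: "\<forall>P\<in>?Z. P \<subseteq> R \<longrightarrow> R = P"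
        by (rule bexE[OF finite_has_minimal2[OF finZ P0Z]], erule conjE, rule that)
      have RT: "R \<in> T" "Q \<subseteq> R" "R \<subseteq> P0" using R by simp_all
      have Rc: "R \<in> cubes" using RT(1) Tc by (rule subsetD[rotated])
      have minR: "P = R" if "P \<in> T" "Q \<subseteq> P" "P \<subseteq> R" for P
      proof -
        have "P \<in> ?Z" using that RT(3) by simp
        from bspec[OF Rmin this] show ?thesis using that(3) by simp
      qed
      have aQ: "\<bar>avg Q - avg R\<bar> \<le> 2 * B"
      proof (rule avg_not_stopped[OF Rc Qc RT(2)])
        fix C assume C: "C \<in> children R"
        show "\<not> Q \<subseteq> C" using minR[OF Tch[OF RT(1) C]] children_subset[OF C] by blast
      qed
      have sub: "{P\<in>T. x \<in> P \<and> P \<subseteq> R} \<subseteq> insert R {P\<in>?Y. x \<in> P}"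
      proof
        fix P assume P: "P \<in> {P\<in>T. x \<in> P \<and> P \<subseteq> R}"
        then have "P \<in> cubes" "x \<in> P \<inter> Q" using Tc x by auto
        then have "P \<subseteq> Q \<or> Q \<subseteq> P" using laminarD[OF laminar_cubes _ Qc, of P] by blast
        then show "P \<in> insert R {P\<in>?Y. x \<in> P}" using P minR[of P] by auto
      qed
      then have finR: "finite {P\<in>T. x \<in> P \<and> P \<subseteq> R}" by (rule finite_subset) (use True in simp)
      \<comment> \<open>The additional 1 accounts for R itself, which need not lie inside Q.\<close>
      have cR: "card {P\<in>T. x \<in> P \<and> P \<subseteq> R} \<le> Suc (card {P\<in>?Y. x \<in> P})"
      proof -
        have "card {P\<in>T. x \<in> P \<and> P \<subseteq> R} \<le> card (insert R {P\<in>?Y. x \<in> P})"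
          by (rule card_mono[OF _ sub]) (use True in simp)
        also have "\<dots> \<le> Suc (card {P\<in>?Y. x \<in> P})"
          using True by (simp add: card_insert_if)
        finally show ?thesis .
      qed
      have "\<bar>b x - avg R\<bar> \<le> 3 * \<kappa> * B * real (card {P\<in>T. x \<in> P \<and> P \<subseteq> R})"
        using x RT(2) by (intro deviation_le_count[OF Tc Tch good RT(1) _ finR]) auto
      also have "\<dots> \<le> 3 * \<kappa> * B * (1 + real (card {P\<in>?Y. x \<in> P}))"
        using cR B_pos \<kappa>_ge_1 by (intro mult_left_mono) auto
      finally have "\<bar>b x - avg Q\<bar> \<le> 2 * B + 3 * \<kappa> * B * (1 + real (card {P\<in>?Y. x \<in> P}))"
        using aQ by linarith
      \<comment> \<open>The 2 B spent on passing from Q to R is absorbed by doubling the coefficient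
        3 \<kappa> B.\<close>
      also have "\<dots> \<le> 6 * \<kappa> * B * (1 + real (card {P\<in>?Y. x \<in> P}))"
      proof -
        have "2 * B * 1 \<le> 3 * \<kappa> * B * (1 + real (card {P\<in>?Y. x \<in> P}))"
          using B_pos \<kappa>_ge_1 by (intro mult_mono) auto
        then show ?thesis by (simp add: algebra_simps)
      qed
      finally have "ennreal \<bar>b x - avg Q\<bar> \<le> ennreal (6 * \<kappa> * B * (1 + real (card {P\<in>?Y. x \<in> P})))"
        by (rule ennreal_leI)
      also have "\<dots> = ennreal (6 * \<kappa> * B) * (1 + of_nat (card {P\<in>?Y. x \<in> P}))"
        using B_pos \<kappa>_ge_1 by (simp add: ennreal_mult ennreal_of_nat_eq_real_of_nat)
      also have "of_nat (card {P\<in>?Y. x \<in> P}) = (\<integral>\<^sup>+R. indicator R x \<partial>count_space ?Y)"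
        unfolding cnt using True by (subst emeasure_count_space_finite) auto
      finally show ?thesis .
    qed
  qed
  then show ?thesis
    using that[OF Tc] stopping_family_sparse[OF T0c d0] by (simp add: T_def)
qed

end

section \<open>Commutator forms\<close>

text \<open>The oscillation acts on the first slot. With f in it the form belongs to the adjoint
  operator; with the test function in it, to the commutator itself.\<close>

definition comm_form :: "'a measure \<Rightarrow> ('a set \<Rightarrow> real) \<Rightarrow> ('a \<Rightarrow> real) \<Rightarrow> 'a set set
    \<Rightarrow> ('a \<Rightarrow> ennreal) \<Rightarrow> ('a \<Rightarrow> ennreal) \<Rightarrow> ennreal" where
  "comm_form M a b S f g = (\<integral>\<^sup>+Q. (\<integral>\<^sup>+t\<in>Q. ennreal \<bar>b t - a Q\<bar> * f t \<partial>M) * (set_nn_integral M Q g)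
      / emeasure M Q \<partial>count_space S)"

context bmo_tree begin

text \<open>A stopping cube R inside Q contributes the integral of f over R, which does not change
  when f is replaced on R by its mean. Summing the means over R gives at most
  \<open>sparse_op M T f\<close> on Q.\<close>

lemma oscillation_integral_le:
  assumes T: "T \<subseteq> cubes" and Q: "Q \<in> cubes"
    and dom: "AE x in M. x \<in> Q \<longrightarrow> ennreal \<bar>b x - avg Q\<bar>
       \<le> ennreal L * (1 + (\<integral>\<^sup>+R. indicator R x \<partial>count_space {R\<in>T. R \<subseteq> Q}))"
    and f [measurable]: "f \<in> borel_measurable M"
  shows "(\<integral>\<^sup>+t\<in>Q. ennreal \<bar>b t - avg Q\<bar> * f t \<partial>M)
    \<le> ennreal L * ((set_nn_integral M Q f) + (\<integral>\<^sup>+t\<in>Q. sparse_op M T f t \<partial>M))"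
proof -
  let ?Y = "{R\<in>T. R \<subseteq> Q}"
  let ?N = "\<lambda>t. \<integral>\<^sup>+R. indicator R t \<partial>count_space ?Y"
  let ?m = "\<lambda>R. set_nn_integral M R f / emeasure M R"
  have Yc: "countable ?Y" using T countable_cubes by (auto intro: countable_subset)
  have Tc: "countable T" using T countable_cubes by (rule countable_subset)
  have Ts: "R \<in> sets M" if "R \<in> T" for R using that T cube_measurable by auto
  have [measurable]: "Q \<in> sets borel" using Q by (rule cube_measurable)
  have [measurable]: "(\<lambda>x. \<integral>\<^sup>+R. indicator R x \<partial>count_space ?Y) \<in> borel_measurable M"
    using Ts by (intro borel_measurable_nn_integral_count_space Yc borel_measurable_indicator) auto
  have [measurable]: "sparse_op M T f \<in> borel_measurable M"
    using Tc Ts f by (rule sparse_op_dual(1))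
  have cnt: "(\<integral>\<^sup>+t. ?N t * (f t * indicator Q t) \<partial>M)
     \<le> (\<integral>\<^sup>+t\<in>Q. sparse_op M T f t \<partial>M)"
  proof -
    have "(\<integral>\<^sup>+t. ?N t * (f t * indicator Q t) \<partial>M)
       = (\<integral>\<^sup>+t. \<integral>\<^sup>+R. indicator R t * (f t * indicator Q t) \<partial>count_space ?Y \<partial>M)"
      by (subst nn_integral_multc[symmetric]) auto
    also have "\<dots> = (\<integral>\<^sup>+R. \<integral>\<^sup>+t. indicator R t * (f t * indicator Q t) \<partial>M \<partial>count_space ?Y)"
      using Ts by (intro nn_integral_count_space_nn_integral Yc) auto
    also have "\<dots> = (\<integral>\<^sup>+R. \<integral>\<^sup>+t. ?m R * indicator R t * indicator Q t \<partial>M \<partial>count_space ?Y)"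
    proof (rule nn_integral_cong)
      fix R assume "R \<in> space (count_space ?Y)"
      then have R: "R \<in> T" "R \<subseteq> Q" "R \<in> cubes" using T by auto
      have [measurable]: "R \<in> sets borel" using R(3) by (rule cube_measurable)
      have "(\<integral>\<^sup>+t. indicator R t * (f t * indicator Q t) \<partial>M) = (set_nn_integral M R f)"
        using R(2) by (intro nn_integral_cong) (auto simp: indicator_def)
      also have "\<dots> = (set_nn_integral M R f) / emeasure M R * emeasure M R"
        using cube_emeasure[OF R(3)] by (simp add: ennreal_divide_times)
      also have "\<dots> = (\<integral>\<^sup>+t. ?m R * indicator R t \<partial>M)"
        by (rule nn_integral_cmult_indicator[symmetric]) simp
      also have "\<dots> = (\<integral>\<^sup>+t. ?m R * indicator R t * indicator Q t \<partial>M)"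
        using R(2) by (intro nn_integral_cong) (auto simp: indicator_def)
      finally show "(\<integral>\<^sup>+t. indicator R t * (f t * indicator Q t) \<partial>M)
        = (\<integral>\<^sup>+t. ?m R * indicator R t * indicator Q t \<partial>M)" .
    qed
    also have "\<dots> = (\<integral>\<^sup>+t. \<integral>\<^sup>+R. ?m R * indicator R t * indicator Q t \<partial>count_space ?Y \<partial>M)"
      using Ts by (intro nn_integral_count_space_nn_integral[symmetric] Yc
        borel_measurable_times_ennreal borel_measurable_indicator borel_measurable_const) auto
    also have "\<dots> = (\<integral>\<^sup>+t. (\<integral>\<^sup>+R. ?m R * indicator R t \<partial>count_space ?Y) * indicator Q t \<partial>M)"
      by (subst nn_integral_multc[symmetric]) auto
    also have "\<dots> \<le> (\<integral>\<^sup>+t\<in>Q. sparse_op M T f t \<partial>M)"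
      unfolding sparse_op_def
      by (intro nn_integral_mono mult_right_mono nn_integral_count_space_mono_set) auto
    finally show ?thesis .
  qed
  have "(\<integral>\<^sup>+t\<in>Q. ennreal \<bar>b t - avg Q\<bar> * f t \<partial>M)
    \<le> (\<integral>\<^sup>+t. ennreal L * (f t * indicator Q t + ?N t * (f t * indicator Q t)) \<partial>M)"
    using dom
  proof (intro nn_integral_mono_AE, elim AE_mp, intro AE_I2 impI)
    fix t assume *: "t \<in> Q \<longrightarrow> ennreal \<bar>b t - avg Q\<bar>
       \<le> ennreal L * (1 + ?N t)"
    show "ennreal \<bar>b t - avg Q\<bar> * f t * indicator Q t
      \<le> ennreal L * (f t * indicator Q t + ?N t * (f t * indicator Q t))"
    proof (cases "t \<in> Q")
      case True
      then have "ennreal \<bar>b t - avg Q\<bar> * f t \<le> ennreal L * (1 + ?N t) * f t"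
        using * by (intro mult_right_mono) auto
      then show ?thesis using True by (simp add: distrib_left distrib_right mult_ac)
    qed simp
  qed
  also have "\<dots> = ennreal L * ((set_nn_integral M Q f)
      + (\<integral>\<^sup>+t. ?N t * (f t * indicator Q t) \<partial>M))"
    by (subst nn_integral_cmult, measurable) (subst nn_integral_add, auto)
  also have "\<dots> \<le> ennreal L * ((set_nn_integral M Q f) + (\<integral>\<^sup>+t\<in>Q. sparse_op M T f t \<partial>M))"
    by (intro mult_left_mono add_left_mono cnt) auto
  finally show ?thesis .
qed

text \<open>The stopping family varies with F, but its sparsity constant 1/2 and overlap 1 do not,
  so the bound is uniform in F. Since K \<ge> 1, the term with a single sparse operator is absorbed
  into the power of the composition.\<close>

lemma comm_form_bound:
  assumes W: "dual_weights M p q v s"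
    and S: "sparse_family M \<Lambda> N S" "S \<subseteq> cubes" "0 < \<Lambda>"
    and Ap: "dual_weights.Ap_on M p v s cubes K" and K: "1 \<le> K"
    and f: "f \<in> borel_measurable M" "Lp_pow M p v f \<le> 1"
    and g: "g \<in> borel_measurable M" "Lp_pow M q s g \<le> 1"
  shows "comm_form M avg b S f g \<le> ennreal (6 * \<kappa> * B * (dual_weights.sparse_const p q \<Lambda> N
     * (1 + dual_weights.sparse_const p q (1/2) 1)) * K powr (2 * max 1 (1 / (p - 1))))"
proof -
  interpret W: dual_weights M p q v s by fact
  let ?e = "max 1 (1 / (p - 1))"
  have L: "0 \<le> 6 * \<kappa> * B" using \<kappa>_ge_1 B_pos by simp
  have Ap_sub: "W.Ap_on A K" if "A \<subseteq> cubes" for A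
    using Ap that unfolding W.Ap_on_def by (meson subsetD)
  show ?thesis unfolding comm_form_def
  proof (rule nn_integral_count_space_le_finite_sums)
    show "countable S" using S(1) by (simp add: sparse_family_def)
    fix F assume F: "finite F" "F \<subseteq> S"
    have Fc: "F \<subseteq> cubes" using F S by blast
    have SF: "sparse_family M \<Lambda> N F" using S(1) F(2) by (rule sparse_family_subset)
    obtain T where T: "T \<subseteq> cubes" "sparse_family M (1 / 2) 1 T" and
      dom: "AE x in M. \<forall>Q\<in>F. x \<in> Q \<longrightarrow> ennreal \<bar>b x - avg Q\<bar>
       \<le> ennreal (6 * \<kappa> * B) * (1 + (\<integral>\<^sup>+R. indicator R x \<partial>count_space {R\<in>T. R \<subseteq> Q}))"
      using oscillation_domination[OF F(1) Fc] by blast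
    have "(\<Sum>Q\<in>F. (\<integral>\<^sup>+t\<in>Q. ennreal \<bar>b t - avg Q\<bar> * f t \<partial>M) * (set_nn_integral M Q g) / emeasure M Q)
      \<le> (\<Sum>Q\<in>F. ennreal (6 * \<kappa> * B) * ((set_nn_integral M Q f) * (set_nn_integral M Q g) / emeasure M Q
          + (\<integral>\<^sup>+t\<in>Q. sparse_op M T f t \<partial>M) * (set_nn_integral M Q g) / emeasure M Q))"
    proof (rule sum_mono)
      fix Q assume Q: "Q \<in> F"
      have "(\<integral>\<^sup>+t\<in>Q. ennreal \<bar>b t - avg Q\<bar> * f t \<partial>M)
        \<le> ennreal (6 * \<kappa> * B) * ((set_nn_integral M Q f) + (\<integral>\<^sup>+t\<in>Q. sparse_op M T f t \<partial>M))"
      proof (rule oscillation_integral_le[OF T(1) _ _ f(1)])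
        show "Q \<in> cubes" using Q Fc by blast
        show "AE x in M. x \<in> Q \<longrightarrow> ennreal \<bar>b x - avg Q\<bar>
          \<le> ennreal (6 * \<kappa> * B) * (1 + (\<integral>\<^sup>+R. indicator R x \<partial>count_space {R\<in>T. R \<subseteq> Q}))"
          using dom by (rule AE_mp) (use Q in auto)
      qed
      then have "(\<integral>\<^sup>+t\<in>Q. ennreal \<bar>b t - avg Q\<bar> * f t \<partial>M) * ((set_nn_integral M Q g) / emeasure M Q)
        \<le> ennreal (6 * \<kappa> * B) * ((set_nn_integral M Q f) + (\<integral>\<^sup>+t\<in>Q. sparse_op M T f t \<partial>M)) * ((set_nn_integral M Q g) / emeasure M Q)"
        by (rule mult_right_mono) simp
      then show "(\<integral>\<^sup>+t\<in>Q. ennreal \<bar>b t - avg Q\<bar> * f t \<partial>M) * (set_nn_integral M Q g) / emeasure M Q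
        \<le> ennreal (6 * \<kappa> * B) * ((set_nn_integral M Q f) * (set_nn_integral M Q g) / emeasure M Q
          + (\<integral>\<^sup>+t\<in>Q. sparse_op M T f t \<partial>M) * (set_nn_integral M Q g) / emeasure M Q)"
        by (simp add: ennreal_times_divide[symmetric] distrib_right distrib_left mult.assoc)
    qed
    also have "\<dots> = ennreal (6 * \<kappa> * B) * (sparse_form M F f g + sparse_form M F (sparse_op M T f) g)"
      using F(1) by (simp add: sparse_form_def nn_integral_count_space_finite sum_distrib_left[symmetric] sum.distrib)
    also have "\<dots> \<le> ennreal (6 * \<kappa> * B) * (ennreal (W.sparse_const \<Lambda> N * K powr ?e)
       + ennreal (W.sparse_const \<Lambda> N * W.sparse_const (1/2) 1 * K powr (2 * ?e)))"
      using K by (intro mult_left_mono add_mono W.sparse_form_bound[OF SF S(3) Ap_sub[OF Fc] _ f g]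
        W.sparse_form_compose_bound[OF SF S(3) Ap_sub[OF Fc] _ T(2) _ Ap_sub[OF T(1)] f g]) auto
    also have "\<dots> \<le> ennreal (6 * \<kappa> * B) * (ennreal (W.sparse_const \<Lambda> N * K powr (2 * ?e))
       + ennreal (W.sparse_const \<Lambda> N * W.sparse_const (1/2) 1 * K powr (2 * ?e)))"
      using K W.sparse_const_pos[OF S(3), of N]
      by (intro mult_left_mono add_right_mono ennreal_leI powr_mono) auto
    also have "\<dots> = ennreal (6 * \<kappa> * B * (W.sparse_const \<Lambda> N * (1 + W.sparse_const (1/2) 1)) * K powr (2 * ?e))"
      using L W.sparse_const_pos[OF S(3), of N] W.sparse_const_pos[of "1/2" 1]
      by (simp add: ennreal_mult[symmetric] algebra_simps flip: ennreal_plus)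
    finally show "(\<Sum>Q\<in>F. (\<integral>\<^sup>+t\<in>Q. ennreal \<bar>b t - avg Q\<bar> * f t \<partial>M) * (set_nn_integral M Q g) / emeasure M Q)
      \<le> ennreal (6 * \<kappa> * B * (W.sparse_const \<Lambda> N * (1 + W.sparse_const (1/2) 1)) * K powr (2 * ?e))" .
  qed
qed

end

section \<open>Operators behind the commutator forms\<close>

definition comm_op :: "'a measure \<Rightarrow> ('a set \<Rightarrow> real) \<Rightarrow> ('a \<Rightarrow> real) \<Rightarrow> 'a set set
    \<Rightarrow> ('a \<Rightarrow> ennreal) \<Rightarrow> 'a \<Rightarrow> ennreal" where
  "comm_op M a b S f x = (\<integral>\<^sup>+Q. (set_nn_integral M Q f) / emeasure M Q * (ennreal \<bar>b x - a Q\<bar> * indicator Q x) \<partial>count_space S)"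

definition comm_adj_op :: "'a measure \<Rightarrow> ('a set \<Rightarrow> real) \<Rightarrow> ('a \<Rightarrow> real) \<Rightarrow> 'a set set
    \<Rightarrow> ('a \<Rightarrow> ennreal) \<Rightarrow> 'a \<Rightarrow> ennreal" where
  "comm_adj_op M a b S f x =
     (\<integral>\<^sup>+Q. (\<integral>\<^sup>+t\<in>Q. ennreal \<bar>b t - a Q\<bar> * f t \<partial>M) / emeasure M Q * indicator Q x \<partial>count_space S)"

lemma comm_op_dual:
  assumes S: "countable S" "\<And>Q. Q \<in> S \<Longrightarrow> Q \<in> sets M" and b: "b \<in> borel_measurable M" and g: "g \<in> borel_measurable M"
  shows "comm_op M a b S f \<in> borel_measurable M"
    and "(\<integral>\<^sup>+x. comm_op M a b S f x * g x \<partial>M) = comm_form M a b S g f"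
proof -
  have h: "(\<lambda>x. ennreal \<bar>b x - a Q\<bar> * indicator Q x) \<in> borel_measurable M" if "Q \<in> S" for Q
    using S(2)[OF that] b by measurable
  note r = rank_one_sum_dual[of S "\<lambda>Q x. ennreal \<bar>b x - a Q\<bar> * indicator Q x" M g "\<lambda>Q. (set_nn_integral M Q f) / emeasure M Q", OF S(1) h g]
  show "comm_op M a b S f \<in> borel_measurable M"
    using r(1) by (simp add: comm_op_def[abs_def])
  show "(\<integral>\<^sup>+x. comm_op M a b S f x * g x \<partial>M) = comm_form M a b S g f"
  proof -
    have "(\<integral>\<^sup>+x. comm_op M a b S f x * g x \<partial>M) = (\<integral>\<^sup>+Q. (set_nn_integral M Q f) / emeasure M Q
        * (\<integral>\<^sup>+x. ennreal \<bar>b x - a Q\<bar> * indicator Q x * g x \<partial>M) \<partial>count_space S)"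
      unfolding comm_op_def by (rule r(2))
    also have "\<dots> = comm_form M a b S g f"
      unfolding comm_form_def by (intro nn_integral_cong) (simp add: divide_ennreal_def mult_ac)
    finally show ?thesis .
  qed
qed

lemma comm_adj_op_dual:
  assumes S: "countable S" "\<And>Q. Q \<in> S \<Longrightarrow> Q \<in> sets M" and g: "g \<in> borel_measurable M"
  shows "comm_adj_op M a b S f \<in> borel_measurable M"
    and "(\<integral>\<^sup>+x. comm_adj_op M a b S f x * g x \<partial>M) = comm_form M a b S f g"
proof -
  have h: "indicator Q \<in> borel_measurable M" if "Q \<in> S" for Q
    using S(2)[OF that] by measurable
  note r = rank_one_sum_dual[of S indicator M g "\<lambda>Q. (\<integral>\<^sup>+t\<in>Q. ennreal \<bar>b t - a Q\<bar> * f t \<partial>M) / emeasure M Q", OF S(1) h g]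
  show "comm_adj_op M a b S f \<in> borel_measurable M"
    using r(1) by (simp add: comm_adj_op_def[abs_def])
  show "(\<integral>\<^sup>+x. comm_adj_op M a b S f x * g x \<partial>M) = comm_form M a b S f g"
  proof -
    have "(\<integral>\<^sup>+x. comm_adj_op M a b S f x * g x \<partial>M) = (\<integral>\<^sup>+Q. (\<integral>\<^sup>+t\<in>Q. ennreal \<bar>b t - a Q\<bar> * f t \<partial>M) / emeasure M Q
        * (\<integral>\<^sup>+x. indicator Q x * g x \<partial>M) \<partial>count_space S)"
      unfolding comm_adj_op_def by (rule r(2))
    also have "\<dots> = comm_form M a b S f g"
      unfolding comm_form_def by (intro nn_integral_cong) (simp add: divide_ennreal_def mult_ac)
    finally show ?thesis .
  qed
qed

lemma comm_form_cmult:
  assumes S: "\<And>Q. Q \<in> S \<Longrightarrow> Q \<in> sets M" and b: "b \<in> borel_measurable M"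
    and f: "f \<in> borel_measurable M" and g: "g \<in> borel_measurable M"
  shows "comm_form M a b S (\<lambda>x. c * f x) g = c * comm_form M a b S f g"
    and "comm_form M a b S f (\<lambda>x. c * g x) = c * comm_form M a b S f g"
proof -
  note b [measurable] f [measurable] g [measurable]
  have ac: "(c * x) * y / z = c * (x * y / z)" "x * (c * y) / z = c * (x * y / z)" for x y z :: ennreal
    by (simp_all add: divide_ennreal_def mult_ac)
  have 1: "(\<integral>\<^sup>+t\<in>Q. ennreal \<bar>b t - a Q\<bar> * (c * f t) \<partial>M) = c * (\<integral>\<^sup>+t\<in>Q. ennreal \<bar>b t - a Q\<bar> * f t \<partial>M)" if "Q \<in> S" for Q
  proof -
    have [measurable]: "Q \<in> sets M" using that S by blast
    have "(\<integral>\<^sup>+t\<in>Q. ennreal \<bar>b t - a Q\<bar> * (c * f t) \<partial>M) = (\<integral>\<^sup>+t. c * (ennreal \<bar>b t - a Q\<bar> * f t * indicator Q t) \<partial>M)"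
      by (simp add: mult_ac)
    also have "\<dots> = c * (\<integral>\<^sup>+t\<in>Q. ennreal \<bar>b t - a Q\<bar> * f t \<partial>M)"
      by (rule nn_integral_cmult) measurable
    finally show ?thesis .
  qed
  have 2: "(\<integral>\<^sup>+t\<in>Q. c * g t \<partial>M) = c * (set_nn_integral M Q g)" if "Q \<in> S" for Q
  proof -
    have [measurable]: "Q \<in> sets M" using that S by blast
    show ?thesis unfolding mult.assoc by (rule nn_integral_cmult) measurable
  qed
  have "comm_form M a b S (\<lambda>x. c * f x) g = (\<integral>\<^sup>+Q. c * ((\<integral>\<^sup>+t\<in>Q. ennreal \<bar>b t - a Q\<bar> * f t \<partial>M) * (set_nn_integral M Q g)
      / emeasure M Q) \<partial>count_space S)"
    unfolding comm_form_def
  proof (rule nn_integral_cong)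
    fix Q assume "Q \<in> space (count_space S)"
    then have "Q \<in> S" by simp
    show "(\<integral>\<^sup>+t\<in>Q. ennreal \<bar>b t - a Q\<bar> * (c * f t) \<partial>M) * (set_nn_integral M Q g) / emeasure M Q
      = c * ((\<integral>\<^sup>+t\<in>Q. ennreal \<bar>b t - a Q\<bar> * f t \<partial>M) * (set_nn_integral M Q g) / emeasure M Q)"
      unfolding 1[OF \<open>Q \<in> S\<close>] by (rule ac)
  qed
  then show "comm_form M a b S (\<lambda>x. c * f x) g = c * comm_form M a b S f g"
    unfolding comm_form_def by (subst (asm) nn_integral_cmult) auto
  have "comm_form M a b S f (\<lambda>x. c * g x) = (\<integral>\<^sup>+Q. c * ((\<integral>\<^sup>+t\<in>Q. ennreal \<bar>b t - a Q\<bar> * f t \<partial>M) * (set_nn_integral M Q g)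
      / emeasure M Q) \<partial>count_space S)"
    unfolding comm_form_def
  proof (rule nn_integral_cong)
    fix Q assume "Q \<in> space (count_space S)"
    then have "Q \<in> S" by simp
    show "(\<integral>\<^sup>+t\<in>Q. ennreal \<bar>b t - a Q\<bar> * f t \<partial>M) * (\<integral>\<^sup>+t\<in>Q. c * g t \<partial>M) / emeasure M Q
      = c * ((\<integral>\<^sup>+t\<in>Q. ennreal \<bar>b t - a Q\<bar> * f t \<partial>M) * (set_nn_integral M Q g) / emeasure M Q)"
      unfolding 2[OF \<open>Q \<in> S\<close>] by (rule ac)
  qed
  then show "comm_form M a b S f (\<lambda>x. c * g x) = c * comm_form M a b S f g"
    unfolding comm_form_def by (subst (asm) nn_integral_cmult) auto
qed

text \<open>Two limits go through this: scaling by a norm that may be 0, and an oscillation bound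
  that has to stay positive.\<close>

lemma ennreal_le_mult_epsilon:
  fixes x y :: ennreal
  assumes C: "0 \<le> C" and le: "\<And>e. 0 < e \<Longrightarrow> x \<le> ennreal C * (y + ennreal e)"
  shows "x \<le> ennreal C * y"
proof (rule ennreal_le_epsilon)
  fix e :: real assume e: "0 < e"
  have "x \<le> ennreal C * (y + ennreal (e / (C + 1)))" using e C by (intro le) auto
  also have "\<dots> = ennreal C * y + ennreal (C * (e / (C + 1)))"
    using C e by (simp add: distrib_left ennreal_mult del: times_divide_eq_right)
  also have "\<dots> \<le> ennreal C * y + ennreal e"
    using C e by (intro add_left_mono ennreal_leI) (simp add: field_simps)
  finally show "x \<le> ennreal C * y + ennreal e" .
qed

text \<open>Scaling f by (X + e)^(-1/p), with X its p-th power integral, normalises it even when X =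
  0. The scalar passes through the homogeneous form, and \<open>duality\<close> recovers the norm of
  the operator.\<close>

lemma (in dual_weights) operator_bound_from_form:
  fixes T :: "'a \<Rightarrow> ennreal" and form :: "('a \<Rightarrow> ennreal) \<Rightarrow> ('a \<Rightarrow> ennreal) \<Rightarrow> ennreal"
  assumes T: "T \<in> borel_measurable M" and f [measurable]: "f \<in> borel_measurable M"
    and fin: "Lp_pow M p v f < top" and K: "0 \<le> K"
    and dual_eq: "\<And>g. g \<in> borel_measurable M \<Longrightarrow> (\<integral>\<^sup>+x. T x * g x \<partial>M) = form f g"
    and hom: "\<And>c g. g \<in> borel_measurable M \<Longrightarrow> form (\<lambda>x. c * f x) g = c * form f g"
    and bound: "\<And>f g. f \<in> borel_measurable M \<Longrightarrow> Lp_pow M p v f \<le> 1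
      \<Longrightarrow> g \<in> borel_measurable M \<Longrightarrow> Lp_pow M q s g \<le> 1 \<Longrightarrow> form f g \<le> ennreal K"
  shows "Lp_pow M p v T \<le> ennreal (K powr p) * Lp_pow M p v f"
proof (rule ennreal_le_mult_epsilon)
  show "0 \<le> K powr p" by simp
  note T [measurable]
  fix e :: real assume e: "0 < e"
  obtain X where X: "0 \<le> X" "Lp_pow M p v f = ennreal X"
    using fin by (cases "\<integral>\<^sup>+x. epow (f x) p * ennreal (v x) \<partial>M") auto
  define c where "c = (X + e) powr (- 1 / p)"
  have c: "0 < c" and cp: "c powr p = 1 / (X + e)"
    using X e p_gt_1 by (auto simp: c_def powr_powr powr_minus_divide powr_divide)
  have scale: "(\<integral>\<^sup>+x. epow (ennreal c * h x) p * ennreal (v x) \<partial>M) = ennreal (c powr p) * Lp_pow M p v h"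
    if [measurable]: "h \<in> borel_measurable M" for h
    unfolding epow_mult mult.assoc using c by (subst nn_integral_cmult) auto
  have "(\<integral>\<^sup>+x. epow (ennreal c * f x) p * ennreal (v x) \<partial>M) = ennreal (X / (X + e))"
    using X e by (simp add: scale cp ennreal_mult[symmetric] del: ennreal_plus)
  also have "\<dots> \<le> 1" using X e by simp
  finally have n: "(\<integral>\<^sup>+x. epow (ennreal c * f x) p * ennreal (v x) \<partial>M) \<le> 1" .
  have "(\<integral>\<^sup>+x. epow (ennreal c * T x) p * ennreal (v x) \<partial>M) \<le> ennreal (K powr p)"
  proof (rule duality[OF _ K])
    show "(\<lambda>x. ennreal c * T x) \<in> borel_measurable M" by measurable
    fix g assume g: "g \<in> borel_measurable M" "Lp_pow M q s g \<le> 1"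
    note g(1) [measurable]
    have "(\<integral>\<^sup>+x. ennreal c * T x * g x \<partial>M) = ennreal c * (\<integral>\<^sup>+x. T x * g x \<partial>M)"
      unfolding mult.assoc by (rule nn_integral_cmult) measurable
    also have "\<dots> = form (\<lambda>x. ennreal c * f x) g"
      using dual_eq[OF g(1)] hom[OF g(1)] by simp
    also have "\<dots> \<le> ennreal K" by (intro bound n g) measurable
    finally show "(\<integral>\<^sup>+x. ennreal c * T x * g x \<partial>M) \<le> ennreal K" .
  qed
  then have *: "ennreal (1 / (X + e)) * Lp_pow M p v T \<le> ennreal (K powr p)"
    by (simp add: scale cp)
  have "ennreal (X + e) * (ennreal (1 / (X + e)) * y) = y" for y
    using X e by (simp add: mult.assoc[symmetric] ennreal_mult[symmetric] del: ennreal_plus)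
  then have "Lp_pow M p v T \<le> ennreal (X + e) * ennreal (K powr p)"
    using mult_left_mono[OF *, of "ennreal (X + e)"] by (simp del: ennreal_plus)
  then show "Lp_pow M p v T \<le> ennreal (K powr p) * (Lp_pow M p v f + ennreal e)"
    using X e by (simp add: mult.commute)
qed

section \<open>The measure and weights on the half-line\<close>

lemma sets_mu_lam [measurable_cong, simp]: "sets (mu_lam lam) = sets borel"
  by (simp add: mu_lam_def)

lemma space_mu_lam [simp]: "space (mu_lam lam) = UNIV"
  by (simp add: mu_lam_def)

lemma sigma_finite_mu_lam: "sigma_finite_measure (mu_lam lam)"
  unfolding mu_lam_def by (subst sigma_finite_measure.sigma_finite_iff_density_finite[OF sigma_finite_lborel]) auto

lemma AE_mu_lam_iff: "(AE x in mu_lam lam. P x) \<longleftrightarrow> (AE x in lborel. 0 < x \<longrightarrow> P x)"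
  unfolding mu_lam_def by (subst AE_density) (auto simp: indicator_def intro!: AE_cong)

lemma nn_integral_mu_lam:
  assumes "f \<in> borel_measurable borel"
  shows "(\<integral>\<^sup>+x. f x \<partial>mu_lam lam) = (\<integral>\<^sup>+x\<in>{0<..}. ennreal (x powr (2 * lam)) * f x \<partial>lborel)"
  unfolding mu_lam_def using assms
  by (subst nn_integral_density) (auto intro!: nn_integral_cong simp: indicator_def)

lemma emeasure_mu_lam:
  assumes "A \<in> sets borel"
  shows "emeasure (mu_lam lam) A = (\<integral>\<^sup>+t\<in>A \<inter> {0<..}. ennreal (t powr (2 * lam)) \<partial>lborel)"
  unfolding mu_lam_def using assms
  by (subst emeasure_density) (auto intro!: nn_integral_cong simp: indicator_def)

lemma emeasure_mu_lam_le:
  assumes A: "A \<in> sets borel" and c: "\<And>t. t \<in> A \<Longrightarrow> t \<le> c" and lam: "0 < lam"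
  shows "emeasure (mu_lam lam) A \<le> ennreal (c powr (2 * lam)) * emeasure lborel A"
proof -
  have "emeasure (mu_lam lam) A \<le> (\<integral>\<^sup>+t. ennreal (c powr (2 * lam)) * indicator A t \<partial>lborel)"
    unfolding emeasure_mu_lam[OF A] using c lam
    by (intro nn_integral_mono) (auto simp: indicator_def intro!: ennreal_leI powr_mono2)
  then show ?thesis using A by (simp add: nn_integral_cmult_indicator)
qed

lemma emeasure_mu_lam_ge:
  assumes A: "A \<in> sets borel" and c: "\<And>t. t \<in> A \<Longrightarrow> c \<le> t" "0 < c" and lam: "0 < lam"
  shows "ennreal (c powr (2 * lam)) * emeasure lborel A \<le> emeasure (mu_lam lam) A"
proof -
  have "(\<integral>\<^sup>+t. ennreal (c powr (2 * lam)) * indicator A t \<partial>lborel) \<le> emeasure (mu_lam lam) A"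
    unfolding emeasure_mu_lam[OF A]
  proof (rule nn_integral_mono)
    fix t
    show "ennreal (c powr (2 * lam)) * indicator A t \<le> ennreal (t powr (2 * lam)) * indicator (A \<inter> {0<..}) t"
    proof (cases "t \<in> A")
      case True
      then have "c \<le> t" "0 < t" using c(1)[OF True] c(2) by auto
      then show ?thesis using True c(2) lam by (auto intro!: ennreal_leI powr_mono2)
    qed simp
  qed
  then show ?thesis using A by (simp add: nn_integral_cmult_indicator)
qed

text \<open>The cost of enlarging a ball by \<rho>: the enlarged ball is 4 \<rho> times as long as a
  quarter of the original one, and the density t^(2 \<open>lam\<close>) grows by at most (2
  \<rho>)^(2 \<open>lam\<close>).\<close>

definition doubling_const :: "real \<Rightarrow> real \<Rightarrow> real" where
  "doubling_const lam \<rho> = 4 * \<rho> * (2 * \<rho>) powr (2 * lam)"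

lemma mu_lam_doubling:
  assumes lam: "0 < lam" and z: "0 < z" and r: "0 < r" and \<rho>: "1 \<le> \<rho>"
  shows "emeasure (mu_lam lam) (ball z (\<rho> * r)) \<le> ennreal (doubling_const lam \<rho>) * emeasure (mu_lam lam) (ball z r \<inter> {0<..})"
proof -
  \<comment> \<open>The rightmost quarter of the ball stays in the half-line even when the ball
    reaches below 0. On it t is at least z + r/2, and z + \<rho> r \<le> 2 \<rho> (z + r/2).\<close>
  let ?A = "{z + r / 2 <..< z + r}"
  have "emeasure (mu_lam lam) (ball z (\<rho> * r)) \<le> ennreal ((z + \<rho> * r) powr (2 * lam)) * emeasure lborel (ball z (\<rho> * r))"
    using lam by (intro emeasure_mu_lam_le) (auto simp: ball_eq_greaterThanLessThan)
  also have "emeasure lborel (ball z (\<rho> * r)) = ennreal (2 * (\<rho> * r))"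
    using r \<rho> by (simp add: ball_eq_greaterThanLessThan)
  also have "ennreal ((z + \<rho> * r) powr (2 * lam)) * ennreal (2 * (\<rho> * r)) = ennreal ((z + \<rho> * r) powr (2 * lam) * (2 * (\<rho> * r)))"
    using r \<rho> by (simp add: ennreal_mult[symmetric])
  also have "\<dots> \<le> ennreal ((2 * \<rho>) powr (2 * lam) * (z + r / 2) powr (2 * lam) * (4 * \<rho> * (r / 2)))"
  proof (rule ennreal_leI, rule mult_mono)
    have "z * 1 \<le> z * (2 * \<rho>)" using z \<rho> by (intro mult_left_mono) auto
    then have "z + \<rho> * r \<le> (2 * \<rho>) * (z + r / 2)" by (simp add: algebra_simps)
    then have "(z + \<rho> * r) powr (2 * lam) \<le> ((2 * \<rho>) * (z + r / 2)) powr (2 * lam)"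
      using lam z r \<rho> by (intro powr_mono2) auto
    also have "\<dots> = (2 * \<rho>) powr (2 * lam) * (z + r / 2) powr (2 * lam)"
      using z r \<rho> by (simp add: powr_mult)
    finally show "(z + \<rho> * r) powr (2 * lam) \<le> (2 * \<rho>) powr (2 * lam) * (z + r / 2) powr (2 * lam)" .
  qed (use r \<rho> in auto)
  also have "\<dots> = ennreal (doubling_const lam \<rho>) * (ennreal ((z + r / 2) powr (2 * lam)) * ennreal (r / 2))"
    using r \<rho> by (simp add: doubling_const_def ennreal_mult[symmetric] mult_ac)
  also have "ennreal (r / 2) = emeasure lborel ?A"
    using r by simp
  also have "ennreal (doubling_const lam \<rho>) * (ennreal ((z + r / 2) powr (2 * lam)) * emeasure lborel ?A)
     \<le> ennreal (doubling_const lam \<rho>) * emeasure (mu_lam lam) ?A"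
    using lam z r by (intro mult_left_mono emeasure_mu_lam_ge) auto
  also have "\<dots> \<le> ennreal (doubling_const lam \<rho>) * emeasure (mu_lam lam) (ball z r \<inter> {0<..})"
    using z r by (intro mult_left_mono emeasure_mono) (auto simp: ball_eq_greaterThanLessThan)
  finally show ?thesis .
qed

lemma emeasure_mu_lam_pos:
  assumes "0 < lam" "0 < z" "0 < r"
  shows "0 < emeasure (mu_lam lam) (ball z r \<inter> {0<..})"
proof -
  let ?A = "{z <..< z + r}"
  have "0 < ennreal (z powr (2 * lam)) * emeasure lborel ?A"
    using assms by (simp add: ennreal_zero_less_mult_iff)
  also have "\<dots> \<le> emeasure (mu_lam lam) ?A"
    using assms by (intro emeasure_mu_lam_ge) auto
  also have "\<dots> \<le> emeasure (mu_lam lam) (ball z r \<inter> {0<..})"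
    using assms by (intro emeasure_mono) (auto simp: ball_eq_greaterThanLessThan)
  finally show ?thesis .
qed

lemma emeasure_mu_lam_ball_finite:
  assumes "0 < lam"
  shows "emeasure (mu_lam lam) (ball z r) < top"
proof -
  have "emeasure (mu_lam lam) (ball z r) \<le> ennreal ((z + r) powr (2 * lam)) * emeasure lborel (ball z r)"
    using assms by (intro emeasure_mu_lam_le) (auto simp: ball_eq_greaterThanLessThan)
  also have "\<dots> < top"
    using emeasure_lborel_ball_finite[of z r] by (auto simp: ennreal_mult_less_top)
  finally show ?thesis .
qed

lemma interval_mu_lam:
  assumes "0 < lam" "I \<in> intervals_Rplus"
  shows "I \<in> sets borel" "I \<subseteq> {0<..}" "0 < emeasure (mu_lam lam) I" "emeasure (mu_lam lam) I < top"
    "0 < measure (mu_lam lam) I" "emeasure (mu_lam lam) I = ennreal (measure (mu_lam lam) I)"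
proof -
  obtain a c where I: "I = {a<..<c}" "0 \<le> a" "a < c" using assms(2) by (auto simp: intervals_Rplus_def)
  have eq: "I = ball ((a + c) / 2) ((c - a) / 2)"
    unfolding I ball_eq_greaterThanLessThan by (simp add: field_simps)
  have eq2: "ball ((a + c) / 2) ((c - a) / 2) \<inter> {0<..} = ball ((a + c) / 2) ((c - a) / 2)"
    using I unfolding eq[symmetric] by auto
  show "I \<in> sets borel" "I \<subseteq> {0<..}" using I by auto
  show pos: "0 < emeasure (mu_lam lam) I"
    using emeasure_mu_lam_pos[OF assms(1), of "(a + c) / 2" "(c - a) / 2"] I(2,3) eq eq2 by simp
  show fin: "emeasure (mu_lam lam) I < top"
    unfolding eq using assms(1) by (rule emeasure_mu_lam_ball_finite)
  show e: "emeasure (mu_lam lam) I = ennreal (measure (mu_lam lam) I)"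
    using fin by (intro emeasure_eq_ennreal_measure) auto
  show "0 < measure (mu_lam lam) I" using pos e by simp
qed

text \<open>The ratio 2 C0 / (c0 \<delta>) enlarges the inner ball of a cube of level k + 1 to
  radius 2 C0 \<delta>^k, enough to cover the cube of level k around it. It also enlarges the inner
  ball of a cube beyond its own outer ball, which gives the interval in the second claim.\<close>

lemma dyadic_system_tree:
  assumes lam: "0 < lam" and D: "dyadic_system \<delta> c0 C0 D"
  defines "\<kappa> \<equiv> doubling_const lam (2 * C0 / (c0 * \<delta>))"
  shows "dyadic_tree (mu_lam lam) D {0<..} \<kappa>"
    and "\<And>k Q. Q \<in> D k \<Longrightarrow> \<exists>I\<in>intervals_Rplus. Q \<subseteq> I \<and> emeasure (mu_lam lam) I \<le> ennreal \<kappa> * emeasure (mu_lam lam) Q"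
proof -
  let ?M = "mu_lam lam"
  define \<rho> where "\<rho> = 2 * C0 / (c0 * \<delta>)"
  have par: "0 < \<delta>" "\<delta> < 1" "0 < c0" "c0 \<le> C0" using D by (auto simp: dyadic_system_def)
  have sub: "\<And>k Q. Q \<in> D k \<Longrightarrow> Q \<subseteq> {0<..}" and meas: "\<And>k Q. Q \<in> D k \<Longrightarrow> Q \<in> sets borel"
    and cov: "\<And>k. \<Union>(D k) = {0<..}"
    and dis: "\<And>k P Q. P \<in> D k \<Longrightarrow> Q \<in> D k \<Longrightarrow> P \<noteq> Q \<Longrightarrow> P \<inter> Q = {}"
    and nest: "\<And>k l P Q. k \<le> l \<Longrightarrow> Q \<in> D l \<Longrightarrow> P \<in> D k \<Longrightarrow> Q \<subseteq> P \<or> Q \<inter> P = {}"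
    using D by (auto simp: dyadic_system_def)
  have center: "\<exists>z\<in>Q. ball z (c0 * \<delta> powi k) \<inter> {0<..} \<subseteq> Q \<and> Q \<subseteq> ball z (C0 * \<delta> powi k)" if "Q \<in> D k" for k Q
    using D that by (auto simp: dyadic_system_def)
  have pw: "0 < \<delta> powi k" for k using par by simp
  have \<rho>1: "1 \<le> \<rho>" and \<rho>C: "C0 \<le> \<rho> * c0" and \<rho>2: "2 * C0 = \<rho> * (c0 * \<delta>)"
  proof -
    have "c0 * \<delta> \<le> c0 * 1" using par by (intro mult_left_mono) auto
    then have "c0 * \<delta> \<le> 2 * C0" using par by linarith
    then show "1 \<le> \<rho>" using par by (simp add: \<rho>_def)
    have "C0 * \<delta> \<le> C0 * 1" using par by (intro mult_left_mono) auto
    then have "C0 * \<delta> \<le> 2 * C0" using par by linarith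
    then show "C0 \<le> \<rho> * c0" using par by (simp add: \<rho>_def field_simps)
    show "2 * C0 = \<rho> * (c0 * \<delta>)" using par by (simp add: \<rho>_def)
  qed
  have \<kappa>: "\<kappa> = doubling_const lam \<rho>" by (simp add: \<kappa>_def \<rho>_def)
  have dbl: "emeasure ?M (ball z (\<rho> * (c0 * \<delta> powi k))) \<le> ennreal \<kappa> * emeasure ?M Q"
    if "0 < z" "ball z (c0 * \<delta> powi k) \<inter> {0<..} \<subseteq> Q" "Q \<in> sets borel" for z k Q
  proof -
    have "emeasure ?M (ball z (\<rho> * (c0 * \<delta> powi k))) \<le> ennreal \<kappa> * emeasure ?M (ball z (c0 * \<delta> powi k) \<inter> {0<..})"
      unfolding \<kappa> using that par pw by (intro mu_lam_doubling lam \<rho>1) auto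
    also have "\<dots> \<le> ennreal \<kappa> * emeasure ?M Q"
      using that by (intro mult_left_mono emeasure_mono) auto
    finally show ?thesis .
  qed
  show "\<exists>I\<in>intervals_Rplus. Q \<subseteq> I \<and> emeasure ?M I \<le> ennreal \<kappa> * emeasure ?M Q" if Q: "Q \<in> D k" for k Q
  proof -
    obtain z where z: "z \<in> Q" "ball z (c0 * \<delta> powi k) \<inter> {0<..} \<subseteq> Q" "Q \<subseteq> ball z (C0 * \<delta> powi k)"
      using center[OF Q] by blast
    have z0: "0 < z" using z sub[OF Q] by auto
    define R where "R = \<rho> * (c0 * \<delta> powi k)"
    have CR: "C0 * \<delta> powi k \<le> R" unfolding R_def using mult_right_mono[OF \<rho>C, of "\<delta> powi k"] pw[of k] by (simp add: mult.assoc)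
    have "0 < C0 * \<delta> powi k" using par pw[of k] by (intro mult_pos_pos) auto
    then have R0: "0 < R" using CR by linarith
    let ?I = "{max 0 (z - R)<..<z + R}"
    have "?I \<in> intervals_Rplus" unfolding intervals_Rplus_def mem_Collect_eq
      using z0 R0 by (intro exI[of _ "max 0 (z - R)"] exI[of _ "z + R"]) auto
    moreover have "Q \<subseteq> ?I"
    proof
      fix t assume t: "t \<in> Q"
      then have "t \<in> ball z (C0 * \<delta> powi k)" "0 < t" using z(3) sub[OF Q] by auto
      then show "t \<in> ?I" using CR by (auto simp: ball_eq_greaterThanLessThan)
    qed
    moreover have "emeasure ?M ?I \<le> ennreal \<kappa> * emeasure ?M Q"
    proof -
      have "emeasure ?M ?I \<le> emeasure ?M (ball z R)"
        by (intro emeasure_mono) (auto simp: ball_eq_greaterThanLessThan)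
      also have "\<dots> \<le> ennreal \<kappa> * emeasure ?M Q"
        unfolding R_def using z0 z meas[OF Q] by (intro dbl) auto
      finally show ?thesis .
    qed
    ultimately show ?thesis by blast
  qed
  show "dyadic_tree ?M D {0<..} \<kappa>"
  proof
    show "sets ?M = sets borel" by simp
    show "1 \<le> \<kappa>"
    proof -
      have "1 * 1 \<le> 4 * \<rho> * (2 * \<rho>) powr (2 * lam)"
        using \<rho>1 lam by (intro mult_mono ge_one_powr_ge_zero) auto
      then show ?thesis by (simp add: \<kappa> doubling_const_def)
    qed
    fix k Q assume Q: "Q \<in> D k"
    obtain z where z: "z \<in> Q" "ball z (c0 * \<delta> powi k) \<inter> {0<..} \<subseteq> Q" "Q \<subseteq> ball z (C0 * \<delta> powi k)"
      using center[OF Q] by blast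
    have z0: "0 < z" using z sub[OF Q] by auto
    have "0 < emeasure ?M (ball z (c0 * \<delta> powi k) \<inter> {0<..})"
      using lam z0 par pw by (intro emeasure_mu_lam_pos) auto
    also have "\<dots> \<le> emeasure ?M Q" using z meas[OF Q] by (intro emeasure_mono) auto
    finally show "0 < emeasure ?M Q" .
    have "emeasure ?M Q \<le> emeasure ?M (ball z (C0 * \<delta> powi k))"
      using z by (intro emeasure_mono) auto
    then show "emeasure ?M Q < top" using emeasure_mu_lam_ball_finite[OF lam] by (rule le_less_trans)
  next
    fix k P Q assume PQ: "P \<in> D (k + 1)" "Q \<in> D k" "P \<subseteq> Q"
    obtain z where z: "z \<in> P" "ball z (c0 * \<delta> powi (k + 1)) \<inter> {0<..} \<subseteq> P"
      using center[OF PQ(1)] by blast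
    obtain y where y: "Q \<subseteq> ball y (C0 * \<delta> powi k)" using center[OF PQ(2)] by blast
    have z0: "0 < z" using z sub[OF PQ(1)] by auto
    have e: "\<rho> * (c0 * \<delta> powi (k + 1)) = 2 * (C0 * \<delta> powi k)"
    proof -
      have "\<delta> powi (k + 1) = \<delta> powi k * \<delta>" using par by (simp add: power_int_add_1)
      then have "\<rho> * (c0 * \<delta> powi (k + 1)) = (\<rho> * (c0 * \<delta>)) * \<delta> powi k" by (simp add: mult_ac)
      then show ?thesis unfolding \<rho>2[symmetric] by simp
    qed
    have "Q \<subseteq> ball z (\<rho> * (c0 * \<delta> powi (k + 1)))"
    proof
      fix x assume "x \<in> Q"
      then have "dist y x < C0 * \<delta> powi k" "dist y z < C0 * \<delta> powi k" using y z PQ(3) by auto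
      then show "x \<in> ball z (\<rho> * (c0 * \<delta> powi (k + 1)))" unfolding e
        using dist_triangle3[of z x y] by simp
    qed
    then have "emeasure ?M Q \<le> emeasure ?M (ball z (\<rho> * (c0 * \<delta> powi (k + 1))))"
      by (intro emeasure_mono) auto
    also have "\<dots> \<le> ennreal \<kappa> * emeasure ?M P" using z0 z meas[OF PQ(1)] by (intro dbl) auto
    finally show "emeasure ?M Q \<le> ennreal \<kappa> * emeasure ?M P" .
  next
    fix k
    \<comment> \<open>A rational point chosen in each cube identifies the cube, since cubes of one
      level are disjoint; hence a level is countable.\<close>
    have "\<exists>x. x \<in> \<rat> \<and> x \<in> Q" if Q: "Q \<in> D k" for Q
    proof -
      obtain z where z: "z \<in> Q" "ball z (c0 * \<delta> powi k) \<inter> {0<..} \<subseteq> Q" using center[OF Q] by blast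
      have z0: "0 < z" using z sub[OF Q] by auto
      obtain x where x: "x \<in> \<rat>" "z < x" "x < z + c0 * \<delta> powi k"
        using Rats_dense_in_real[of z "z + c0 * \<delta> powi k"] par pw[of k] by auto
      then have "x \<in> ball z (c0 * \<delta> powi k) \<inter> {0<..}" using z0 by (auto simp: dist_real_def)
      then show ?thesis using x z by blast
    qed
    then obtain h where h: "\<And>Q. Q \<in> D k \<Longrightarrow> h Q \<in> \<rat> \<and> h Q \<in> Q" by metis
    have "inj_on h (D k)"
    proof (rule inj_onI, rule ccontr)
      fix P Q assume "P \<in> D k" "Q \<in> D k" "h P = h Q" "P \<noteq> Q"
      then show False using dis[of P k Q] h[of P] h[of Q] by auto
    qed
    moreover have "countable (h ` D k)"
      using h by (intro countable_subset[OF _ countable_rat]) auto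
    ultimately show "countable (D k)" by (meson countable_image_inj_on)
  next
    fix x :: real and U assume U: "open U" "x \<in> U" "x \<in> {0<..}"
    obtain e where e: "0 < e" "ball x e \<subseteq> U" using U openE by blast
    have C0: "0 < C0" using par by linarith
    obtain n where n: "\<delta> ^ n < e / (2 * C0)"
      using real_arch_pow_inv[of "e / (2 * C0)" \<delta>] e C0 par by auto
    have "\<forall>j\<ge>int n. \<forall>Q\<in>D j. x \<in> Q \<longrightarrow> Q \<subseteq> U"
    proof (intro allI impI ballI)
      fix j Q assume j: "int n \<le> j" and Q: "Q \<in> D j" "x \<in> Q"
      have "\<delta> powi j = \<delta> ^ nat j" using j by (simp add: power_int_def)
      also have "\<dots> \<le> \<delta> ^ n" using j par by (intro power_decreasing) auto
      finally have "\<delta> powi j < e / (2 * C0)" using n by linarith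
      then have small: "2 * (C0 * \<delta> powi j) < e" using C0 by (simp add: field_simps)
      obtain y where y: "Q \<subseteq> ball y (C0 * \<delta> powi j)" using center[OF Q(1)] by blast
      have "Q \<subseteq> ball x e"
      proof
        fix t assume "t \<in> Q"
        then have "dist y t < C0 * \<delta> powi j" "dist y x < C0 * \<delta> powi j" using y Q(2) by auto
        then show "t \<in> ball x e" using dist_triangle3[of x t y] small by simp
      qed
      then show "Q \<subseteq> U" using e by blast
    qed
    then show "\<exists>k. \<forall>j\<ge>k. \<forall>Q\<in>D j. x \<in> Q \<longrightarrow> Q \<subseteq> U" by blast
  qed (fact meas cov dis nest)+
qed

text \<open>For w in the weight class the value 1 is taken only on a null set of the half-line. It
  makes the weight positive at every point, as \<open>dual_weights\<close> demands.\<close>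

definition dual_weight_v :: "real \<Rightarrow> (real \<Rightarrow> real) \<Rightarrow> real \<Rightarrow> real" where
  "dual_weight_v lam w x = (if 0 < x \<and> 0 < w x then w x * x powr (- 2 * lam) else 1)"

definition dual_weight_s :: "real \<Rightarrow> real \<Rightarrow> (real \<Rightarrow> real) \<Rightarrow> real \<Rightarrow> real" where
  "dual_weight_s lam p w x = dual_weight_v lam w x powr (- 1 / (p - 1))"

lemma dual_weight_v_pos: "0 < dual_weight_v lam w x"
  by (simp add: dual_weight_v_def)

lemma dual_weights_mu_lam:
  assumes p: "1 < p" and w [measurable]: "w \<in> borel_measurable borel"
  shows "dual_weights (mu_lam lam) p (p / (p - 1)) (dual_weight_v lam w) (dual_weight_s lam p w)"
proof -
  interpret sigma_finite_measure "mu_lam lam" by (rule sigma_finite_mu_lam)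
  have v [measurable]: "dual_weight_v lam w \<in> borel_measurable borel"
    unfolding dual_weight_v_def by measurable
  have s: "dual_weight_s lam p w \<in> borel_measurable borel"
    unfolding dual_weight_s_def by measurable
  show ?thesis
  proof
    show "1 / p + 1 / (p / (p - 1)) = 1" "1 < p / (p - 1)" using p by (auto simp: field_simps)
    fix x
    show "0 < dual_weight_s lam p w x" using dual_weight_v_pos[of lam w x] by (simp add: dual_weight_s_def)
    have "1 / p + (- 1 / (p - 1)) * (1 / (p / (p - 1))) = 0" using p by (simp add: field_simps)
    then have e: "dual_weight_v lam w x powr (1 / p + (- 1 / (p - 1)) * (1 / (p / (p - 1)))) = 1"
      using dual_weight_v_pos[of lam w x] by (simp only: powr_zero_eq_one) simp
    show "dual_weight_v lam w x powr (1 / p) * dual_weight_s lam p w x powr (1 / (p / (p - 1))) = 1"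
      unfolding dual_weight_s_def powr_powr powr_add[symmetric] by (rule e)
  qed (use p v s dual_weight_v_pos in auto)
qed

lemma nn_integral_dual_weight_v:
  assumes w: "in_Ap_tilde lam p w" and h: "h \<in> borel_measurable borel"
  shows "(\<integral>\<^sup>+x. h x * ennreal (dual_weight_v lam w x) \<partial>mu_lam lam) = (\<integral>\<^sup>+x\<in>{0<..}. h x * ennreal (w x) \<partial>lborel)"
proof -
  have wm [measurable]: "w \<in> borel_measurable borel" and wpos: "AE t in lborel. t > 0 \<longrightarrow> w t > 0"
    using w by (auto simp: in_Ap_tilde_def)
  note h [measurable]
  have "(\<integral>\<^sup>+x. h x * ennreal (dual_weight_v lam w x) \<partial>mu_lam lam)
    = (\<integral>\<^sup>+x\<in>{0<..}. ennreal (x powr (2 * lam)) * (h x * ennreal (dual_weight_v lam w x)) \<partial>lborel)"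
    unfolding dual_weight_v_def by (rule nn_integral_mu_lam) measurable
  also have "\<dots> = (\<integral>\<^sup>+x\<in>{0<..}. h x * ennreal (w x) \<partial>lborel)"
    using wpos
  proof (intro nn_integral_cong_AE, elim AE_mp, intro AE_I2 impI)
    fix x assume x: "x > 0 \<longrightarrow> w x > 0"
    show "ennreal (x powr (2 * lam)) * (h x * ennreal (dual_weight_v lam w x)) * indicator {0<..} x
       = h x * ennreal (w x) * indicator {0<..} x"
    proof (cases "0 < x")
      case True
      then have "x powr (2 * lam) * dual_weight_v lam w x = w x"
        using x by (simp add: dual_weight_v_def powr_minus field_simps)
      then have "ennreal (x powr (2 * lam)) * ennreal (dual_weight_v lam w x) = ennreal (w x)"
        using dual_weight_v_pos[of lam w x] by (simp add: ennreal_mult[symmetric])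
      then have "ennreal (x powr (2 * lam)) * (h x * ennreal (dual_weight_v lam w x)) = h x * ennreal (w x)"
        by (simp add: mult.left_commute)
      then show ?thesis by simp
    qed simp
  qed
  finally show ?thesis .
qed

text \<open>The density x^(2 \<open>lam\<close>) times (w x^(-2 \<open>lam\<close>))^(-1/(p-1))
  carries x to the power 2 \<open>lam\<close> + 2 \<open>lam\<close>/(p-1) = 2 \<open>lam\<close>
  p/(p-1), the power in the modified condition.\<close>

lemma nn_integral_dual_weight_s:
  assumes p: "1 < p" and w: "in_Ap_tilde lam p w" and I: "I \<in> sets borel" "I \<subseteq> {0<..}"
  shows "(\<integral>\<^sup>+x\<in>I. ennreal (dual_weight_s lam p w x) \<partial>mu_lam lam)
     = (\<integral>\<^sup>+t\<in>I. ennreal (t powr (2 * lam * (p / (p - 1))) * w t powr (- 1 / (p - 1))) \<partial>lborel)"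
proof -
  have wm [measurable]: "w \<in> borel_measurable borel" and wpos: "AE t in lborel. t > 0 \<longrightarrow> w t > 0"
    using w by (auto simp: in_Ap_tilde_def)
  note I(1) [measurable]
  have "(\<integral>\<^sup>+x\<in>I. ennreal (dual_weight_s lam p w x) \<partial>mu_lam lam)
    = (\<integral>\<^sup>+x\<in>{0<..}. ennreal (x powr (2 * lam)) * (ennreal (dual_weight_s lam p w x) * indicator I x) \<partial>lborel)"
    unfolding dual_weight_s_def dual_weight_v_def by (rule nn_integral_mu_lam) measurable
  also have "\<dots> = (\<integral>\<^sup>+t\<in>I. ennreal (t powr (2 * lam * (p / (p - 1))) * w t powr (- 1 / (p - 1))) \<partial>lborel)"
    using wpos
  proof (intro nn_integral_cong_AE, elim AE_mp, intro AE_I2 impI)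
    fix x assume x: "x > 0 \<longrightarrow> w x > 0"
    show "ennreal (x powr (2 * lam)) * (ennreal (dual_weight_s lam p w x) * indicator I x) * indicator {0<..} x
      = ennreal (x powr (2 * lam * (p / (p - 1))) * w x powr (- 1 / (p - 1))) * indicator I x"
    proof (cases "x \<in> I")
      case True
      then have x0: "0 < x" "0 < w x" using I x by auto
      have "dual_weight_s lam p w x = w x powr (- 1 / (p - 1)) * x powr (2 * lam / (p - 1))"
        using x0 by (simp add: dual_weight_s_def dual_weight_v_def powr_mult powr_powr)
      then have "x powr (2 * lam) * dual_weight_s lam p w x
          = (x powr (2 * lam) * x powr (2 * lam / (p - 1))) * w x powr (- 1 / (p - 1))"
        by (simp only: mult_ac)
      also have "x powr (2 * lam) * x powr (2 * lam / (p - 1)) = x powr (2 * lam * (p / (p - 1)))"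
      proof -
        have "2 * lam + 2 * lam / (p - 1) = 2 * lam * (p / (p - 1))" using p by (simp add: field_simps)
        then show ?thesis by (simp add: powr_add[symmetric])
      qed
      finally have "x powr (2 * lam) * dual_weight_s lam p w x = x powr (2 * lam * (p / (p - 1))) * w x powr (- 1 / (p - 1))" .
      then show ?thesis using True x0 dual_weight_v_pos[of lam w x]
        by (simp add: dual_weight_s_def ennreal_mult[symmetric])
    qed simp
  qed
  finally show ?thesis .
qed

section \<open>The weighted estimate\<close>

lemma set_nn_integral_eq_integral:
  fixes h :: "'a \<Rightarrow> real"
  assumes "set_integrable M I h" and "\<And>x. x \<in> I \<Longrightarrow> 0 \<le> h x"
  shows "(\<integral>\<^sup>+x\<in>I. ennreal (h x) \<partial>M) = ennreal (\<integral>x\<in>I. h x \<partial>M)"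
proof -
  have "(\<integral>\<^sup>+x\<in>I. ennreal (h x) \<partial>M) = (\<integral>\<^sup>+x. ennreal (indicator I x *\<^sub>R h x) \<partial>M)"
    by (intro nn_integral_cong) (auto simp: indicator_def)
  also have "\<dots> = ennreal (\<integral>x. indicator I x *\<^sub>R h x \<partial>M)"
    using assms by (intro nn_integral_eq_integral) (auto simp: set_integrable_def indicator_def)
  finally show ?thesis by (simp add: set_lebesgue_integral_def)
qed

lemma bmo_norm_nonneg:
  assumes "in_BMO lam b"
  shows "0 \<le> bmo_norm lam b"
proof -
  let ?I = "{0<..<1::real}"
  have I: "?I \<in> intervals_Rplus" by (force simp: intervals_Rplus_def)
  have "0 \<le> avg_mu lam ?I (\<lambda>t. \<bar>b t - avg_mu lam ?I b\<bar>)"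
    unfolding avg_mu_def[of lam ?I "\<lambda>t. \<bar>b t - avg_mu lam ?I b\<bar>"] set_lebesgue_integral_def
    by (intro divide_nonneg_nonneg integral_nonneg) auto
  also have "\<dots> \<le> bmo_norm lam b"
    unfolding bmo_norm_def using assms I by (intro cSUP_upper) (auto simp: in_BMO_def)
  finally show ?thesis .
qed

lemma interval_oscillation:
  assumes lam: "0 < lam" and b: "in_BMO lam b" and I: "I \<in> intervals_Rplus"
  shows "(\<integral>\<^sup>+t\<in>I. ennreal \<bar>b t - avg_mu lam I b\<bar> \<partial>mu_lam lam) \<le> ennreal (bmo_norm lam b) * emeasure (mu_lam lam) I"
proof -
  let ?c = "avg_mu lam I b"
  note Im = interval_mu_lam[OF lam I]
  have bi: "set_integrable (mu_lam lam) I b" using b I by (auto simp: in_BMO_def)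
  have ci: "set_integrable (mu_lam lam) I (\<lambda>t. ?c)"
    using Im by (auto simp: set_integrable_def integrable_indicator_iff)
  have int: "set_integrable (mu_lam lam) I (\<lambda>t. \<bar>b t - ?c\<bar>)"
    by (intro set_integrable_abs set_integral_diff(1) bi ci)
  have "avg_mu lam I (\<lambda>t. \<bar>b t - ?c\<bar>) \<le> bmo_norm lam b"
    unfolding bmo_norm_def using b I by (intro cSUP_upper) (auto simp: in_BMO_def)
  then have "(\<integral>t\<in>I. \<bar>b t - ?c\<bar> \<partial>mu_lam lam) \<le> bmo_norm lam b * measure (mu_lam lam) I"
    using Im(5) unfolding avg_mu_def[of lam I "\<lambda>t. \<bar>b t - ?c\<bar>"] by (simp add: divide_le_eq)
  then have "ennreal (\<integral>t\<in>I. \<bar>b t - ?c\<bar> \<partial>mu_lam lam) \<le> ennreal (bmo_norm lam b) * ennreal (measure (mu_lam lam) I)"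
    using bmo_norm_nonneg[OF b] by (simp add: ennreal_mult[symmetric] ennreal_leI)
  then show ?thesis
    using set_nn_integral_eq_integral[OF int] Im(6) by simp
qed

text \<open>A surrounding interval costs the factor \<kappa>, and replacing its mean by the mean
  over the cube costs the factor 2. The summand e keeps the bound positive when the norm
  vanishes.\<close>

lemma bmo_tree_mu_lam:
  assumes lam: "0 < lam" and D: "dyadic_system \<delta> c0 C0 D" and b: "in_BMO lam b" and e: "0 < e"
  defines "\<kappa> \<equiv> doubling_const lam (2 * C0 / (c0 * \<delta>))"
  shows "bmo_tree (mu_lam lam) D {0<..} \<kappa> b (2 * \<kappa> * bmo_norm lam b + e)"
proof -
  let ?M = "mu_lam lam" and ?n = "bmo_norm lam b"
  interpret dyadic_tree ?M D "{0<..}" \<kappa>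
    unfolding \<kappa>_def by (rule dyadic_system_tree(1)[OF lam D])
  have inI: "\<exists>I\<in>intervals_Rplus. Q \<subseteq> I \<and> emeasure ?M I \<le> ennreal \<kappa> * emeasure ?M Q" if "Q \<in> D k" for k Q
    unfolding \<kappa>_def by (rule dyadic_system_tree(2)[OF lam D that])
  have bm [measurable]: "b \<in> borel_measurable borel" using b by (simp add: in_BMO_def)
  have n0: "0 \<le> ?n" using b by (rule bmo_norm_nonneg)
  have bQ: "set_integrable ?M Q b" if Q: "Q \<in> D k" for k Q
  proof -
    obtain I where "I \<in> intervals_Rplus" "Q \<subseteq> I" using inI[OF Q] by blast
    moreover have "Q \<in> sets ?M" using cube_sets[OF Q] by simp
    ultimately show ?thesis using b unfolding in_BMO_def by (meson set_integrable_subset)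
  qed
  show ?thesis
  proof
    show "0 < 2 * \<kappa> * ?n + e" using n0 e \<kappa>_ge_1 by (intro add_nonneg_pos mult_nonneg_nonneg) auto
    fix k Q assume Q: "Q \<in> D k"
    then show "set_integrable ?M Q b" by (rule bQ)
    have Qc: "Q \<in> cubes" using Q by (rule cubesI)
    have [measurable]: "Q \<in> sets borel" using Q by (rule cube_sets)
    obtain I where I: "I \<in> intervals_Rplus" "Q \<subseteq> I" "emeasure ?M I \<le> ennreal \<kappa> * emeasure ?M Q"
      using inI[OF Q] by blast
    define c where "c = avg_mu lam I b"
    define a where "a = (\<integral>t\<in>Q. b t \<partial>?M) / measure ?M Q"
    have J: "(\<integral>\<^sup>+t\<in>Q. ennreal \<bar>b t - c\<bar> \<partial>?M) \<le> ennreal ?n * (ennreal \<kappa> * emeasure ?M Q)"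
    proof -
      have "(\<integral>\<^sup>+t\<in>Q. ennreal \<bar>b t - c\<bar> \<partial>?M) \<le> (\<integral>\<^sup>+t\<in>I. ennreal \<bar>b t - c\<bar> \<partial>?M)"
        using I by (intro nn_integral_mono) (auto simp: indicator_def)
      also have "\<dots> \<le> ennreal ?n * emeasure ?M I"
        unfolding c_def by (rule interval_oscillation[OF lam b I(1)])
      also have "\<dots> \<le> ennreal ?n * (ennreal \<kappa> * emeasure ?M Q)"
        using I by (intro mult_left_mono) auto
      finally show ?thesis .
    qed
    have ad: "ennreal \<bar>a - c\<bar> * emeasure ?M Q \<le> (\<integral>\<^sup>+t\<in>Q. ennreal \<bar>b t - c\<bar> \<partial>?M)"
      unfolding a_def using cube_measure_pos[OF Qc] cube_emeasure(2)[OF Qc] bQ[OF Q]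
      by (intro average_diff_le) auto
    have "(\<integral>\<^sup>+t\<in>Q. ennreal \<bar>b t - a\<bar> \<partial>?M)
      \<le> (\<integral>\<^sup>+t. ennreal \<bar>b t - c\<bar> * indicator Q t + ennreal \<bar>a - c\<bar> * indicator Q t \<partial>?M)"
      by (intro nn_integral_mono) (auto simp: indicator_def simp flip: ennreal_plus intro!: ennreal_leI)
    also have "\<dots> = (\<integral>\<^sup>+t\<in>Q. ennreal \<bar>b t - c\<bar> \<partial>?M) + ennreal \<bar>a - c\<bar> * emeasure ?M Q"
      by (subst nn_integral_add) (auto simp: nn_integral_cmult_indicator)
    also have "\<dots> \<le> ennreal ?n * (ennreal \<kappa> * emeasure ?M Q) + ennreal ?n * (ennreal \<kappa> * emeasure ?M Q)"
      using ad J by (intro add_mono) (auto intro: order_trans)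
    also have "\<dots> = ennreal (2 * \<kappa> * ?n) * emeasure ?M Q"
    proof -
      have "ennreal (2 * \<kappa> * ?n) = ennreal ?n * ennreal \<kappa> + ennreal ?n * ennreal \<kappa>"
        using n0 \<kappa>_ge_1 by (simp add: ennreal_mult[symmetric] flip: ennreal_plus)
      then show ?thesis by (simp add: distrib_right mult.assoc)
    qed
    also have "\<dots> \<le> ennreal (2 * \<kappa> * ?n + e) * emeasure ?M Q"
      using e by (intro mult_right_mono ennreal_leI) auto
    finally show "(\<integral>\<^sup>+t\<in>Q. ennreal \<bar>b t - (\<integral>t\<in>Q. b t \<partial>?M) / measure ?M Q\<bar> \<partial>?M)
      \<le> ennreal (2 * \<kappa> * ?n + e) * emeasure ?M Q"
      unfolding a_def .
  qed (rule bm)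
qed

lemma Ap_interval:
  assumes lam: "0 < lam" and p: "1 < p" and w: "in_Ap_tilde lam p w" and I: "I \<in> intervals_Rplus"
  obtains u t where "0 \<le> u" "0 \<le> t"
    "(\<integral>\<^sup>+x\<in>I. ennreal (dual_weight_v lam w x) \<partial>mu_lam lam) = ennreal u"
    "(\<integral>\<^sup>+x\<in>I. ennreal (dual_weight_s lam p w x) \<partial>mu_lam lam) = ennreal t"
    "u / measure (mu_lam lam) I * (t / measure (mu_lam lam) I) powr (p - 1) = Ap_char lam p w I"
    "Ap_char lam p w I \<le> Ap_const lam p w"
proof -
  note Im = interval_mu_lam[OF lam I]
  let ?s = "\<lambda>t. t powr (2 * lam * (p / (p - 1))) * w t powr (- 1 / (p - 1))"
  have w0: "0 \<le> w t" if "0 < t" for t using w that by (simp add: in_Ap_tilde_def)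
  have wi: "set_integrable lborel I w" "set_integrable lborel I ?s"
    using w I by (auto simp: in_Ap_tilde_def)
  show ?thesis
  proof (rule that)
    have nn: "0 \<le> w x" if "x \<in> I" for x using w0 that Im(2) by auto
    show "0 \<le> (\<integral>t\<in>I. w t \<partial>lborel)" "0 \<le> (\<integral>t\<in>I. ?s t \<partial>lborel)"
      using nn unfolding set_lebesgue_integral_def by (auto intro!: integral_nonneg simp: indicator_def)
    have "(\<integral>\<^sup>+x\<in>I. ennreal (dual_weight_v lam w x) \<partial>mu_lam lam)
      = (\<integral>\<^sup>+x. indicator I x * ennreal (dual_weight_v lam w x) \<partial>mu_lam lam)"
      by (simp add: mult.commute)
    also have "\<dots> = (\<integral>\<^sup>+x\<in>{0<..}. indicator I x * ennreal (w x) \<partial>lborel)"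
      using Im(1) by (intro nn_integral_dual_weight_v[OF w]) auto
    also have "\<dots> = (\<integral>\<^sup>+x\<in>I. ennreal (w x) \<partial>lborel)"
      using Im(2) by (intro nn_integral_cong) (auto simp: indicator_def)
    also have "\<dots> = ennreal (\<integral>t\<in>I. w t \<partial>lborel)"
      by (rule set_nn_integral_eq_integral[OF wi(1) nn])
    finally show "(\<integral>\<^sup>+x\<in>I. ennreal (dual_weight_v lam w x) \<partial>mu_lam lam) = ennreal (\<integral>t\<in>I. w t \<partial>lborel)" .
    show "(\<integral>\<^sup>+x\<in>I. ennreal (dual_weight_s lam p w x) \<partial>mu_lam lam) = ennreal (\<integral>t\<in>I. ?s t \<partial>lborel)"
      unfolding nn_integral_dual_weight_s[OF p w Im(1,2)]
      by (rule set_nn_integral_eq_integral[OF wi(2)]) simp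
    show "Ap_char lam p w I \<le> Ap_const lam p w"
      unfolding Ap_const_def using w I by (intro cSUP_upper) (auto simp: in_Ap_tilde_def)
  qed (simp add: Ap_char_def)
qed

text \<open>Hoelder's inequality on a single interval is enough. The bound lets lower powers of the
  characteristic be absorbed into higher ones.\<close>

lemma Ap_const_ge_1:
  assumes lam: "0 < lam" and p: "1 < p" and w: "in_Ap_tilde lam p w"
  shows "1 \<le> Ap_const lam p w"
proof -
  let ?M = "mu_lam lam" and ?I = "{0<..<1::real}" and ?q = "p / (p - 1)"
  have I: "?I \<in> intervals_Rplus" by (force simp: intervals_Rplus_def)
  note Im = interval_mu_lam[OF lam I]
  have "w \<in> borel_measurable borel" using w by (simp add: in_Ap_tilde_def)
  then interpret dual_weights ?M p ?q "dual_weight_v lam w" "dual_weight_s lam p w"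
    by (rule dual_weights_mu_lam[OF p])
  obtain u t where ut: "0 \<le> u" "0 \<le> t"
    "(\<integral>\<^sup>+x\<in>?I. ennreal (dual_weight_v lam w x) \<partial>?M) = ennreal u"
    "(\<integral>\<^sup>+x\<in>?I. ennreal (dual_weight_s lam p w x) \<partial>?M) = ennreal t"
    and char: "u / measure ?M ?I * (t / measure ?M ?I) powr (p - 1) = Ap_char lam p w ?I"
    and le: "Ap_char lam p w ?I \<le> Ap_const lam p w"
    by (rule Ap_interval[OF lam p w I])
  define m where "m = measure ?M ?I"
  have m: "0 < m" using Im(5) by (simp add: m_def)
  have "m \<le> u powr (1 / p) * t powr (1 / ?q)"
    using Im ut m by (intro Holder_measure[of ?I]) (auto simp: m_def)
  then have "m powr p \<le> (u powr (1 / p) * t powr (1 / ?q)) powr p"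
    using m p by (intro powr_mono2) auto
  also have "\<dots> = u * t powr (p - 1)"
    using ut p by (simp add: powr_mult powr_powr)
  finally have "m powr p \<le> u * t powr (p - 1)" .
  moreover have "u / m * (t / m) powr (p - 1) = u * t powr (p - 1) / m powr p"
  proof -
    have "m powr p = m * m powr (p - 1)" using m by (simp add: powr_diff)
    then show ?thesis using ut m by (simp add: powr_divide)
  qed
  ultimately have "1 \<le> u / m * (t / m) powr (p - 1)" using m by simp
  then show ?thesis using char le by (simp add: m_def)
qed

text \<open>Masses on Q are at most those on a surrounding interval, whose measure is at most
  \<kappa> times that of Q. The two averages enter with total degree 1 + (p - 1), hence the factor
  \<kappa>^p.\<close>

lemma Ap_on_cubes:
  assumes lam: "0 < lam" and p: "1 < p" and w: "in_Ap_tilde lam p w" and D: "dyadic_system \<delta> c0 C0 D"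
  defines "\<kappa> \<equiv> doubling_const lam (2 * C0 / (c0 * \<delta>))"
  shows "dual_weights.Ap_on (mu_lam lam) p (dual_weight_v lam w) (dual_weight_s lam p w)
     (dyadic_tree.cubes D) (\<kappa> powr p * Ap_const lam p w)"
proof -
  let ?M = "mu_lam lam"
  interpret dyadic_tree ?M D "{0<..}" \<kappa>
    unfolding \<kappa>_def by (rule dyadic_system_tree(1)[OF lam D])
  have "w \<in> borel_measurable borel" using w by (simp add: in_Ap_tilde_def)
  then interpret dual_weights ?M p "p / (p - 1)" "dual_weight_v lam w" "dual_weight_s lam p w"
    by (rule dual_weights_mu_lam[OF p])
  show ?thesis unfolding Ap_on_def
  proof
    fix Q assume Qc: "Q \<in> cubes"
    then obtain k where Q: "Q \<in> D k" by (rule cubesE)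
    obtain I where I: "I \<in> intervals_Rplus" "Q \<subseteq> I" "emeasure ?M I \<le> ennreal \<kappa> * emeasure ?M Q"
      using dyadic_system_tree(2)[OF lam D Q] unfolding \<kappa>_def by blast
    note Im = interval_mu_lam[OF lam I(1)]
    obtain u t where ut: "0 \<le> u" "0 \<le> t"
      "(\<integral>\<^sup>+x\<in>I. ennreal (dual_weight_v lam w x) \<partial>?M) = ennreal u"
      "(\<integral>\<^sup>+x\<in>I. ennreal (dual_weight_s lam p w x) \<partial>?M) = ennreal t"
      and char: "u / measure ?M I * (t / measure ?M I) powr (p - 1) = Ap_char lam p w I"
      and le: "Ap_char lam p w I \<le> Ap_const lam p w"
      by (rule Ap_interval[OF lam p w I(1)])
    have "(\<integral>\<^sup>+x\<in>Q. ennreal (dual_weight_v lam w x) \<partial>?M) \<le> ennreal u"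
      unfolding ut(3)[symmetric] using I(2) by (intro nn_integral_mono) (auto simp: indicator_def)
    then obtain u' where u': "0 \<le> u'" "u' \<le> u" "(\<integral>\<^sup>+x\<in>Q. ennreal (dual_weight_v lam w x) \<partial>?M) = ennreal u'"
      using ut(1) by (cases "\<integral>\<^sup>+x\<in>Q. ennreal (dual_weight_v lam w x) \<partial>?M") (auto simp: top_unique)
    have "(\<integral>\<^sup>+x\<in>Q. ennreal (dual_weight_s lam p w x) \<partial>?M) \<le> ennreal t"
      unfolding ut(4)[symmetric] using I(2) by (intro nn_integral_mono) (auto simp: indicator_def)
    then obtain t' where t': "0 \<le> t'" "t' \<le> t" "(\<integral>\<^sup>+x\<in>Q. ennreal (dual_weight_s lam p w x) \<partial>?M) = ennreal t'"
      using ut(2) by (cases "\<integral>\<^sup>+x\<in>Q. ennreal (dual_weight_s lam p w x) \<partial>?M") (auto simp: top_unique)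
    define m n where "m = measure ?M Q" and "n = measure ?M I"
    have m: "0 < m" and n: "0 < n" using cube_measure_pos[OF Qc] Im(5) by (auto simp: m_def n_def)
    have nm: "n \<le> \<kappa> * m"
    proof -
      have "ennreal n \<le> ennreal (\<kappa> * m)"
        using I(3) \<kappa>_ge_1 m unfolding Im(6) cube_emeasure_eq[OF Qc] by (simp add: m_def n_def ennreal_mult)
      then show ?thesis using m \<kappa>_ge_1 by simp
    qed
    have div: "x' / m \<le> \<kappa> * (x / n)" if "0 \<le> x'" "x' \<le> x" for x x'
    proof -
      have "x' * n \<le> x * (\<kappa> * m)" using that nm n by (intro mult_mono) auto
      then show ?thesis using m n by (simp add: field_simps)
    qed
    have "u' / m * (t' / m) powr (p - 1) \<le> \<kappa> * (u / n) * (\<kappa> * (t / n)) powr (p - 1)"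
    proof (rule mult_mono)
      show "u' / m \<le> \<kappa> * (u / n)" using u' by (intro div) auto
      show "(t' / m) powr (p - 1) \<le> (\<kappa> * (t / n)) powr (p - 1)"
        using t' p m by (intro powr_mono2 div) auto
      show "0 \<le> \<kappa> * (u / n)" using \<kappa>_ge_1 ut n by (intro mult_nonneg_nonneg) auto
    qed simp
    also have "\<dots> = \<kappa> powr p * (u / n * (t / n) powr (p - 1))"
    proof -
      have "\<kappa> powr p = \<kappa> * \<kappa> powr (p - 1)" using \<kappa>_ge_1 by (simp add: powr_diff)
      moreover have "(\<kappa> * (t / n)) powr (p - 1) = \<kappa> powr (p - 1) * (t / n) powr (p - 1)"
        by (rule powr_mult)
      ultimately show ?thesis by (simp only: mult_ac)
    qed
    also have "\<dots> \<le> \<kappa> powr p * Ap_const lam p w"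
      using char le by (intro mult_left_mono) (auto simp: n_def)
    finally show "\<exists>u t. 0 \<le> u \<and> 0 \<le> t
       \<and> (\<integral>\<^sup>+x\<in>Q. ennreal (dual_weight_v lam w x) \<partial>?M) = ennreal u
       \<and> (\<integral>\<^sup>+x\<in>Q. ennreal (dual_weight_s lam p w x) \<partial>?M) = ennreal t
       \<and> u / measure ?M Q * (t / measure ?M Q) powr (p - 1) \<le> \<kappa> powr p * Ap_const lam p w"
      using u' t' by (auto simp: m_def)
  qed
qed

text \<open>\<open>comm_form_bound\<close> is applied with B equal to 2 \<kappa> times the norm plus
  e. The coefficient A does not involve e, so e can tend to 0; 12 \<kappa>^2 is the product of 6
  \<kappa> and 2 \<kappa>.\<close>

lemma comm_form_mu_lam_bound:
  assumes lam: "0 < lam" and D: "dyadic_system \<delta> c0 C0 D" and b: "in_BMO lam b"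
  defines "\<kappa> \<equiv> doubling_const lam (2 * C0 / (c0 * \<delta>))"
  assumes W: "dual_weights (mu_lam lam) p q v s"
    and S: "sparse_family (mu_lam lam) \<Lambda> N S" "S \<subseteq> dyadic_tree.cubes D" "0 < \<Lambda>"
    and Ap: "dual_weights.Ap_on (mu_lam lam) p v s (dyadic_tree.cubes D) K" and K: "1 \<le> K"
    and f: "f \<in> borel_measurable (mu_lam lam)" "Lp_pow (mu_lam lam) p v f \<le> 1"
    and g: "g \<in> borel_measurable (mu_lam lam)" "Lp_pow (mu_lam lam) q s g \<le> 1"
  shows "comm_form (mu_lam lam) (\<lambda>Q. avg_mu lam Q b) b S f g
    \<le> ennreal (12 * \<kappa>\<^sup>2 * (dual_weights.sparse_const p q \<Lambda> N * (1 + dual_weights.sparse_const p q (1/2) 1))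
        * bmo_norm lam b * K powr (2 * max 1 (1 / (p - 1))))"
proof -
  interpret W: dual_weights "mu_lam lam" p q v s by fact
  define c where "c = W.sparse_const \<Lambda> N * (1 + W.sparse_const (1/2) 1)"
  define A where "A = 6 * \<kappa> * c * K powr (2 * max 1 (1 / (p - 1)))"
  have \<kappa>: "1 \<le> \<kappa>"
    unfolding \<kappa>_def by (rule dyadic_tree.\<kappa>_ge_1[OF dyadic_system_tree(1)[OF lam D]])
  have c: "0 \<le> c"
    using W.sparse_const_pos[OF S(3), of N] W.sparse_const_pos[of "1/2" 1] by (simp add: c_def)
  have A: "0 \<le> A" using \<kappa> c by (simp add: A_def)
  have n0: "0 \<le> bmo_norm lam b" using b by (rule bmo_norm_nonneg)
  have "comm_form (mu_lam lam) (\<lambda>Q. avg_mu lam Q b) b S f g \<le> ennreal A * ennreal (2 * \<kappa> * bmo_norm lam b)"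
  proof (rule ennreal_le_mult_epsilon[OF A])
    fix e :: real assume e: "0 < e"
    interpret bmo_tree "mu_lam lam" D "{0<..}" \<kappa> b "2 * \<kappa> * bmo_norm lam b + e"
      unfolding \<kappa>_def by (rule bmo_tree_mu_lam[OF lam D b e])
    have avg: "avg = (\<lambda>Q. avg_mu lam Q b)"
      by (rule ext) (simp add: avg_def avg_mu_def)
    have "comm_form (mu_lam lam) (\<lambda>Q. avg_mu lam Q b) b S f g
      \<le> ennreal (6 * \<kappa> * (2 * \<kappa> * bmo_norm lam b + e) * c * K powr (2 * max 1 (1 / (p - 1))))"
      using comm_form_bound[OF W S Ap K f g] unfolding avg c_def .
    also have "6 * \<kappa> * (2 * \<kappa> * bmo_norm lam b + e) * c * K powr (2 * max 1 (1 / (p - 1)))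
       = A * (2 * \<kappa> * bmo_norm lam b + e)"
      by (simp add: A_def mult_ac)
    also have "ennreal (A * (2 * \<kappa> * bmo_norm lam b + e)) = ennreal A * (ennreal (2 * \<kappa> * bmo_norm lam b) + ennreal e)"
      using A n0 \<kappa> e by (simp add: ennreal_mult)
    finally show "comm_form (mu_lam lam) (\<lambda>Q. avg_mu lam Q b) b S f g
       \<le> ennreal A * (ennreal (2 * \<kappa> * bmo_norm lam b) + ennreal e)" .
  qed
  also have "\<dots> = ennreal (A * (2 * \<kappa> * bmo_norm lam b))"
    using A n0 \<kappa> by (simp add: ennreal_mult)
  also have "A * (2 * \<kappa> * bmo_norm lam b) = 12 * \<kappa>\<^sup>2 * c * bmo_norm lam b * K powr (2 * max 1 (1 / (p - 1)))"
    by (simp add: A_def power2_eq_square mult_ac)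
  finally show ?thesis unfolding c_def .
qed

lemma sparse_imp_sparse_family:
  assumes lam: "0 < lam" and D: "dyadic_system \<delta> c0 C0 D" and S: "sparse lam \<Lambda> N D S"
  shows "sparse_family (mu_lam lam) \<Lambda> N S" "S \<subseteq> dyadic_tree.cubes D"
proof -
  interpret dyadic_tree "mu_lam lam" D "{0<..}" "doubling_const lam (2 * C0 / (c0 * \<delta>))"
    by (rule dyadic_system_tree(1)[OF lam D])
  show sub: "S \<subseteq> cubes" using S by (auto simp: sparse_def dyadic_cubes_def cubes_def)
  obtain E where "\<forall>Q\<in>S. E Q \<subseteq> Q \<and> E Q \<in> sets borel \<and> measure (mu_lam lam) (E Q) \<ge> \<Lambda> * measure (mu_lam lam) Q"
    "\<forall>x. finite {Q\<in>S. x \<in> E Q} \<and> card {Q\<in>S. x \<in> E Q} \<le> N"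
    using S unfolding sparse_def by blast
  then have "\<exists>E. (\<forall>Q\<in>S. E Q \<in> sets (mu_lam lam) \<and> E Q \<subseteq> Q \<and> \<Lambda> * measure (mu_lam lam) Q \<le> measure (mu_lam lam) (E Q))
          \<and> (\<forall>x. finite {Q\<in>S. x \<in> E Q} \<and> card {Q\<in>S. x \<in> E Q} \<le> N)"
    by auto
  then show "sparse_family (mu_lam lam) \<Lambda> N S"
    unfolding sparse_family_def
    using countable_subset[OF sub countable_cubes] laminar_subset[OF laminar_cubes sub] sub cube_measurable cube_emeasure
    by (auto simp: subset_iff)
qed

lemma Lp_w_pow_eq:
  assumes w: "in_Ap_tilde lam p w" and f: "f \<in> borel_measurable borel"
  shows "(\<integral>\<^sup>+x. epow (ennreal \<bar>f x\<bar>) p * ennreal (dual_weight_v lam w x) \<partial>mu_lam lam) = Lp_w_pow p w f"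
proof -
  note f [measurable]
  have "0 \<le> w x" if "0 < x" for x using w that by (simp add: in_Ap_tilde_def)
  then show ?thesis
    unfolding Lp_w_pow_def
    by (subst nn_integral_dual_weight_v[OF w])
      (auto intro!: nn_integral_cong simp: indicator_def ennreal_mult)
qed

text \<open>Finiteness of the \<open>L\<^sup>p\<close> bound gives absolute summability almost everywhere.\<close>

lemma real_sum_from_ennreal_operator:
  fixes \<tau> :: "real \<Rightarrow> 'i \<Rightarrow> real" and \<theta> :: "real \<Rightarrow> 'i \<Rightarrow> ennreal"
  assumes p: "1 < p" and w: "in_Ap_tilde lam p w"
    and dom: "\<And>x Q. Q \<in> S \<Longrightarrow> ennreal \<bar>\<tau> x Q\<bar> \<le> \<theta> x Q"
    and Op: "\<And>x. Op x = (\<integral>\<^sup>+Q. \<theta> x Q \<partial>count_space S)" "Op \<in> borel_measurable borel"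
    and le: "Lp_pow (mu_lam lam) p (dual_weight_v lam w) Op \<le> C" and C: "C < top"
  shows "(AE x in lborel. x > 0 \<longrightarrow> \<tau> x summable_on S) \<and> Lp_w_pow p w (\<lambda>x. \<Sum>\<^sub>\<infinity>Q\<in>S. \<tau> x Q) \<le> C"
proof -
  note Op(2) [measurable]
  have wm [measurable]: "w \<in> borel_measurable borel" using w by (simp add: in_Ap_tilde_def)
  interpret dual_weights "mu_lam lam" p "p / (p - 1)" "dual_weight_v lam w" "dual_weight_s lam p w"
    by (rule dual_weights_mu_lam[OF p wm])
  have "Lp_pow (mu_lam lam) p (dual_weight_v lam w) Op \<noteq> \<infinity>"
    using le C by (auto simp: top_unique)
  then have "AE x in mu_lam lam. epow (Op x) p * ennreal (dual_weight_v lam w x) \<noteq> \<infinity>"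
    by (intro nn_integral_PInf_AE) measurable
  then have "AE x in mu_lam lam. Op x < top"
  proof (rule AE_mp, intro AE_I2 impI)
    fix x assume "epow (Op x) p * ennreal (dual_weight_v lam w x) \<noteq> \<infinity>"
    then show "Op x < top"
      using dual_weight_v_pos[of lam w x]
      by (cases "Op x = top") (auto simp: ennreal_top_mult ennreal_eq_0_iff less_top)
  qed
  then have fin: "AE x in lborel. 0 < x \<longrightarrow> Op x < top" by (simp add: AE_mu_lam_iff)
  have sums: "\<tau> x summable_on S" "ennreal \<bar>\<Sum>\<^sub>\<infinity>Q\<in>S. \<tau> x Q\<bar> \<le> Op x" if x: "Op x < top" for x
  proof -
    obtain r where r: "0 \<le> r" "Op x = ennreal r" using x by (cases "Op x") auto
    have F: "(\<Sum>Q\<in>F. \<bar>\<tau> x Q\<bar>) \<le> r" if "finite F" "F \<subseteq> S" for F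
    proof -
      have "ennreal (\<Sum>Q\<in>F. \<bar>\<tau> x Q\<bar>) = (\<Sum>Q\<in>F. ennreal \<bar>\<tau> x Q\<bar>)" by simp
      also have "\<dots> \<le> (\<Sum>Q\<in>F. \<theta> x Q)" using that dom by (intro sum_mono) auto
      also have "\<dots> \<le> Op x" unfolding Op(1) by (rule sum_le_nn_integral_count_space[OF that])
      finally show ?thesis using r by simp
    qed
    have abs: "(\<lambda>Q. \<bar>\<tau> x Q\<bar>) summable_on S"
      using F by (intro nonneg_bdd_above_summable_on) (auto intro!: bdd_aboveI)
    then show "\<tau> x summable_on S"
      using summable_on_iff_abs_summable_on_real[of "\<tau> x" S] by simp
    have "\<bar>\<Sum>\<^sub>\<infinity>Q\<in>S. \<tau> x Q\<bar> \<le> (\<Sum>\<^sub>\<infinity>Q\<in>S. \<bar>\<tau> x Q\<bar>)"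
      using norm_infsum_bound[of "\<tau> x" S] abs by simp
    also have "\<dots> \<le> r" by (rule infsum_le_finite_sums[OF abs F])
    finally show "ennreal \<bar>\<Sum>\<^sub>\<infinity>Q\<in>S. \<tau> x Q\<bar> \<le> Op x" using r by (simp add: ennreal_leI)
  qed
  have "AE x in lborel. x > 0 \<longrightarrow> \<tau> x summable_on S"
    using fin by (rule AE_mp) (use sums in auto)
  moreover have "Lp_w_pow p w (\<lambda>x. \<Sum>\<^sub>\<infinity>Q\<in>S. \<tau> x Q) \<le> C"
  proof -
    have "Lp_w_pow p w (\<lambda>x. \<Sum>\<^sub>\<infinity>Q\<in>S. \<tau> x Q) \<le> (\<integral>\<^sup>+x\<in>{0<..}. epow (Op x) p * ennreal (w x) \<partial>lborel)"
      unfolding Lp_w_pow_def using fin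
    proof (intro nn_integral_mono_AE, elim AE_mp, intro AE_I2 impI)
      fix x assume x: "0 < x \<longrightarrow> Op x < top"
      show "ennreal (\<bar>\<Sum>\<^sub>\<infinity>Q\<in>S. \<tau> x Q\<bar> powr p * w x) * indicator {0<..} x
        \<le> epow (Op x) p * ennreal (w x) * indicator {0<..} x"
      proof (cases "0 < x")
        case True
        then have w0: "0 \<le> w x" using w by (simp add: in_Ap_tilde_def)
        have "ennreal (\<bar>\<Sum>\<^sub>\<infinity>Q\<in>S. \<tau> x Q\<bar> powr p * w x) = epow (ennreal \<bar>\<Sum>\<^sub>\<infinity>Q\<in>S. \<tau> x Q\<bar>) p * ennreal (w x)"
          using w0 by (simp add: ennreal_mult)
        also have "\<dots> \<le> epow (Op x) p * ennreal (w x)"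
          using x True p by (intro mult_right_mono epow_mono sums) auto
        finally show ?thesis using True by simp
      qed simp
    qed
    also have "\<dots> = Lp_pow (mu_lam lam) p (dual_weight_v lam w) Op"
      by (rule nn_integral_dual_weight_v[OF w, symmetric]) measurable
    finally show ?thesis using le by (rule order_trans)
  qed
  ultimately show ?thesis ..
qed

text \<open>The integral of a non-integrable function is 0 by convention, so the terms of the
  operators can be estimated before integrability over Q is known.\<close>

lemma ennreal_abs_set_integral_le:
  fixes h :: "'a \<Rightarrow> real"
  shows "ennreal \<bar>\<integral>t\<in>Q. h t \<partial>M\<bar> \<le> (\<integral>\<^sup>+t\<in>Q. ennreal \<bar>h t\<bar> \<partial>M)"
proof (cases "set_integrable M Q h")
  case True
  have "ennreal (norm (\<integral>t. indicator Q t *\<^sub>R h t \<partial>M)) \<le> (\<integral>\<^sup>+t. ennreal (norm (indicator Q t *\<^sub>R h t)) \<partial>M)"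
    using True unfolding set_integrable_def by (rule integral_norm_bound_ennreal)
  also have "\<dots> = (\<integral>\<^sup>+t\<in>Q. ennreal \<bar>h t\<bar> \<partial>M)"
    by (intro nn_integral_cong) (auto simp: indicator_def)
  finally show ?thesis by (simp add: set_lebesgue_integral_def)
next
  case False
  then show ?thesis
    by (simp add: set_lebesgue_integral_def set_integrable_def not_integrable_integral_eq)
qed

theorem theorem1p6:
  fixes lam p \<Lambda> \<delta> c0 C0 :: real and D :: "int \<Rightarrow> real set set" and N :: nat
  assumes "lam > 0" and "1 < p" and "0 < \<Lambda>" and "\<Lambda> < 1"
    and "dyadic_system \<delta> c0 C0 D"
  shows "\<exists>C>0. \<forall>S b w f.
           sparse lam \<Lambda> N D S \<and> in_BMO lam b \<and> in_Ap_tilde lam p w \<and> in_Lp_w p w f \<longrightarrow>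
             (AE x in lborel. x > 0 \<longrightarrow> (comm_term lam b f x) summable_on S)
           \<and> (AE x in lborel. x > 0 \<longrightarrow> (comm_adj_term lam b f x) summable_on S)
           \<and> Lp_w_pow p w (sparse_comm lam S b f)
               \<le> ennreal ((C * bmo_norm lam b * Ap_const lam p w powr (2 * max 1 (1 / (p - 1)))) powr p)
                   * Lp_w_pow p w f
           \<and> Lp_w_pow p w (sparse_comm_adj lam S b f)
               \<le> ennreal ((C * bmo_norm lam b * Ap_const lam p w powr (2 * max 1 (1 / (p - 1)))) powr p)
                   * Lp_w_pow p w f"
proof -
  note lam = assms(1) and p = assms(2) and \<Lambda> = assms(3) and D = assms(5)
  let ?M = "mu_lam lam" and ?e = "max 1 (1 / (p - 1))"
  define q where "q = p / (p - 1)"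
  define \<kappa> where "\<kappa> = doubling_const lam (2 * C0 / (c0 * \<delta>))"
  have W: "dual_weights ?M p q (dual_weight_v lam w) (dual_weight_s lam p w)"
    if "w \<in> borel_measurable borel" for w
    unfolding q_def using that by (rule dual_weights_mu_lam[OF p])
  \<comment> \<open>Apart from \<Lambda> and N, \<open>sparse_const\<close> depends on p and q
    alone. The instance with weight 1 names it before any w is chosen, which makes C independent of
    w.\<close>
  interpret one: dual_weights ?M p q "dual_weight_v lam (\<lambda>_. 1)" "dual_weight_s lam p (\<lambda>_. 1)"
    by (rule W) simp
  interpret one': dual_weights ?M q p "dual_weight_s lam p (\<lambda>_. 1)" "dual_weight_v lam (\<lambda>_. 1)"
    by (rule one.swap)
  interpret dyadic_tree ?M D "{0<..}" \<kappa>
    unfolding \<kappa>_def by (rule dyadic_system_tree(1)[OF lam D])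
  define c where "c = 12 * \<kappa>\<^sup>2 * (one.sparse_const \<Lambda> N * (1 + one.sparse_const (1/2) 1))"
  \<comment> \<open>The second factor pays for returning from K, the characteristic on cubes, to the
    characteristic on intervals.\<close>
  define C where "C = c * (\<kappa> powr p) powr (2 * ?e)"
  have c: "0 < c"
    unfolding c_def using one.sparse_const_pos[OF \<Lambda>, of N] one.sparse_const_pos[of "1/2" 1] \<kappa>_ge_1
    by (intro mult_pos_pos add_pos_pos) auto
  have C: "0 < C" unfolding C_def using c \<kappa>_ge_1 by (intro mult_pos_pos) auto
  have const_swap: "one'.sparse_const x n = one.sparse_const x n" for x n
    unfolding one.sparse_const_def one'.sparse_const_def by (simp add: add.commute)
  show ?thesis
  proof (intro exI[of _ C] conjI[OF C] allI impI, elim conjE)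
    fix S b w f
    assume S: "sparse lam \<Lambda> N D S" and b: "in_BMO lam b" and w: "in_Ap_tilde lam p w" and f: "in_Lp_w p w f"
    define A where "A = Ap_const lam p w"
    define K where "K = \<kappa> powr p * A"
    define a where "a Q = avg_mu lam Q b" for Q
    define B where "B = C * bmo_norm lam b * A powr (2 * ?e)"
    have wm [measurable]: "w \<in> borel_measurable borel" using w by (simp add: in_Ap_tilde_def)
    have bm [measurable]: "b \<in> borel_measurable borel" using b by (simp add: in_BMO_def)
    have fm [measurable]: "f \<in> borel_measurable borel" and Lf: "Lp_w_pow p w f < top"
      using f by (auto simp: in_Lp_w_def Lp_w_pow_def)
    let ?v = "dual_weight_v lam w" and ?s = "dual_weight_s lam p w"
    interpret V: dual_weights ?M p q ?v ?s by (rule W[OF wm])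
    have SF: "sparse_family ?M \<Lambda> N S" and Sc: "S \<subseteq> cubes"
      using sparse_imp_sparse_family[OF lam D S] by auto
    have Scount: "countable S" and Ssets: "\<And>Q. Q \<in> S \<Longrightarrow> Q \<in> sets ?M"
      using SF by (auto simp: sparse_family_def)
    have A1: "1 \<le> A" unfolding A_def by (rule Ap_const_ge_1[OF lam p w])
    have "1 * 1 \<le> \<kappa> powr p * A"
      using A1 \<kappa>_ge_1 p by (intro mult_mono ge_one_powr_ge_zero) auto
    then have K1: "1 \<le> K" by (simp add: K_def)
    have Ap: "V.Ap_on cubes K"
      unfolding K_def A_def \<kappa>_def by (rule Ap_on_cubes[OF lam p w D])
    have Ap': "dual_weights.Ap_on ?M q ?s ?v cubes (K powr (q - 1))"
      using K1 by (intro V.Ap_on_swap[OF Ap]) simp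
    have KB: "c * bmo_norm lam b * K powr (2 * ?e) = B"
    proof -
      have "K powr (2 * ?e) = (\<kappa> powr p) powr (2 * ?e) * A powr (2 * ?e)"
        unfolding K_def by (rule powr_mult)
      then show ?thesis by (simp add: B_def C_def mult_ac)
    qed
    have B0: "0 \<le> B" unfolding B_def using C bmo_norm_nonneg[OF b] by simp
    have form: "comm_form ?M a b S h g \<le> ennreal B"
      if "h \<in> borel_measurable ?M" "Lp_pow ?M p ?v h \<le> 1"
        "g \<in> borel_measurable ?M" "Lp_pow ?M q ?s g \<le> 1" for h g
      using comm_form_mu_lam_bound[OF lam D b V.dual_weights_axioms SF Sc \<Lambda> Ap K1 that]
      unfolding \<kappa>_def[symmetric] a_def[symmetric] c_def[symmetric] by (simp add: KB)
    \<comment> \<open>The transposed form is covered by the same estimate with the exponents p, q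
      and the two weights exchanged.\<close>
    have form': "comm_form ?M a b S g h \<le> ennreal B"
      if "h \<in> borel_measurable ?M" "Lp_pow ?M p ?v h \<le> 1"
        "g \<in> borel_measurable ?M" "Lp_pow ?M q ?s g \<le> 1" for h g
    proof -
      have K1': "1 \<le> K powr (q - 1)" using K1 V.q_gt_1 by (intro ge_one_powr_ge_zero) auto
      \<comment> \<open>The dual characteristic is K^(q-1), and (q - 1) max 1 (p - 1) = max (q - 1)
        1 with q - 1 = 1/(p-1). So both operators end up with the same power of K.\<close>
      have e: "(K powr (q - 1)) powr (2 * max 1 (1 / (q - 1))) = K powr (2 * ?e)"
      proof -
        have "1 / (q - 1) = p - 1" using dual_weights.exp_eqs(6)[OF V.swap] by simp
        moreover have "(q - 1) * max 1 (p - 1) = ?e"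
          using V.exp_eqs(2,6) V.q_gt_1 by (simp add: max_mult_distrib_left mult.commute max.commute)
        ultimately have "(q - 1) * (2 * max 1 (1 / (q - 1))) = 2 * ?e" by simp
        then show ?thesis by (simp only: powr_powr)
      qed
      show ?thesis
        using comm_form_mu_lam_bound[OF lam D b V.swap SF Sc \<Lambda> Ap' K1' that(3,4,1,2)]
        unfolding \<kappa>_def[symmetric] a_def[symmetric] e const_swap c_def[symmetric] by (simp add: KB)
    qed
    let ?f = "\<lambda>x. ennreal \<bar>f x\<bar>"
    have fm': "?f \<in> borel_measurable ?M" by measurable
    have bm': "b \<in> borel_measurable ?M" by measurable
    have fL: "Lp_pow ?M p ?v ?f = Lp_w_pow p w f"
      by (rule Lp_w_pow_eq[OF w fm])
    then have ffin: "Lp_pow ?M p ?v ?f < top" using Lf by simp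
    have bd: "ennreal (B powr p) * Lp_w_pow p w f < top"
      using Lf by (simp add: ennreal_mult_less_top)
    have em: "emeasure ?M Q = ennreal (measure ?M Q)" "0 < measure ?M Q" if "Q \<in> S" for Q
      using cube_emeasure_eq cube_measure_pos that Sc by auto
    have inv: "ennreal \<bar>1 / measure ?M Q * y\<bar> = ennreal \<bar>y\<bar> / emeasure ?M Q" if "Q \<in> S" for Q y
      using em[OF that] by (simp add: divide_ennreal abs_mult)
    have "Lp_pow ?M p ?v (comm_op ?M a b S ?f) \<le> ennreal (B powr p) * Lp_w_pow p w f"
      unfolding fL[symmetric]
      by (rule V.operator_bound_from_form[where form = "\<lambda>f g. comm_form ?M a b S g f",
          OF comm_op_dual(1)[OF Scount Ssets bm' fm'] fm' ffin B0 comm_op_dual(2)[OF Scount Ssets bm']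
            comm_form_cmult(2)[OF Ssets bm' _ fm'] form'])
    moreover have "ennreal \<bar>comm_term lam b f x Q\<bar>
        \<le> (\<integral>\<^sup>+t\<in>Q. ?f t \<partial>?M) / emeasure ?M Q * (ennreal \<bar>b x - a Q\<bar> * indicator Q x)" if Q: "Q \<in> S" for x Q
    proof -
      have "comm_term lam b f x Q = 1 / measure ?M Q * ((\<integral>t\<in>Q. f t \<partial>?M) * (\<bar>b x - a Q\<bar> * indicator Q x))"
        by (simp add: comm_term_def a_def mult_ac)
      then have "ennreal \<bar>comm_term lam b f x Q\<bar> = ennreal \<bar>(\<integral>t\<in>Q. f t \<partial>?M) * (\<bar>b x - a Q\<bar> * indicator Q x)\<bar> / emeasure ?M Q"
        using inv[OF Q] by simp
      also have "\<dots> = ennreal \<bar>\<integral>t\<in>Q. f t \<partial>?M\<bar> / emeasure ?M Q * (ennreal \<bar>b x - a Q\<bar> * indicator Q x)"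
        by (auto simp: abs_mult ennreal_mult indicator_def divide_ennreal_def mult_ac)
      also have "\<dots> \<le> (\<integral>\<^sup>+t\<in>Q. ?f t \<partial>?M) / emeasure ?M Q * (ennreal \<bar>b x - a Q\<bar> * indicator Q x)"
        by (intro mult_right_mono divide_right_mono_ennreal ennreal_abs_set_integral_le) simp
      finally show ?thesis .
    qed
    ultimately have 1: "(AE x in lborel. x > 0 \<longrightarrow> comm_term lam b f x summable_on S)
      \<and> Lp_w_pow p w (\<lambda>x. \<Sum>\<^sub>\<infinity>Q\<in>S. comm_term lam b f x Q) \<le> ennreal (B powr p) * Lp_w_pow p w f"
      using bd comm_op_dual(1)[OF Scount Ssets bm' fm']
      by (intro real_sum_from_ennreal_operator[OF p w, where Op = "comm_op ?M a b S ?f" and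
          \<theta> = "\<lambda>x Q. (\<integral>\<^sup>+t\<in>Q. ?f t \<partial>?M) / emeasure ?M Q * (ennreal \<bar>b x - a Q\<bar> * indicator Q x)"])
        (auto simp: comm_op_def)
    have "Lp_pow ?M p ?v (comm_adj_op ?M a b S ?f) \<le> ennreal (B powr p) * Lp_w_pow p w f"
      unfolding fL[symmetric]
      by (rule V.operator_bound_from_form[where form = "comm_form ?M a b S",
          OF comm_adj_op_dual(1)[OF Scount Ssets fm'] fm' ffin B0 comm_adj_op_dual(2)[OF Scount Ssets]
            comm_form_cmult(1)[OF Ssets bm' fm'] form])
    moreover have "ennreal \<bar>comm_adj_term lam b f x Q\<bar>
        \<le> (\<integral>\<^sup>+t\<in>Q. ennreal \<bar>b t - a Q\<bar> * ?f t \<partial>?M) / emeasure ?M Q * indicator Q x" if Q: "Q \<in> S" for x Q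
    proof -
      have "comm_adj_term lam b f x Q = 1 / measure ?M Q * ((\<integral>t\<in>Q. \<bar>b t - a Q\<bar> * f t \<partial>?M) * indicator Q x)"
        by (simp add: comm_adj_term_def a_def)
      then have "ennreal \<bar>comm_adj_term lam b f x Q\<bar> = ennreal \<bar>(\<integral>t\<in>Q. \<bar>b t - a Q\<bar> * f t \<partial>?M) * indicator Q x\<bar> / emeasure ?M Q"
        using inv[OF Q] by simp
      also have "\<dots> = ennreal \<bar>\<integral>t\<in>Q. \<bar>b t - a Q\<bar> * f t \<partial>?M\<bar> / emeasure ?M Q * indicator Q x"
        by (auto simp: indicator_def)
      also have "\<dots> \<le> (\<integral>\<^sup>+t\<in>Q. ennreal \<bar>\<bar>b t - a Q\<bar> * f t\<bar> \<partial>?M) / emeasure ?M Q * indicator Q x"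
        by (intro mult_right_mono divide_right_mono_ennreal ennreal_abs_set_integral_le) simp
      also have "\<dots> = (\<integral>\<^sup>+t\<in>Q. ennreal \<bar>b t - a Q\<bar> * ?f t \<partial>?M) / emeasure ?M Q * indicator Q x"
        by (simp add: abs_mult ennreal_mult)
      finally show ?thesis .
    qed
    ultimately have 2: "(AE x in lborel. x > 0 \<longrightarrow> comm_adj_term lam b f x summable_on S)
      \<and> Lp_w_pow p w (\<lambda>x. \<Sum>\<^sub>\<infinity>Q\<in>S. comm_adj_term lam b f x Q) \<le> ennreal (B powr p) * Lp_w_pow p w f"
      using bd comm_adj_op_dual(1)[OF Scount Ssets fm']
      by (intro real_sum_from_ennreal_operator[OF p w, where Op = "comm_adj_op ?M a b S ?f" and
          \<theta> = "\<lambda>x Q. (\<integral>\<^sup>+t\<in>Q. ennreal \<bar>b t - a Q\<bar> * ?f t \<partial>?M) / emeasure ?M Q * indicator Q x"])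
        (auto simp: comm_adj_op_def)
    show "(AE x in lborel. x > 0 \<longrightarrow> (comm_term lam b f x) summable_on S)
       \<and> (AE x in lborel. x > 0 \<longrightarrow> (comm_adj_term lam b f x) summable_on S)
       \<and> Lp_w_pow p w (sparse_comm lam S b f)
           \<le> ennreal ((C * bmo_norm lam b * Ap_const lam p w powr (2 * max 1 (1 / (p - 1)))) powr p)
               * Lp_w_pow p w f
       \<and> Lp_w_pow p w (sparse_comm_adj lam S b f)
           \<le> ennreal ((C * bmo_norm lam b * Ap_const lam p w powr (2 * max 1 (1 / (p - 1)))) powr p)
               * Lp_w_pow p w f"
      using 1 2 unfolding sparse_comm_def[abs_def] sparse_comm_adj_def[abs_def] B_def A_def by blast
  qed
qed

end
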